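(* Let $R$ be the Baxter–Belavin elliptic $R$-matrix, $g\in\mathbb{C}$, and let $\lambda^0=(\mu,0,\dots,0)$ with $\mu\neq0$ sufficiently close to $0$. For each $r=1,\dots,n$ let $$h_r(\lambda,y)=H_r+\hbar\,a_r$$ be the decomposition in which $H_r\in A_\hbar^W$ is a (scalar) quantum elliptic Calogero–Moser Hamiltonian and $a_r\in(A_\hbar\otimes\mathrm{End}\,U)*\widehat W$ depends on $\lambda$ and is regular near $\lambda=0$. After specialising $\lambda=\lambda^0$, both $y_1$ and $a_r$ commute with $\widehat w$ for all $w\in W'$; let $\mathcal L$ and $\mathcal A_r$ be the $n\times n$ matrices with entries in $A_\hbar\otimes\mathrm{End}\,U$ representing $y_1$ and $a_r$ (at $\lambda=\lambda^0$) in the sense defined in the context. Then $\mathcal L,\mathcal A_r$, $r=1,\dots,n$, form a compatible family of quantum Lax pairs: $$\hbar^{-1}[H_r\,\mathbb 1,\mathcal L]=[\mathcal L,\mathcal A_r],\qquad r=1,\dots,n,$$ where $$\mathcal L_{ij}=-g\,R_{ij}(x_i-x_j,\mu)\ \ (i\ne j),\qquad \mathcal L_{ii}=\hat p_i .$$ Moreover, the classical limits $L=\eta_0(\mathcal L)$ and $A_r=\eta_0(\mathcal A_r)$ satisfy the classical Lax equations $\dot L=[L,A_r]$, where $\dot L=\{\eta_0(H_r),L\}$ is the time-derivative along the Hamiltonian flow of $\eta_0(H_r)$.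
   Context: Everything is over $\mathbb{C}$. $W=S_n$ acts on $V=\mathbb{C}^n$ (coordinates $x_1,\dots,x_n$) by permuting basis vectors, and on the space $\mathbb{C}(V)$ of meromorphic functions by $(w.f)(v)=f(w^{-1}.v)$. $U=U_1\otimes\cdots\otimes U_n$, $U_i\cong\mathbb{C}^d$, with $W$ permuting tensor factors; $s_{ij}$ is the transposition of $i,j$, and $s_{11}=\mathrm{id}$. $W'\cong S_{n-1}$ is the subgroup of $W$ permuting $\{2,\dots,n\}$. Algebras. $A_\hbar=\mathbb{C}[[\hbar]]\otimes\mathbb{C}(V)[\hat p_1,\dots,\hat p_n]$, $\hat p_i=\hbar\,\partial/\partial x_i$, i.e. the $\hat p_i$ commute and $[\hat p_i,f]=\hbar\,\partial_if$. $A_0=\mathbb{C}(V)[p_1,\dots,p_n]$ with Poisson bracket $\{p_i,x_j\}=\delta_{ij}$, extended entrywise to $\mathrm{End}\,U$-valued matrices when one argument is scalar. The classical limit $\eta_0:A_\hbar\to A_0$ sends $f\mapsto f$, $\hat p_i\mapsto p_i$, $\hbar\mapsto0$ (extended to $\mathrm{End}\,U$-valued elements and matrices); $\{\eta_0(a),\eta_0(b)\}=\eta_0(\hbar^{-1}[a,b])$ for $a,b\in A_\hbar$. $W$ acts on $A_\hbar$ by permuting the $x_i$ and $\hat p_i$ simultaneously. $\widehat W=\{\widehat w\}\cong W$ acts on $A_\hbar\otimes\mathrm{End}\,U$ by $\widehat w.(a\otimes b)=(w.a)\otimes(w\,b\,w^{-1})$, and $(A_\hbar\otimes\mathrm{End}\,U)*\widehat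 W$ is the crossed product (elements $\sum_wa_w\widehat w$, $\widehat w\,a=(\widehat w.a)\widehat w$). Matrices. Let $e'=\frac1{(n-1)!}\sum_{w\in W'}\widehat w$. The right $A_\hbar\otimes\mathrm{End}\,U$-module $e'\cdot\bigl((A_\hbar\otimes\mathrm{End}\,U)*\widehat W\bigr)$ is free with basis $e'\widehat s_{11},e'\widehat s_{12},\dots,e'\widehat s_{1n}$. If $a\in(A_\hbar\otimes\mathrm{End}\,U)*\widehat W$ commutes with all $\widehat w$, $w\in W'$, the matrix $[a]$ representing $a$ is defined by $a\,e'\,\widehat s_{1i}=\sum_{j=1}^ne'\,\widehat s_{1j}\,[a]_{ji}$. (Equivalently, it describes the action of $a$ on $e'M$, where $M$ is the module induced from the $\mathrm{End}\,U$-valued differential operators acting on $\mathbb{C}(V)\otimes U$.) $\mathbb 1$ is the identity $n\times n$ matrix. $R$-matrix. For $\mathrm{Im}\,\tau>0$ let $\theta(z|\tau)$ be the odd Jacobi theta function and $\phi(z,\mu|\tau)=\frac{\theta'(0|\tau)\theta(z+\mu|\tau)}{\theta(z|\tau)\theta(\mu|\tau)}$. The Baxter–Belavin $R$-matrix is $R(z,\mu)=\sum R_{\alpha\beta,\gamma\delta}(z,\mu)\,e_{\alpha\beta}\otimes e_{\gamma\delta}\in\mathrm{End}(\mathbb{C}^d\otimes\mathbb{C}^d)$, the sum over $\alpha,\beta,\gamma,\delta\in\{1,\dots,d\}$ with $\alpha+\gamma\equiv\beta+\delta\pmod d$, where $$R_{\alpha\beta,\gamma\delta}(z,\mu)=\exp\Bigl(\tfrac{2\pi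 \mathrm i}{d}\bigl((\gamma-\beta)(\beta-\alpha)\tau+(\gamma-\beta)\mu+(\beta-\alpha)z\bigr)\Bigr)\,\phi\bigl(z+(\gamma-\beta)\tau,\mu+(\beta-\alpha)\tau\,|\,d\tau\bigr).$$ $R_{ij}(z,\mu)\in\mathrm{End}\,U$ acts as $R(z,\mu)$ on $U_i\otimes U_j$ and trivially on the other factors. $\wp$ is the Weierstrass function with periods $1,\tau$. Dunkl operators. With spectral variables $\lambda=(\lambda_1,\dots,\lambda_n)$, on which $\widehat W$ does not act, $y_i=\hat p_i-g\sum_{j\ne i}R_{ij}(x_i-x_j,\lambda_i-\lambda_j)\,\widehat s_{ij}$. The $y_i$ commute pairwise and with functions of $\lambda$. $h_r(\lambda,y)$ is the result of substituting $x_i\mapsto\lambda_i$, $p_i\mapsto y_i$ into $h_r(x,p)$. Elliptic Calogero–Moser (eCM) Hamiltonians. The classical ones $h_r(x,p)=\sigma_r(p)+\text{l.o.t.}$ ($\sigma_r$ elementary symmetric) are the standard Poisson-commuting integrals of $h_1^2-2h_2=\sum_ip_i^2-2g^2\sum_{i<j}\wp(x_i-x_j)$; explicitly, $h_r$ is the sum, over all choices of a set $M$ of $m\ge0$ pairwise disjoint pairs $\{i,j\}\subset\{1,\dots,n\}$ and a set $K$ of $r-2m$ indices disjoint from these pairs, of $\prod_{\{i,j\}\in M}g^2\wp(x_i-x_j)\prod_{k\in K}p_k$. They admit pairwise commuting quantum lifts $\widetilde H_1,\dots,\widetilde H_n\in A_\hbar^W$, $\eta_0(\widetilde H_r)=h_r$,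 with $\widetilde H_1=\sum\hat p_i$ and $\widetilde H_1^2-2\widetilde H_2=\sum_i\hat p_i^2-2g(g-\hbar)\sum_{i<j}\wp(x_i-x_j)$; a scalar quantum eCM Hamiltonian is an element of $\mathbb{C}[\widetilde H_1,\dots,\widetilde H_n]$. A decomposition $h_r(\lambda,y)=H_r+\hbar a_r$ of the stated kind exists for every $r$. *)

theory Defs
  imports "HOL-Complex_Analysis.Complex_Analysis" "HOL-Combinatorics.Perm" "HOL-Library.Poly_Mapping"
    "HOL-Computational_Algebra.Formal_Power_Series"
begin

no_notation fps_nth (infixl \<open>$\<close> 75)
unbundle permutation_syntax

section \<open>Holomorphic functions of several variables\<close>

definition upd :: "complex^'k \<Rightarrow> 'k \<Rightarrow> complex \<Rightarrow> complex^'k" where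
  "upd z i t = (\<chi> k. if k = i then t else z $ k)"

text \<open>Continuous and holomorphic in each variable separately (Osgood).\<close>

definition mholo_on :: "(complex^'k \<Rightarrow> complex) \<Rightarrow> (complex^'k) set \<Rightarrow> bool" (infix \<open>mholo'_on\<close> 50) where
  "f mholo_on S \<longleftrightarrow> open S \<and> continuous_on S f \<and>
     (\<forall>z\<in>S. \<forall>i. (\<lambda>t. f (upd z i t)) field_differentiable at (z $ i))"

definition pd :: "'k \<Rightarrow> (complex^'k \<Rightarrow> complex) \<Rightarrow> complex^'k \<Rightarrow> complex" where
  "pd i f z = deriv (\<lambda>t. f (upd z i t)) (z $ i)"

lemma upd_nth [simp]: "upd z i t $ k = (if k = i then t else z $ k)"
  by (simp add: upd_def)

lemma upd_triv [simp]: "upd z i (z $ i) = z"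
  by (simp add: vec_eq_iff)

lemma upd_upd [simp]: "upd (upd z i s) i t = upd z i t"
  by (simp add: vec_eq_iff)

lemma upd_shift: "upd z i (z $ i + c) = z + axis i c"
  by (simp add: vec_eq_iff axis_def)

lemma upd_add_axis: "upd z j t + axis i c = upd (z + axis i c) j (t + axis i c $ j)"
  by (simp add: vec_eq_iff axis_def)

lemma upd_eq_axis: "upd z i t = z + axis i (t - z $ i)"
  by (simp add: vec_eq_iff axis_def)

lemma continuous_axis: "continuous_on UNIV (axis i :: complex \<Rightarrow> complex^'k)"
proof -
  have "continuous_on UNIV (\<lambda>c. \<chi> k. if k = i then c else (0::complex))"
  proof (intro continuous_on_vec_lambda)
    show "continuous_on UNIV (\<lambda>c. if k = i then c else (0::complex))" for k
      by (cases "k = i") auto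
  qed
  then show ?thesis by (simp add: axis_def)
qed

lemma continuous_on_axis [continuous_intros]:
  "continuous_on A h \<Longrightarrow> continuous_on A (\<lambda>x. axis i (h x) :: complex^'k)"
  by (rule continuous_on_compose2 [OF continuous_axis]) auto

lemma continuous_on_upd [continuous_intros]:
  "continuous_on A h \<Longrightarrow> continuous_on A (\<lambda>x. upd z i (h x))"
  unfolding upd_eq_axis by (intro continuous_intros)

lemma norm_axis: "norm (axis i c :: complex^'k) = norm c"
proof -
  have "(\<Sum>k\<in>UNIV. (norm ((axis i c :: complex^'k) $ k))\<^sup>2) = (\<Sum>k\<in>UNIV. if k = i then (norm c)\<^sup>2 else 0)"
    by (rule sum.cong) (auto simp: axis_def)
  then show ?thesis by (simp add: norm_vec_def L2_set_def)
qed

lemma dist_upd: "dist z (upd z i t) = norm (t - z $ i)"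
  by (simp add: upd_eq_axis dist_norm norm_axis)

lemma mholo_onD:
  assumes "f mholo_on S" "upd z i t \<in> S"
  shows "((\<lambda>t. f (upd z i t)) has_field_derivative pd i f (upd z i t)) (at t)"
proof -
  from assms have "(\<lambda>s. f (upd (upd z i t) i s)) field_differentiable at (upd z i t $ i)"
    unfolding mholo_on_def by blast
  then show ?thesis by (simp add: pd_def field_differentiable_derivI)
qed

lemma mholo_onD':
  assumes "f mholo_on S" "z \<in> S"
  shows "((\<lambda>t. f (upd z i t)) has_field_derivative pd i f z) (at (z $ i))"
  using mholo_onD[OF assms(1), of z i "z $ i"] assms(2) by simp

lemma has_pdI:
  assumes "((\<lambda>t. f (upd z i t)) has_field_derivative D) (at (z $ i))"
  shows "pd i f z = D"
  using assms by (simp add: pd_def DERIV_imp_deriv)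

lemma mholo_onI:
  assumes "open S" "continuous_on S f"
    "\<And>z i. z \<in> S \<Longrightarrow> ((\<lambda>t. f (upd z i t)) has_field_derivative D z i) (at (z $ i))"
  shows "f mholo_on S"
  unfolding mholo_on_def using assms by (auto simp: field_differentiable_def)

lemma mholo_on_subset: "f mholo_on S \<Longrightarrow> open T \<Longrightarrow> T \<subseteq> S \<Longrightarrow> f mholo_on T"
  unfolding mholo_on_def using continuous_on_subset by blast

lemma mholo_open: "f mholo_on S \<Longrightarrow> open S"
  and mholo_cont: "f mholo_on S \<Longrightarrow> continuous_on S f"
  by (auto simp: mholo_on_def)

lemma eventually_upd:
  assumes "open S" "z \<in> S" shows "eventually (\<lambda>t. upd z i t \<in> S) (nhds (z $ i))"
proof -
  have "open (upd z i -` S)"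
    using assms(1) by (rule open_vimage) (intro continuous_intros)
  moreover have "z $ i \<in> upd z i -` S" using assms by simp
  ultimately show ?thesis by (auto simp: eventually_nhds)
qed

lemma pd_cong:
  assumes "open S" "z \<in> S" "\<And>z. z \<in> S \<Longrightarrow> f z = g z"
  shows "pd i f z = pd i g z"
  unfolding pd_def
  by (rule deriv_cong_ev) (use eventually_upd[OF assms(1,2), of i] in \<open>auto elim!: eventually_mono simp: assms(3)\<close>)

lemma mholo_cong:
  assumes "f mholo_on S" "\<And>z. z \<in> S \<Longrightarrow> f z = g z"
  shows "g mholo_on S"
proof (rule mholo_onI)
  show "open S" using assms mholo_open by blast
  show "continuous_on S g" using mholo_cont[OF assms(1)] assms(2) by (simp cong: continuous_on_cong)
  fix z i assume z: "z \<in> S"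
  have "((\<lambda>t. g (upd z i t)) has_field_derivative pd i f z) (at (z $ i)) \<longleftrightarrow>
     ((\<lambda>t. f (upd z i t)) has_field_derivative pd i f z) (at (z $ i))"
    by (rule DERIV_cong_ev)
      (use eventually_upd[OF mholo_open[OF assms(1)] z, of i] assms(2) in \<open>auto elim!: eventually_mono\<close>)
  with mholo_onD'[OF assms(1) z]
  show "((\<lambda>t. g (upd z i t)) has_field_derivative pd i f z) (at (z $ i))" by simp
qed

lemma mholo_const: "open S \<Longrightarrow> (\<lambda>_. c) mholo_on S"
  by (rule mholo_onI[where D = "\<lambda>_ _. 0"]) auto

lemma mholo_add: "f mholo_on S \<Longrightarrow> g mholo_on S \<Longrightarrow> (\<lambda>z. f z + g z) mholo_on S"
  by (rule mholo_onI[where D = "\<lambda>z i. pd i f z + pd i g z"])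
    (auto intro!: continuous_intros derivative_intros dest: mholo_cont mholo_open intro: mholo_onD')

lemma mholo_uminus: "f mholo_on S \<Longrightarrow> (\<lambda>z. - f z) mholo_on S"
  by (rule mholo_onI[where D = "\<lambda>z i. - pd i f z"])
    (auto intro!: continuous_intros derivative_intros dest: mholo_cont mholo_open intro: mholo_onD')

lemma mholo_mult:
  assumes "f mholo_on S" "g mholo_on S" shows "(\<lambda>z. f z * g z) mholo_on S"
proof (rule mholo_onI)
  fix z i assume z: "z \<in> S"
  show "((\<lambda>t. f (upd z i t) * g (upd z i t)) has_field_derivative pd i f z * g z + pd i g z * f z) (at (z $ i))"
    using DERIV_mult[OF mholo_onD'[OF assms(1) z, of i] mholo_onD'[OF assms(2) z, of i]] by simp
qed (use assms in \<open>auto intro!: continuous_intros dest: mholo_cont mholo_open\<close>)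

lemma pd_add: "f mholo_on S \<Longrightarrow> g mholo_on S \<Longrightarrow> z \<in> S \<Longrightarrow> pd i (\<lambda>z. f z + g z) z = pd i f z + pd i g z"
  by (rule has_pdI) (intro derivative_intros mholo_onD')

lemma pd_uminus: "f mholo_on S \<Longrightarrow> z \<in> S \<Longrightarrow> pd i (\<lambda>z. - f z) z = - pd i f z"
  by (rule has_pdI) (intro derivative_intros mholo_onD')

lemma pd_mult: "f mholo_on S \<Longrightarrow> g mholo_on S \<Longrightarrow> z \<in> S \<Longrightarrow>
   pd i (\<lambda>z. f z * g z) z = pd i f z * g z + f z * pd i g z"
  by (rule has_pdI) (use DERIV_mult[OF mholo_onD'[of f S z i] mholo_onD'[of g S z i]] in \<open>simp add: mult.commute\<close>)

lemma pd_const: "pd i (\<lambda>_. c) z = 0"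
  by (simp add: pd_def)

lemma pd_divide: 
  assumes "f mholo_on S" "g mholo_on S" "z \<in> S" "g z \<noteq> 0"
  shows "pd i (\<lambda>z. f z / g z) z = (pd i f z * g z - f z * pd i g z) / (g z * g z)"
  by (rule has_pdI)
     (use DERIV_divide[OF mholo_onD'[OF assms(1,3)] mholo_onD'[OF assms(2,3)], of i] assms(4) in simp)

lemma mholo_divide:
  assumes "f mholo_on S" "g mholo_on S" "\<And>z. z \<in> S \<Longrightarrow> g z \<noteq> 0"
  shows "(\<lambda>z. f z / g z) mholo_on S"
proof (rule mholo_onI)
  fix z i assume z: "z \<in> S"
  show "((\<lambda>t. f (upd z i t) / g (upd z i t)) has_field_derivative 
      (pd i f z * g z - f z * pd i g z) / (g z * g z)) (at (z $ i))"
    using DERIV_divide[OF mholo_onD'[OF assms(1) z, of i] mholo_onD'[OF assms(2) z, of i]] assms(3)[OF z] by simp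
qed (use assms in \<open>auto intro!: continuous_intros dest: mholo_cont mholo_open\<close>)

lemma pd_integral:
  fixes z :: "complex^'k"
  assumes f: "f mholo_on S" and r: "0 < r" "\<And>t. norm (t - z $ i) < 2 * r \<Longrightarrow> upd z i t \<in> S"
  shows "pd i f z = integral {0..1} (\<lambda>\<theta>. f (z + axis i (of_real r * exp (2 * of_real pi * \<i> * of_real \<theta>))) /
            (of_real r * exp (2 * of_real pi * \<i> * of_real \<theta>)))"
proof -
  let ?g = "\<lambda>t. f (upd z i t)"
  have hol: "?g holomorphic_on ball (z $ i) (2 * r)"
    unfolding holomorphic_on_def
  proof
    fix t assume "t \<in> ball (z $ i) (2 * r)"
    then have "norm (t - z $ i) < 2 * r" by (simp add: dist_norm norm_minus_commute)
    from mholo_onD[OF f r(2)[OF this]]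
    show "?g field_differentiable (at t within ball (z $ i) (2 * r))"
      unfolding field_differentiable_def by (blast intro: has_field_derivative_at_within)
  qed
  have sub: "cball (z $ i) r \<subseteq> ball (z $ i) (2 * r)" using r(1) by auto
  have "(?g has_field_derivative (1 / (2 * of_real pi * \<i>) *
     contour_integral (circlepath (z $ i) r) (\<lambda>u. ?g u / (u - z $ i)^2))) (at (z $ i))"
  proof (rule Cauchy_derivative_integral_circlepath(2))
    show "continuous_on (cball (z $ i) r) ?g"
      by (rule holomorphic_on_imp_continuous_on[OF holomorphic_on_subset[OF hol sub]])
    show "?g holomorphic_on ball (z $ i) r"
      by (rule holomorphic_on_subset[OF hol subset_trans[OF ball_subset_cball sub]])
    show "z $ i \<in> ball (z $ i) r" using r(1) by simp
  qed
  then have "pd i f z = 1 / (2 * of_real pi * \<i>) *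
     contour_integral (circlepath (z $ i) r) (\<lambda>u. ?g u / (u - z $ i)^2)"
    by (rule has_pdI[of f z i])
  also have "\<dots> = 1 / (2 * of_real pi * \<i>) * integral {0..1} (\<lambda>x. ?g (circlepath (z $ i) r x) /
      (circlepath (z $ i) r x - z $ i)^2 * vector_derivative (circlepath (z $ i) r) (at x))"
    by (simp only: contour_integral_integral)
  also have "\<dots> = integral {0..1} (\<lambda>x. 1 / (2 * of_real pi * \<i>) * (?g (circlepath (z $ i) r x) /
      (circlepath (z $ i) r x - z $ i)^2 * vector_derivative (circlepath (z $ i) r) (at x)))"
    by (rule integral_mult_right[symmetric])
  also have "\<dots> = integral {0..1} (\<lambda>\<theta>. f (z + axis i (of_real r * exp (2 * of_real pi * \<i> * of_real \<theta>))) /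
            (of_real r * exp (2 * of_real pi * \<i> * of_real \<theta>)))"
  proof (rule integral_cong)
    fix \<theta> :: real
    define c :: complex where "c = of_real r * exp (2 * of_real pi * \<i> * of_real \<theta>)"
    have c: "c \<noteq> 0" using r(1) by (simp add: c_def)
    have p: "circlepath (z $ i) r \<theta> = z $ i + c"
      by (simp add: circlepath c_def)
    have v: "vector_derivative (circlepath (z $ i) r) (at \<theta>) = (2 * of_real pi * \<i>) * c"
      unfolding vector_derivative_circlepath c_def by (simp only: of_real_mult of_real_numeral ac_simps)
    have k: "(2 * of_real pi * \<i>) \<noteq> 0" by simp
    have "1 / (2 * of_real pi * \<i>) * (f (z + axis i c) / c\<^sup>2 * ((2 * of_real pi * \<i>) * c)) = f (z + axis i c) / c"
      using c k by (simp add: power2_eq_square)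
    then show "1 / (2 * of_real pi * \<i>) * (?g (circlepath (z $ i) r \<theta>) /
      (circlepath (z $ i) r \<theta> - z $ i)^2 * vector_derivative (circlepath (z $ i) r) (at \<theta>)) =
      f (z + axis i (of_real r * exp (2 * of_real pi * \<i> * of_real \<theta>))) /
            (of_real r * exp (2 * of_real pi * \<i> * of_real \<theta>))"
      unfolding p v upd_shift c_def[symmetric] by simp
  qed
  finally show ?thesis .
qed

lemma local_radius:
  fixes z0 :: "complex^'k"
  assumes "open S" "z0 \<in> S"
  obtains r where "r > 0" "\<And>z t i. z \<in> ball z0 r \<Longrightarrow> norm (t - z $ i) < 2 * r \<Longrightarrow> upd z i t \<in> S"
    "ball z0 r \<subseteq> S"
proof -
  obtain e where e: "e > 0" "ball z0 e \<subseteq> S" using assms openE by blast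
  show ?thesis
  proof (rule that[of "e/3"])
    fix z t i assume "z \<in> ball z0 (e/3)" "norm (t - z $ i) < 2 * (e/3)"
    then have "dist z0 (upd z i t) < e"
      using dist_triangle[of z0 "upd z i t" z] by (simp add: dist_upd)
    with e show "upd z i t \<in> S" by auto
  qed (use e in auto)
qed

lemma add_axis_in:
  assumes "\<And>z t i. z \<in> ball z0 r \<Longrightarrow> norm (t - z $ i) < 2 * r \<Longrightarrow> upd z i t \<in> S" "r > 0"
    "z \<in> ball z0 r"
  shows "z + axis i (of_real r * exp (2 * of_real pi * \<i> * of_real \<theta>)) \<in> S"
proof -
  have "upd z i (z $ i + of_real r * exp (2 * of_real pi * \<i> * of_real \<theta>)) \<in> S"
    by (rule assms(1)) (use assms in \<open>auto simp: norm_mult\<close>)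
  then show ?thesis by (simp add: upd_shift)
qed

lemma pd_continuous_on:
  assumes f: "f mholo_on S"
  shows "continuous_on S (pd i f)"
proof -
  have "continuous (at z0) (pd i f)" if z0: "z0 \<in> S" for z0
  proof -
    obtain r where r: "r > 0" "\<And>z t i. z \<in> ball z0 r \<Longrightarrow> norm (t - z $ i) < 2 * r \<Longrightarrow> upd z i t \<in> S"
      "ball z0 r \<subseteq> S"
      using local_radius[OF mholo_open[OF f] z0] by blast
    let ?e = "\<lambda>\<theta>. of_real r * exp (2 * of_real pi * \<i> * of_real \<theta>) :: complex"
    have "continuous_on (ball z0 r) (\<lambda>z. integral (cbox 0 1) (\<lambda>\<theta>::real. f (z + axis i (?e \<theta>)) / ?e \<theta>))"
    proof (rule integral_continuous_on_param)
      have "continuous_on (ball z0 r \<times> cbox 0 1) (\<lambda>p. f (fst p + axis i (?e (snd p))))"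
      proof (rule continuous_on_compose2[OF mholo_cont[OF f]])
        show "continuous_on (ball z0 r \<times> cbox 0 1) (\<lambda>p. fst p + axis i (?e (snd p)))"
          by (intro continuous_intros)
        show "(\<lambda>p. fst p + axis i (?e (snd p))) ` (ball z0 r \<times> cbox 0 1) \<subseteq> S"
          using add_axis_in[OF r(2,1)] by (force simp del: mem_ball)
      qed
      moreover have "continuous_on (ball z0 r \<times> cbox 0 1) (\<lambda>p. ?e (snd p))"
        by (intro continuous_intros)
      ultimately have "continuous_on (ball z0 r \<times> cbox 0 1) (\<lambda>p. f (fst p + axis i (?e (snd p))) / ?e (snd p))"
        by (rule continuous_on_divide) (use r(1) in simp)
      then show "continuous_on (ball z0 r \<times> cbox 0 1) (\<lambda>(z, \<theta>). f (z + axis i (?e \<theta>)) / ?e \<theta>)"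
        by (simp add: split_beta)
    qed
    moreover have "integral (cbox 0 1) (\<lambda>\<theta>::real. f (z + axis i (?e \<theta>)) / ?e \<theta>) = pd i f z"
      if "z \<in> ball z0 r" for z
      using pd_integral[OF f r(1), of z i] r(2)[OF that] by simp
    ultimately have "continuous_on (ball z0 r) (pd i f)"
      by (rule continuous_on_eq)
    then show ?thesis using r(1) by (simp add: continuous_on_eq_continuous_at)
  qed
  then show ?thesis by (simp add: continuous_at_imp_continuous_on)
qed

lemma pd_pd_integral:
  fixes z0 :: "complex^'k"
  assumes f: "f mholo_on S" and r: "r > 0" "\<And>z t i. z \<in> ball z0 r \<Longrightarrow> norm (t - z $ i) < 2 * r \<Longrightarrow> upd z i t \<in> S"
    "ball z0 r \<subseteq> S"
  shows "((\<lambda>t. pd i f (upd z0 j t)) has_field_derivative 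
     integral {0..1} (\<lambda>\<theta>. pd j f (z0 + axis i (of_real r * exp (2 * of_real pi * \<i> * of_real \<theta>))) /
            (of_real r * exp (2 * of_real pi * \<i> * of_real \<theta>)))) (at (z0 $ j))"
proof -
  let ?e = "\<lambda>\<theta>. of_real r * exp (2 * of_real pi * \<i> * of_real \<theta>) :: complex"
  let ?U = "ball (z0 $ j) r"
  have inb: "upd z0 j t \<in> ball z0 r" if "t \<in> ?U" for t
    using that by (simp add: dist_upd) (simp add: dist_norm norm_minus_commute)
  have inS: "upd z0 j t + axis i (?e \<theta>) \<in> S" if "t \<in> ?U" for t \<theta>
    using add_axis_in[OF r(2,1) inb[OF that]] .
  have "((\<lambda>t. integral (cbox 0 1) (\<lambda>\<theta>::real. f (upd z0 j t + axis i (?e \<theta>)) / ?e \<theta>)) has_field_derivative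
     integral (cbox 0 1) (\<lambda>\<theta>. pd j f (upd z0 j (z0 $ j) + axis i (?e \<theta>)) / ?e \<theta>)) (at (z0 $ j) within ?U)"
  proof (rule leibniz_rule_field_derivative)
    fix t \<theta> assume t: "t \<in> ?U"
    let ?c = "axis i (?e \<theta>) :: complex^'k"
    have S': "upd (z0 + ?c) j (t + ?c $ j) \<in> S"
      using inS[OF t] by (simp add: upd_add_axis)
    have "((\<lambda>s. f (upd (z0 + ?c) j (s + ?c $ j))) has_field_derivative pd j f (upd (z0 + ?c) j (t + ?c $ j))) (at t)"
      using mholo_onD[OF f S'] by (simp add: DERIV_shift)
    then have "((\<lambda>s. f (upd z0 j s + ?c)) has_field_derivative pd j f (upd z0 j t + ?c)) (at t)"
      by (simp add: upd_add_axis)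
    then show "((\<lambda>s. f (upd z0 j s + ?c) / ?e \<theta>) has_field_derivative pd j f (upd z0 j t + ?c) / ?e \<theta>) (at t within ?U)"
      by (intro DERIV_cdivide) (rule has_field_derivative_at_within)
  next
    fix t assume t: "t \<in> ?U"
    show "(\<lambda>\<theta>. f (upd z0 j t + axis i (?e \<theta>)) / ?e \<theta>) integrable_on cbox 0 1"
    proof (rule integrable_continuous)
      have "continuous_on (cbox 0 1) (\<lambda>\<theta>. f (upd z0 j t + axis i (?e \<theta>)))"
      proof (rule continuous_on_compose2[OF mholo_cont[OF f]])
        show "continuous_on (cbox 0 1) (\<lambda>\<theta>. upd z0 j t + axis i (?e \<theta>))"
          by (intro continuous_intros)
        show "(\<lambda>\<theta>. upd z0 j t + axis i (?e \<theta>)) ` cbox 0 1 \<subseteq> S"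
          using inS[OF t] by blast
      qed
      moreover have "continuous_on (cbox 0 1) ?e"
        by (intro continuous_intros)
      ultimately show "continuous_on (cbox 0 1) (\<lambda>\<theta>. f (upd z0 j t + axis i (?e \<theta>)) / ?e \<theta>)"
        by (rule continuous_on_divide) (use r(1) in simp)
    qed
  next
    show "continuous_on (?U \<times> cbox 0 1) (\<lambda>(t, \<theta>). pd j f (upd z0 j t + axis i (?e \<theta>)) / ?e \<theta>)"
    proof -
      have "continuous_on (?U \<times> cbox 0 1) (\<lambda>p. pd j f (upd z0 j (fst p) + axis i (?e (snd p))))"
      proof (rule continuous_on_compose2[OF pd_continuous_on[OF f]])
        show "continuous_on (?U \<times> cbox 0 1) (\<lambda>p. upd z0 j (fst p) + axis i (?e (snd p)))"
          by (intro continuous_intros)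
        show "(\<lambda>p. upd z0 j (fst p) + axis i (?e (snd p))) ` (?U \<times> cbox 0 1) \<subseteq> S"
          using inS by (force simp del: mem_ball)
      qed
      moreover have "continuous_on (?U \<times> cbox 0 1) (\<lambda>p. ?e (snd p))"
        by (intro continuous_intros)
      ultimately have "continuous_on (?U \<times> cbox 0 1) (\<lambda>p. pd j f (upd z0 j (fst p) + axis i (?e (snd p))) / ?e (snd p))"
        by (rule continuous_on_divide) (use r(1) in simp)
      then show ?thesis by (simp add: split_beta)
    qed
  qed (use r(1) in auto)
  then have h1: "((\<lambda>t. integral {0..1} (\<lambda>\<theta>::real. f (upd z0 j t + axis i (?e \<theta>)) / ?e \<theta>)) has_field_derivative
     integral {0..1} (\<lambda>\<theta>. pd j f (z0 + axis i (?e \<theta>)) / ?e \<theta>)) (at (z0 $ j))"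
    using r(1) by (simp add: at_within_open[of "z0 $ j" ?U])
  have "eventually (\<lambda>t. t \<in> ?U) (nhds (z0 $ j))"
    using r(1) by (intro eventually_nhds_in_open) auto
  then have h2: "eventually (\<lambda>t. integral {0..1} (\<lambda>\<theta>::real. f (upd z0 j t + axis i (?e \<theta>)) / ?e \<theta>) = pd i f (upd z0 j t))
     (nhds (z0 $ j))"
    by (rule eventually_mono) (rule pd_integral[symmetric, OF f r(1)], rule r(2), erule inb)
  from h1 DERIV_cong_ev[OF refl h2 refl] show ?thesis by (rule iffD1[rotated])
qed

lemma pd_mholo:
  assumes f: "f mholo_on S" shows "pd i f mholo_on S"
proof -
  have "(\<lambda>t. pd i f (upd z j t)) field_differentiable at (z $ j)" if z: "z \<in> S" for z j
  proof -
    obtain r where r: "r > 0" "\<And>w t i. w \<in> ball z r \<Longrightarrow> norm (t - w $ i) < 2 * r \<Longrightarrow> upd w i t \<in> S"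
      "ball z r \<subseteq> S"
      using local_radius[OF mholo_open[OF f] z] by blast
    show ?thesis
      unfolding field_differentiable_def by (rule exI) (rule pd_pd_integral[OF f r])
  qed
  then show ?thesis
    using pd_continuous_on[OF f] mholo_open[OF f] by (auto simp: mholo_on_def)
qed

lemma pd_commute:
  assumes f: "f mholo_on S" and z: "z \<in> S" shows "pd i (pd j f) z = pd j (pd i f) z"
proof -
  obtain r where r: "r > 0" "\<And>w t i. w \<in> ball z r \<Longrightarrow> norm (t - w $ i) < 2 * r \<Longrightarrow> upd w i t \<in> S"
      "ball z r \<subseteq> S"
    using local_radius[OF mholo_open[OF f] z] by blast
  have "pd j (pd i f) z = integral {0..1} (\<lambda>\<theta>. pd j f (z + axis i (of_real r * exp (2 * of_real pi * \<i> * of_real \<theta>))) /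
            (of_real r * exp (2 * of_real pi * \<i> * of_real \<theta>)))"
    by (rule has_pdI) (rule pd_pd_integral[OF f r])
  also have "\<dots> = pd i (pd j f) z"
    by (rule pd_integral[symmetric, OF pd_mholo[OF f] r(1)]) (use r in auto)
  finally show ?thesis by simp
qed



section \<open>Meromorphic functions on $V = \mathbb{C}^n$\<close>

definition meromorphic_fun :: "(complex^'n \<Rightarrow> complex) \<Rightarrow> bool" where
  "meromorphic_fun f \<longleftrightarrow> (\<forall>v. \<exists>N g h. v \<in> N \<and> g mholo_on N \<and> h mholo_on N \<and>
     N \<subseteq> closure {x\<in>N. h x \<noteq> 0} \<and> (\<forall>x\<in>N. h x \<noteq> 0 \<longrightarrow> f x = g x / h x))"

text \<open>Two such functions define the same meromorphic function iff they agree on a dense open set;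
  the values on the polar locus carry no information.\<close>

definition mero_eq :: "(complex^'n \<Rightarrow> complex) \<Rightarrow> (complex^'n \<Rightarrow> complex) \<Rightarrow> bool" where
  "mero_eq f g \<longleftrightarrow> meromorphic_fun f \<and> meromorphic_fun g \<and>
     (\<exists>D. open D \<and> closure D = UNIV \<and> (\<forall>x\<in>D. f x = g x))"

lemma meromorphic_funE:
  assumes "meromorphic_fun f"
  obtains N g h where "v \<in> N" "g mholo_on N" "h mholo_on N" "N \<subseteq> closure {x\<in>N. h x \<noteq> 0}"
    "\<forall>x\<in>N. h x \<noteq> 0 \<longrightarrow> f x = g x / h x"
  using assms[unfolded meromorphic_fun_def, rule_format, of v] by (elim exE conjE) (rule that)

lemma mholo_nonzero_open: "h mholo_on N \<Longrightarrow> open {x\<in>N. h x \<noteq> 0}"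
proof -
  assume h: "h mholo_on N"
  have "open (N \<inter> h -` (- {0}))"
    using mholo_cont[OF h] mholo_open[OF h] by (rule continuous_open_preimage) auto
  moreover have "N \<inter> h -` (- {0}) = {x\<in>N. h x \<noteq> 0}" by auto
  ultimately show ?thesis by simp
qed

lemma dense_Int:
  fixes D E :: "'a::topological_space set"
  assumes "open D" "closure D = UNIV" "closure E = UNIV"
  shows "closure (D \<inter> E) = UNIV"
  using closure_open_Int_superset[of D E] assms by simp

lemma mero_eq_refl: "meromorphic_fun f \<Longrightarrow> mero_eq f f"
  unfolding mero_eq_def by (auto intro!: exI[of _ UNIV])

lemma mero_eq_sym: "mero_eq f g \<Longrightarrow> mero_eq g f"
  unfolding mero_eq_def by metis

lemma mero_eq_trans: "mero_eq f g \<Longrightarrow> mero_eq g h \<Longrightarrow> mero_eq f h"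
proof -
  assume a: "mero_eq f g" "mero_eq g h"
  then obtain D E where "open D" "closure D = UNIV" "\<forall>x\<in>D. f x = g x"
     "open E" "closure E = UNIV" "\<forall>x\<in>E. g x = h x"
    unfolding mero_eq_def by blast
  then have "open (D \<inter> E) \<and> closure (D \<inter> E) = UNIV \<and> (\<forall>x\<in>D \<inter> E. f x = h x)"
    by (auto simp: dense_Int)
  with a show ?thesis unfolding mero_eq_def by blast
qed

lemma meromorphic_const: "meromorphic_fun (\<lambda>_. c)"
  unfolding meromorphic_fun_def
  by (intro allI exI[of _ UNIV] exI[of _ "\<lambda>_. c"] exI[of _ "\<lambda>_. 1"]) (auto intro: mholo_const)

lemma meromorphic_fun_binary:
  assumes F: "meromorphic_fun f1" "meromorphic_fun f2"
    and R: "\<And>N g1 g2 h1 h2. \<lbrakk>g1 mholo_on N; g2 mholo_on N; h1 mholo_on N; h2 mholo_on N\<rbrakk> \<Longrightarrow>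
         R g1 h1 g2 h2 mholo_on N"
    and C: "\<And>g1 g2 h1 h2 x. \<lbrakk>h1 x \<noteq> 0; h2 x \<noteq> 0; f1 x = g1 x / h1 x; f2 x = g2 x / h2 x\<rbrakk> \<Longrightarrow>
         f x = R g1 h1 g2 h2 x / (h1 x * h2 x)"
  shows "meromorphic_fun f"
  unfolding meromorphic_fun_def
proof
  fix v
  obtain N1 g1 h1 where 1: "v \<in> N1" "g1 mholo_on N1" "h1 mholo_on N1"
     "N1 \<subseteq> closure {x\<in>N1. h1 x \<noteq> 0}" "\<forall>x\<in>N1. h1 x \<noteq> 0 \<longrightarrow> f1 x = g1 x / h1 x"
    by (rule meromorphic_funE[OF F(1)])
  obtain N2 g2 h2 where 2: "v \<in> N2" "g2 mholo_on N2" "h2 mholo_on N2"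
     "N2 \<subseteq> closure {x\<in>N2. h2 x \<noteq> 0}" "\<forall>x\<in>N2. h2 x \<noteq> 0 \<longrightarrow> f2 x = g2 x / h2 x"
    by (rule meromorphic_funE[OF F(2)])
  define N where "N = N1 \<inter> N2"
  have o: "open N1" "open N2" "open N" using mholo_open[OF 1(2)] mholo_open[OF 2(2)] by (auto simp: N_def)
  have s: "g1 mholo_on N" "h1 mholo_on N" "g2 mholo_on N" "h2 mholo_on N"
    using mholo_on_subset[OF 1(2) o(3)] mholo_on_subset[OF 1(3) o(3)]
      mholo_on_subset[OF 2(2) o(3)] mholo_on_subset[OF 2(3) o(3)] by (auto simp: N_def)
  let ?A = "{x\<in>N1. h1 x \<noteq> 0}" and ?B = "{x\<in>N2. h2 x \<noteq> 0}"
  have "closure (N \<inter> ?A) = closure N"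
    by (rule closure_open_Int_superset) (use o 1(4) in \<open>auto simp: N_def\<close>)
  moreover have "closure ((N \<inter> ?A) \<inter> ?B) = closure (N \<inter> ?A)"
    by (rule closure_open_Int_superset)
      (use o(3) 2(4) mholo_nonzero_open[OF 1(3)] in \<open>auto simp: N_def intro: open_Int\<close>)
  ultimately have "N \<subseteq> closure ((N \<inter> ?A) \<inter> ?B)"
    using closure_subset by metis
  moreover have "(N \<inter> ?A) \<inter> ?B = {x\<in>N. h1 x * h2 x \<noteq> 0}"
    by (auto simp: N_def)
  ultimately have "N \<subseteq> closure {x\<in>N. h1 x * h2 x \<noteq> 0}" by simp
  moreover have "\<forall>x\<in>N. h1 x * h2 x \<noteq> 0 \<longrightarrow> f x = R g1 h1 g2 h2 x / (h1 x * h2 x)"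
  proof (intro ballI impI)
    fix x assume "x \<in> N" "h1 x * h2 x \<noteq> 0"
    then have "x \<in> N1" "x \<in> N2" "h1 x \<noteq> 0" "h2 x \<noteq> 0" by (auto simp: N_def)
    with 1(5) 2(5) show "f x = R g1 h1 g2 h2 x / (h1 x * h2 x)" by (intro C) blast+
  qed
  moreover have "v \<in> N" using 1(1) 2(1) by (simp add: N_def)
  ultimately show "\<exists>N g h. v \<in> N \<and> g mholo_on N \<and> h mholo_on N \<and>
     N \<subseteq> closure {x\<in>N. h x \<noteq> 0} \<and> (\<forall>x\<in>N. h x \<noteq> 0 \<longrightarrow> f x = g x / h x)"
    using s by (intro exI[of _ N] exI[of _ "R g1 h1 g2 h2"] exI[of _ "\<lambda>x. h1 x * h2 x"])
      (auto intro: R mholo_mult)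
qed

lemma meromorphic_add: "meromorphic_fun f \<Longrightarrow> meromorphic_fun g \<Longrightarrow> meromorphic_fun (\<lambda>x. f x + g x)"
  by (rule meromorphic_fun_binary[of f g, where R = "\<lambda>g1 h1 g2 h2 x. g1 x * h2 x + g2 x * h1 x"])
    (auto intro!: mholo_add mholo_mult simp: field_simps)

lemma meromorphic_mult: "meromorphic_fun f \<Longrightarrow> meromorphic_fun g \<Longrightarrow> meromorphic_fun (\<lambda>x. f x * g x)"
  by (rule meromorphic_fun_binary[of f g, where R = "\<lambda>g1 h1 g2 h2 x. g1 x * g2 x"])
    (auto intro!: mholo_add mholo_mult simp: field_simps)

lemma meromorphic_uminus: "meromorphic_fun f \<Longrightarrow> meromorphic_fun (\<lambda>x. - f x)"
  using meromorphic_mult[OF meromorphic_const[of "-1"], of f] by simp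

lemma meromorphic_diff: "meromorphic_fun f \<Longrightarrow> meromorphic_fun g \<Longrightarrow> meromorphic_fun (\<lambda>x. f x - g x)"
  using meromorphic_add[of f, OF _ meromorphic_uminus[of g]] by simp

lemma meromorphic_pd:
  assumes "meromorphic_fun f" shows "meromorphic_fun (pd i f)"
  unfolding meromorphic_fun_def
proof
  fix v
  obtain N g h where 1: "v \<in> N" "g mholo_on N" "h mholo_on N"
     "N \<subseteq> closure {x\<in>N. h x \<noteq> 0}" "\<forall>x\<in>N. h x \<noteq> 0 \<longrightarrow> f x = g x / h x"
    by (rule meromorphic_funE[OF assms])
  let ?A = "{x\<in>N. h x \<noteq> 0}"
  let ?G = "\<lambda>x. pd i g x * h x + - (g x * pd i h x)"
  have o: "open ?A" by (rule mholo_nonzero_open[OF 1(3)])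
  have "?G mholo_on N" "(\<lambda>x. h x * h x) mholo_on N"
    by (rule mholo_add[OF mholo_mult[OF pd_mholo[OF 1(2)] 1(3)] mholo_uminus[OF mholo_mult[OF 1(2) pd_mholo[OF 1(3)]]]])
      (rule mholo_mult[OF 1(3) 1(3)])
  moreover have "pd i f x = ?G x / (h x * h x)" if x: "x \<in> ?A" for x
  proof -
    have "pd i f x = pd i (\<lambda>x. g x / h x) x"
      by (rule pd_cong[OF o x]) (use 1(5) in blast)
    also have "\<dots> = ?G x / (h x * h x)"
      using pd_divide[OF 1(2,3), of x i] x by simp
    finally show ?thesis .
  qed
  ultimately show "\<exists>N g h. v \<in> N \<and> g mholo_on N \<and> h mholo_on N \<and>
     N \<subseteq> closure {x\<in>N. h x \<noteq> 0} \<and> (\<forall>x\<in>N. h x \<noteq> 0 \<longrightarrow> pd i f x = g x / h x)"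
    using 1(1,4) by (intro exI[of _ N] exI[of _ ?G] exI[of _ "\<lambda>x. h x * h x"]) auto
qed

text \<open>The permutation action on $V$: \<open>w\<close> sends the basis vector $e_i$ to $e_{w(i)}$.\<close>

definition vperm :: "'n perm \<Rightarrow> complex^'n \<Rightarrow> complex^'n" where
  "vperm w v = (\<chi> i. v $ (inverse w \<langle>$\<rangle> i))"

lemma perm_inv_apply [simp]: "inverse w \<langle>$\<rangle> (w \<langle>$\<rangle> i) = i" "w \<langle>$\<rangle> (inverse w \<langle>$\<rangle> i) = i"
  by (metis apply_one apply_sequence id_apply perm.left_inverse)
     (metis apply_one apply_sequence id_apply perm.right_inverse)

lemma vperm_one [simp]: "vperm 1 v = v"
  by (simp add: vperm_def vec_eq_iff)

lemma vperm_times: "vperm (u * w) v = vperm u (vperm w v)"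
  by (simp add: vperm_def vec_eq_iff apply_times)

lemma vperm_inv [simp]: "vperm (inverse w) (vperm w v) = v" "vperm w (vperm (inverse w) v) = v"
  by (simp_all add: vperm_times[symmetric])

lemma vperm_upd: "vperm w (upd z i t) = upd (vperm w z) (w \<langle>$\<rangle> i) t"
  by (auto simp: vperm_def vec_eq_iff)

lemma continuous_vperm: "continuous_on A (vperm w)"
  unfolding vperm_def by (intro continuous_on_vec_lambda continuous_intros)

lemma open_vperm: "open S \<Longrightarrow> open (vperm w -` S)"
  by (rule open_vimage) (auto intro: continuous_vperm)

lemma closure_vperm: "vperm w -` closure A \<subseteq> closure (vperm w -` A)"
proof (rule ccontr)
  assume "\<not> ?thesis"
  then obtain x where x: "vperm w x \<in> closure A" "x \<notin> closure (vperm w -` A)" by blast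
  define T where "T = vperm (inverse w) -` (- closure (vperm w -` A))"
  have o: "open T" unfolding T_def by (rule open_vperm) (rule open_Compl[OF closed_closure])
  have "T \<inter> A = {}"
  proof -
    have "vperm (inverse w) y \<in> closure (vperm w -` A)" if "y \<in> A" for y
      using closure_subset[of "vperm w -` A"] that by auto
    then show ?thesis by (auto simp: T_def)
  qed
  then have "T \<inter> closure A = {}" using open_Int_closure_eq_empty[OF o] by blast
  moreover have "vperm w x \<in> T" using x(2) by (simp add: T_def)
  ultimately show False using x(1) by blast
qed

lemma mholo_vperm:
  assumes f: "f mholo_on N" shows "(\<lambda>z. f (vperm w z)) mholo_on (vperm w -` N)"
proof (rule mholo_onI[where D = "\<lambda>z i. pd (w \<langle>$\<rangle> i) f (vperm w z)"])
  show "open (vperm w -` N)" by (rule open_vperm[OF mholo_open[OF f]])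
  show "continuous_on (vperm w -` N) (\<lambda>z. f (vperm w z))"
    by (rule continuous_on_compose2[OF mholo_cont[OF f] continuous_vperm]) auto
  fix z i assume "z \<in> vperm w -` N"
  then have z: "vperm w z \<in> N" by simp
  have "vperm w z $ (w \<langle>$\<rangle> i) = z $ i" by (simp add: vperm_def)
  with mholo_onD'[OF f z, of "w \<langle>$\<rangle> i"]
  show "((\<lambda>t. f (vperm w (upd z i t))) has_field_derivative pd (w \<langle>$\<rangle> i) f (vperm w z)) (at (z $ i))"
    by (simp add: vperm_upd)
qed

lemma pd_vperm: "pd i (\<lambda>z. f (vperm w z)) z = pd (w \<langle>$\<rangle> i) f (vperm w z)"
  by (simp add: pd_def vperm_upd) (simp add: vperm_def)

lemma meromorphic_vperm:
  assumes "meromorphic_fun f" shows "meromorphic_fun (\<lambda>z. f (vperm w z))"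
  unfolding meromorphic_fun_def
proof
  fix v
  obtain N g h where 1: "vperm w v \<in> N" "g mholo_on N" "h mholo_on N"
     "N \<subseteq> closure {x\<in>N. h x \<noteq> 0}" "\<forall>x\<in>N. h x \<noteq> 0 \<longrightarrow> f x = g x / h x"
    by (rule meromorphic_funE[OF assms])
  have "vperm w -` N \<subseteq> vperm w -` closure {x\<in>N. h x \<noteq> 0}" using 1(4) by blast
  also have "\<dots> \<subseteq> closure (vperm w -` {x\<in>N. h x \<noteq> 0})" by (rule closure_vperm)
  also have "vperm w -` {x\<in>N. h x \<noteq> 0} = {x \<in> vperm w -` N. h (vperm w x) \<noteq> 0}" by auto
  finally show "\<exists>N g h. v \<in> N \<and> g mholo_on N \<and> h mholo_on N \<and>
     N \<subseteq> closure {x\<in>N. h x \<noteq> 0} \<and> (\<forall>x\<in>N. h x \<noteq> 0 \<longrightarrow> f (vperm w x) = g x / h x)"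
    using 1(1,5) mholo_vperm[OF 1(2), of w] mholo_vperm[OF 1(3), of w]
    by (intro exI[of _ "vperm w -` N"] exI[of _ "\<lambda>x. g (vperm w x)"] exI[of _ "\<lambda>x. h (vperm w x)"]) auto
qed

quotient_type (overloaded) 'n mero = "complex^('n::finite) \<Rightarrow> complex" / partial: mero_eq
proof (rule part_equivpI)
  show "\<exists>x. mero_eq x (x :: complex^'n \<Rightarrow> complex)"
    using mero_eq_refl[OF meromorphic_const] by blast
  show "symp mero_eq" using mero_eq_sym by (auto intro: sympI)
  show "transp mero_eq" using mero_eq_trans by (blast intro: transpI)
qed

text \<open>\<open>abs_mero f\<close> is the meromorphic function given by the expression \<open>f\<close>.\<close>

lemma mero_eq_map:
  assumes "mero_eq f g" "\<And>f. meromorphic_fun f \<Longrightarrow> meromorphic_fun (F f)"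
    "\<And>f g D. open D \<Longrightarrow> \<forall>x\<in>D. f x = g x \<Longrightarrow> \<forall>x\<in>D. F f x = F g x"
  shows "mero_eq (F f) (F g)"
  using assms unfolding mero_eq_def by meson

lemma mero_eq_map2:
  fixes f f' g g' :: "complex^'n \<Rightarrow> complex"
  assumes "mero_eq f f'" "mero_eq g g'"
    "\<And>f g :: complex^'n \<Rightarrow> complex. meromorphic_fun f \<Longrightarrow> meromorphic_fun g \<Longrightarrow> meromorphic_fun (\<lambda>x. op (f x) (g x))"
  shows "mero_eq (\<lambda>x. op (f x) (g x)) (\<lambda>x. op (f' x) (g' x))"
proof -
  obtain D E where "open D" "closure D = UNIV" "\<forall>x\<in>D. f x = f' x"
     "open E" "closure E = UNIV" "\<forall>x\<in>E. g x = g' x"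
    using assms unfolding mero_eq_def by blast
  then have "open (D \<inter> E) \<and> closure (D \<inter> E) = UNIV \<and> (\<forall>x\<in>D \<inter> E. op (f x) (g x) = op (f' x) (g' x))"
    by (auto simp: dense_Int)
  moreover have "meromorphic_fun (\<lambda>x. op (f x) (g x))" "meromorphic_fun (\<lambda>x. op (f' x) (g' x))"
    using assms(1,2) by (auto simp: mero_eq_def intro: assms(3)[of f g] assms(3)[of f' g'])
  ultimately show ?thesis unfolding mero_eq_def by blast
qed

instantiation mero :: (finite) comm_ring_1
begin

lift_definition zero_mero :: "'a mero" is "\<lambda>_. 0" by (rule mero_eq_refl[OF meromorphic_const])
lift_definition one_mero :: "'a mero" is "\<lambda>_. 1" by (rule mero_eq_refl[OF meromorphic_const])
lift_definition plus_mero :: "'a mero \<Rightarrow> 'a mero \<Rightarrow> 'a mero" is "\<lambda>f g x. f x + g x"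
  by (rule mero_eq_map2) (auto intro: meromorphic_add)
lift_definition times_mero :: "'a mero \<Rightarrow> 'a mero \<Rightarrow> 'a mero" is "\<lambda>f g x. f x * g x"
  by (rule mero_eq_map2) (auto intro: meromorphic_mult)
lift_definition uminus_mero :: "'a mero \<Rightarrow> 'a mero" is "\<lambda>f x. - f x"
  by (erule mero_eq_map) (auto intro: meromorphic_uminus)
lift_definition minus_mero :: "'a mero \<Rightarrow> 'a mero \<Rightarrow> 'a mero" is "\<lambda>f g x. f x - g x"
  by (rule mero_eq_map2) (auto intro: meromorphic_diff)

instance
proof
  fix a b c :: "'a mero"
  note I = mero_eq_refl meromorphic_diff meromorphic_add meromorphic_mult meromorphic_uminus meromorphic_const
  note E = mero_eq_def[THEN iffD1, THEN conjunct1]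
  show "a * b * c = a * (b * c)" by transfer (auto simp: mult.assoc dest!: E intro!: I)
  show "a * b = b * a" by transfer (auto simp: mult.commute dest!: E intro!: I)
  show "1 * a = a" by transfer simp
  show "a + b + c = a + (b + c)" by transfer (auto simp: add.assoc dest!: E intro!: I)
  show "a + b = b + a" by transfer (auto simp: add.commute dest!: E intro!: I)
  show "0 + a = a" by transfer simp
  show "- a + a = 0" by transfer (auto intro!: I)
  show "a - b = a + - b" by transfer (auto dest!: E intro!: I)
  show "(a + b) * c = a * c + b * c" by transfer (auto simp: distrib_right dest!: E intro!: I)
  show "(0::'a mero) \<noteq> 1" by transfer (auto simp: mero_eq_def)
qed

end

lift_definition mero_const :: "complex \<Rightarrow> 'n::finite mero" is "\<lambda>c _. c"
  by (rule mero_eq_refl[OF meromorphic_const])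

lift_definition mero_deriv :: "'n::finite \<Rightarrow> 'n mero \<Rightarrow> 'n mero" is pd
  by (erule mero_eq_map) (auto intro: meromorphic_pd pd_cong)

lift_definition mero_perm :: "'n perm \<Rightarrow> 'n::finite mero \<Rightarrow> 'n mero" is
  "\<lambda>w f v. f (vperm (inverse w) v)"
proof -
  fix w :: "'n perm" and f g :: "complex^'n \<Rightarrow> complex"
  let ?u = "inverse w"
  assume a: "mero_eq f g"
  then obtain D where D: "open D" "closure D = UNIV" "\<forall>x\<in>D. f x = g x"
    unfolding mero_eq_def by blast
  have "closure (vperm ?u -` D) = UNIV" using closure_vperm[of ?u D] D(2) by auto
  then show "mero_eq (\<lambda>v. f (vperm ?u v)) (\<lambda>v. g (vperm ?u v))"
    using a D open_vperm[OF D(1), of ?u] unfolding mero_eq_def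
    by (auto intro!: meromorphic_vperm exI[of _ "vperm ?u -` D"])
qed

lemma mero_eqI:
  assumes "meromorphic_fun f" "meromorphic_fun g"
    "\<And>v. \<exists>N. open N \<and> v \<in> N \<and> N \<subseteq> closure {x\<in>N. f x = g x \<and> x \<in> interior {x. f x = g x}}"
  shows "mero_eq f g"
proof -
  let ?D = "interior {x. f x = g x}"
  have "v \<in> closure ?D" for v
  proof -
    obtain N where "v \<in> N" "N \<subseteq> closure {x\<in>N. f x = g x \<and> x \<in> ?D}" using assms(3) by blast
    moreover have "closure {x\<in>N. f x = g x \<and> x \<in> ?D} \<subseteq> closure ?D" by (rule closure_mono) auto
    ultimately show ?thesis by blast
  qed
  then show ?thesis
    unfolding mero_eq_def using assms(1,2) interior_subset[of "{x. f x = g x}"]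
    by (intro conjI exI[of _ ?D]) blast+
qed

lemma mero_local_eqI:
  assumes F: "meromorphic_fun f" "meromorphic_fun f'"
    and G: "meromorphic_fun g" "meromorphic_fun g'"
    and P: "\<And>S x. f mholo_on S \<Longrightarrow> f' mholo_on S \<Longrightarrow> x \<in> S \<Longrightarrow> g x = g' x"
  shows "mero_eq g g'"
proof (rule mero_eqI[OF G])
  fix v
  obtain N1 g1 h1 where 1: "v \<in> N1" "g1 mholo_on N1" "h1 mholo_on N1"
     "N1 \<subseteq> closure {x\<in>N1. h1 x \<noteq> 0}" "\<forall>x\<in>N1. h1 x \<noteq> 0 \<longrightarrow> f x = g1 x / h1 x"
    by (rule meromorphic_funE[OF F(1)])
  obtain N2 g2 h2 where 2: "v \<in> N2" "g2 mholo_on N2" "h2 mholo_on N2"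
     "N2 \<subseteq> closure {x\<in>N2. h2 x \<noteq> 0}" "\<forall>x\<in>N2. h2 x \<noteq> 0 \<longrightarrow> f' x = g2 x / h2 x"
    by (rule meromorphic_funE[OF F(2)])
  define N where "N = N1 \<inter> N2"
  have o: "open N1" "open N2" "open N" using mholo_open[OF 1(2)] mholo_open[OF 2(2)] by (auto simp: N_def)
  let ?A = "{x\<in>N1. h1 x \<noteq> 0}" and ?B = "{x\<in>N2. h2 x \<noteq> 0}"
  let ?S = "(N \<inter> ?A) \<inter> ?B"
  have oS: "open ?S" using o mholo_nonzero_open[OF 1(3)] mholo_nonzero_open[OF 2(3)] by blast
  have "closure (N \<inter> ?A) = closure N"
    by (rule closure_open_Int_superset) (use o 1(4) in \<open>auto simp: N_def\<close>)
  moreover have "closure ?S = closure (N \<inter> ?A)"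
    by (rule closure_open_Int_superset)
      (use o(3) 2(4) mholo_nonzero_open[OF 1(3)] in \<open>auto simp: N_def intro: open_Int\<close>)
  ultimately have N: "N \<subseteq> closure ?S"
    using closure_subset by metis
  have "(\<lambda>x. g1 x / h1 x) mholo_on ?S"
    by (rule mholo_divide) (use oS in \<open>auto intro: mholo_on_subset[OF 1(2)] mholo_on_subset[OF 1(3)]\<close>)
  then have f: "f mholo_on ?S" by (rule mholo_cong) (use 1(5) in simp)
  have "(\<lambda>x. g2 x / h2 x) mholo_on ?S"
    by (rule mholo_divide) (use oS in \<open>auto intro: mholo_on_subset[OF 2(2)] mholo_on_subset[OF 2(3)]\<close>)
  then have f': "f' mholo_on ?S" by (rule mholo_cong) (use 2(5) in simp)
  have "?S \<subseteq> {x. g x = g' x}" using P[OF f f'] by blast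
  then have "?S \<subseteq> interior {x. g x = g' x}" by (rule interior_maximal[OF _ oS])
  then have "?S \<subseteq> {x\<in>N. g x = g' x \<and> x \<in> interior {x. g x = g' x}}" using interior_subset by blast
  from closure_mono[OF this] N
  have "N \<subseteq> closure {x\<in>N. g x = g' x \<and> x \<in> interior {x. g x = g' x}}" by blast
  then show "\<exists>N. open N \<and> v \<in> N \<and> N \<subseteq> closure {x\<in>N. g x = g' x \<and> x \<in> interior {x. g x = g' x}}"
    using o(3) 1(1) 2(1) by (intro exI[of _ N]) (auto simp: N_def)
qed

lemma mero_eqD: "mero_eq f g \<Longrightarrow> meromorphic_fun f" "mero_eq f g \<Longrightarrow> meromorphic_fun g"
  by (auto simp: mero_eq_def)

lemma mero_deriv_add: "mero_deriv i (f + g) = mero_deriv i f + mero_deriv i g"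
proof transfer
  fix i :: 'a and f g :: "complex^'a \<Rightarrow> complex" assume "mero_eq f f" "mero_eq g g"
  then have f: "meromorphic_fun f" "meromorphic_fun g" by (auto dest: mero_eqD)
  show "mero_eq (pd i (\<lambda>x. f x + g x)) (\<lambda>x. pd i f x + pd i g x)"
    by (rule mero_local_eqI[OF f]) (use f in \<open>auto intro: meromorphic_pd meromorphic_add pd_add\<close>)
qed

lemma mero_deriv_mult: "mero_deriv i (f * g) = mero_deriv i f * g + f * mero_deriv i g"
proof transfer
  fix i :: 'a and f g :: "complex^'a \<Rightarrow> complex" assume "mero_eq f f" "mero_eq g g"
  then have f: "meromorphic_fun f" "meromorphic_fun g" by (auto dest: mero_eqD)
  show "mero_eq (pd i (\<lambda>x. f x * g x)) (\<lambda>x. pd i f x * g x + f x * pd i g x)"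
    by (rule mero_local_eqI[OF f])
      (use f in \<open>auto intro!: meromorphic_pd meromorphic_mult meromorphic_add pd_mult\<close>)
qed

lemma mero_deriv_commute: "mero_deriv i (mero_deriv j f) = mero_deriv j (mero_deriv i f)"
proof transfer
  fix i j :: 'a and f :: "complex^'a \<Rightarrow> complex" assume "mero_eq f f"
  then have f: "meromorphic_fun f" by (auto dest: mero_eqD)
  show "mero_eq (pd i (pd j f)) (pd j (pd i f))"
    by (rule mero_local_eqI[OF f f]) (use f in \<open>auto intro: meromorphic_pd pd_commute\<close>)
qed

lemma mero_deriv_perm: "mero_deriv (w \<langle>$\<rangle> i) (mero_perm w f) = mero_perm w (mero_deriv i f)"
  by transfer (auto simp: pd_vperm[abs_def] dest!: mero_eqD intro!: mero_eq_refl meromorphic_vperm meromorphic_pd)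

lemma mero_perm_add: "mero_perm w (f + g) = mero_perm w f + mero_perm w g"
  by transfer (auto dest!: mero_eqD intro!: mero_eq_refl meromorphic_vperm meromorphic_add)

lemma mero_perm_mult: "mero_perm w (f * g) = mero_perm w f * mero_perm w g"
  by transfer (auto dest!: mero_eqD intro!: mero_eq_refl meromorphic_vperm meromorphic_mult)

lemma mero_perm_one: "mero_perm w 1 = 1"
  by transfer (auto intro!: mero_eq_refl meromorphic_const)

lemma mero_perm_id: "mero_perm 1 f = f"
  by transfer (simp)

lemma mero_perm_times: "mero_perm (u * w) f = mero_perm u (mero_perm w f)"
  by transfer (auto simp: vperm_times dest!: mero_eqD intro!: mero_eq_refl meromorphic_vperm)

lemma mero_deriv_zero [simp]: "mero_deriv i 0 = 0"
  using mero_deriv_add[of i 0 0] by simp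

lemma mero_perm_zero [simp]: "mero_perm w 0 = 0"
  using mero_perm_add[of w 0 0] by simp



section \<open>Algebras of differential operators\<close>

abbreviation "pm_single \<equiv> Poly_Mapping.single"
abbreviation "pm_lookup \<equiv> Poly_Mapping.lookup"
abbreviation "pm_keys \<equiv> Poly_Mapping.keys"
abbreviation "pm_map \<equiv> Poly_Mapping.map"

text \<open>
  For a commutative ring \<open>K\<close> with commuting derivations $D_i$, elements $\sum_\alpha f_\alpha p^\alpha$ of
  $K[p_1,\dots,p_n]$ are finitely supported families of coefficients, written to the left of the
  monomials. \<open>ore_gen D i b\<close> is $p_i \cdot b$ in the algebra with relations $[p_i, f] = D_i(f)$, and
  \<open>ore_mult D a b\<close> is the product there.\<close>

definition ore_gen :: "('n \<Rightarrow> 'k \<Rightarrow> 'k) \<Rightarrow> 'n \<Rightarrow> (('n \<Rightarrow>\<^sub>0 nat) \<Rightarrow>\<^sub>0 'k::comm_ring_1) \<Rightarrow> (('n \<Rightarrow>\<^sub>0 nat) \<Rightarrow>\<^sub>0 'k)" where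
  "ore_gen D i b = pm_single (pm_single i 1) 1 * b + pm_map (D i) b"

definition ore_monom :: "('n::{finite,linorder} \<Rightarrow> 'k \<Rightarrow> 'k) \<Rightarrow> ('n \<Rightarrow>\<^sub>0 nat) \<Rightarrow>
    (('n \<Rightarrow>\<^sub>0 nat) \<Rightarrow>\<^sub>0 'k::comm_ring_1) \<Rightarrow> (('n \<Rightarrow>\<^sub>0 nat) \<Rightarrow>\<^sub>0 'k)" where
  "ore_monom D \<alpha> b = foldr (\<lambda>i. ore_gen D i ^^ pm_lookup \<alpha> i) (sorted_list_of_set UNIV) b"

definition ore_mult :: "('n::{finite,linorder} \<Rightarrow> 'k \<Rightarrow> 'k) \<Rightarrow> (('n \<Rightarrow>\<^sub>0 nat) \<Rightarrow>\<^sub>0 'k) \<Rightarrow>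
    (('n \<Rightarrow>\<^sub>0 nat) \<Rightarrow>\<^sub>0 'k::comm_ring_1) \<Rightarrow> (('n \<Rightarrow>\<^sub>0 nat) \<Rightarrow>\<^sub>0 'k)" where
  "ore_mult D a b = (\<Sum>\<alpha>\<in>pm_keys a. pm_single 0 (pm_lookup a \<alpha>) * ore_monom D \<alpha> b)"

lemma pm_add_induct [case_names zero single add]:
  assumes "P 0" "\<And>k c. P (pm_single k c)" "\<And>a b. P a \<Longrightarrow> P b \<Longrightarrow> P (a + b)"
  shows "P (a :: 'a \<Rightarrow>\<^sub>0 'b::comm_monoid_add)"
proof (induction a rule: update_induct)
  case const
  then show ?case using assms(1) by simp
next
  case (update f a b)
  have "Poly_Mapping.update a b f = f + pm_single a b"
    using update by (intro poly_mapping_eqI)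
     (auto simp: lookup_update lookup_add lookup_single when_def in_keys_iff)
  then show ?case using update assms by simp
qed

lemma multiidx_induct [case_names zero step]:
  assumes "P 0" "\<And>\<alpha> i. P \<alpha> \<Longrightarrow> P (\<alpha> + pm_single i 1)"
  shows "P (\<alpha> :: 'n \<Rightarrow>\<^sub>0 nat)"
proof -
  have "\<forall>\<beta>. P \<beta> \<longrightarrow> P (\<beta> + \<alpha>)"
  proof (induction \<alpha> rule: pm_add_induct)
    case (single k c)
    show ?case
    proof (induction c)
      case (Suc c)
      have "pm_single k (Suc c) = pm_single k c + pm_single k 1" by (simp add: single_add[symmetric])
      then show ?case using Suc assms(2) by (simp add: add.assoc[symmetric])
    qed simp
  next
    case (add a b)
    then show ?case by (simp add: add.assoc[symmetric])
  qed simp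
  with assms(1) show ?thesis by force
qed

locale commuting_derivations =
  fixes D :: "'n::{finite,linorder} \<Rightarrow> 'k \<Rightarrow> 'k::comm_ring_1"
  assumes D_add: "D i (a + b) = D i a + D i b"
    and D_mult: "D i (a * b) = D i a * b + a * D i b"
    and D_commute: "D i (D j a) = D j (D i a)"
begin

lemma D_zero [simp]: "D i 0 = 0"
  using D_add[of i 0 0] by simp

lemma D_one [simp]: "D i 1 = 0"
  using D_mult[of i 1 1] by simp

lemma lookup_map_D: "pm_lookup (pm_map (D i) b) k = D i (pm_lookup b k)"
  by (simp add: Poly_Mapping.map.rep_eq when_def)

lemma map_D_add: "pm_map (D i) (a + b) = pm_map (D i) a + pm_map (D i) b"
  by (rule poly_mapping_eqI) (simp add: lookup_map_D lookup_add D_add)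

lemma map_D_single: "pm_map (D i) (pm_single k c) = pm_single k (D i c)"
  by (rule poly_mapping_eqI) (simp add: lookup_map_D lookup_single when_def)

lemma map_D_single_mult:
  fixes b :: "('n \<Rightarrow>\<^sub>0 nat) \<Rightarrow>\<^sub>0 'k"
  shows "pm_map (D i) (pm_single e c * b) = pm_single e (D i c) * b + pm_single e c * pm_map (D i) b"
proof (induction b rule: pm_add_induct)
  case zero
  have "pm_map (D i) (0 :: ('n \<Rightarrow>\<^sub>0 nat) \<Rightarrow>\<^sub>0 'k) = 0" by (rule poly_mapping_eqI) (simp add: lookup_map_D)
  then show ?case by simp
next
  case (single k d)
  show ?case by (simp add: mult_single map_D_single D_mult single_add)
next
  case (add a b)
  then show ?case by (simp add: map_D_add distrib_left algebra_simps)
qed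

lemma gen_add: "ore_gen D i (a + b) = ore_gen D i a + ore_gen D i b"
  by (simp add: ore_gen_def map_D_add algebra_simps)

lemma gen_zero: "ore_gen D i 0 = 0"
  using gen_add[of i 0 0] by simp

lemma gen_coeff: "ore_gen D i (pm_single 0 c * b) = pm_single 0 c * ore_gen D i b + pm_single 0 (D i c) * b"
  unfolding ore_gen_def map_D_single_mult by (simp add: algebra_simps)

lemma gen_commute: "ore_gen D i (ore_gen D j b) = ore_gen D j (ore_gen D i b)"
proof -
  have "pm_map (D i) (pm_map (D j) b) = pm_map (D j) (pm_map (D i) b)"
    by (rule poly_mapping_eqI) (simp add: lookup_map_D D_commute)
  then show ?thesis
    unfolding ore_gen_def map_D_add map_D_single_mult by (simp add: algebra_simps)
qed

lemma gen_funpow_commute: "ore_gen D i ((ore_gen D j ^^ k) b) = (ore_gen D j ^^ k) (ore_gen D i b)"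
  by (induction k) (simp_all add: gen_commute[of i j])

lemma gen_foldr_commute:
  "ore_gen D i (foldr (\<lambda>j. ore_gen D j ^^ f j) xs b) = foldr (\<lambda>j. ore_gen D j ^^ f j) xs (ore_gen D i b)"
  by (induction xs) (simp_all add: gen_funpow_commute)

lemma foldr_gen_step:
  assumes "distinct xs"
  shows "foldr (\<lambda>j. ore_gen D j ^^ (if j = i then Suc (f j) else f j)) xs b =
    (if i \<in> set xs then ore_gen D i (foldr (\<lambda>j. ore_gen D j ^^ f j) xs b) else foldr (\<lambda>j. ore_gen D j ^^ f j) xs b)"
  using assms by (induction xs) (auto simp: gen_funpow_commute)

lemma monom_zero: "ore_monom D 0 b = b"
proof -
  have "foldr (\<lambda>i. ore_gen D i ^^ 0) xs b = b" for xs by (induction xs) auto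
  then show ?thesis by (simp add: ore_monom_def)
qed

lemma monom_step: "ore_monom D (\<alpha> + pm_single i 1) b = ore_gen D i (ore_monom D \<alpha> b)"
proof -
  have e: "pm_lookup (\<alpha> + pm_single i 1) j = (if j = i then Suc (pm_lookup \<alpha> j) else pm_lookup \<alpha> j)" for j
    by (auto simp: lookup_add lookup_single)
  show ?thesis
    unfolding ore_monom_def e
    using foldr_gen_step[of "sorted_list_of_set UNIV" i "pm_lookup \<alpha>" b] by simp
qed

lemmas monom_step' = monom_step[unfolded One_nat_def]

lemma monom_add: "ore_monom D \<alpha> (a + b) = ore_monom D \<alpha> a + ore_monom D \<alpha> b"
  by (induction \<alpha> rule: multiidx_induct) (simp_all add: monom_zero monom_step' gen_add)

lemma monom_one: "ore_monom D \<alpha> 1 = pm_single \<alpha> 1"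
proof (induction \<alpha> rule: multiidx_induct)
  case zero
  show ?case by (simp add: monom_zero)
next
  case (step \<alpha> i)
  have "ore_gen D i (pm_single \<alpha> 1) = pm_single (\<alpha> + pm_single i 1) 1"
    by (simp add: ore_gen_def map_D_single mult_single add.commute)
  then show ?case by (simp add: monom_step' step)
qed

lemma mult_single': "ore_mult D (pm_single \<alpha> c) b = pm_single 0 c * ore_monom D \<alpha> b"
  by (simp add: ore_mult_def)

lemma mult_add_left: "ore_mult D (a + a') b = ore_mult D a b + ore_mult D a' b"
  unfolding ore_mult_def
  by (rule setsum_keys_plus_distrib) (simp_all add: single_add algebra_simps)

lemma mult_zero_left: "ore_mult D 0 b = 0"
  by (simp add: ore_mult_def)

lemma mult_add_right: "ore_mult D a (b + b') = ore_mult D a b + ore_mult D a b'"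
  by (simp add: ore_mult_def monom_add distrib_left sum.distrib)

lemma mult_coeff: "ore_mult D (pm_single 0 c * a) b = pm_single 0 c * ore_mult D a b"
proof (induction a rule: pm_add_induct)
  case (single \<alpha> d)
  have "pm_single 0 c * pm_single \<alpha> d = pm_single \<alpha> (c * d)" by (simp add: mult_single)
  moreover have "pm_single 0 (c * d) = pm_single 0 c * (pm_single 0 d :: ('n \<Rightarrow>\<^sub>0 nat) \<Rightarrow>\<^sub>0 'k)"
    by (simp add: mult_single)
  ultimately show ?case by (simp add: mult_single' mult.assoc)
qed (simp_all add: mult_zero_left mult_add_left distrib_left)

lemma mult_gen: "ore_mult D (ore_gen D i a) b = ore_gen D i (ore_mult D a b)"
proof (induction a rule: pm_add_induct)
  case zero
  show ?case by (simp add: gen_zero mult_zero_left)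
next
  case (single \<alpha> c)
  have "ore_gen D i (pm_single \<alpha> c) = pm_single (\<alpha> + pm_single i 1) c + pm_single \<alpha> (D i c)"
    by (simp add: ore_gen_def map_D_single mult_single add.commute)
  then show ?case
    by (simp add: mult_add_left mult_single' monom_step' gen_coeff)
next
  case (add a a')
  then show ?case by (simp add: gen_add mult_add_left)
qed

lemma mult_monom: "ore_mult D (ore_monom D \<alpha> a) b = ore_monom D \<alpha> (ore_mult D a b)"
  by (induction \<alpha> rule: multiidx_induct) (simp_all add: monom_zero monom_step' mult_gen)

lemma mult_assoc: "ore_mult D (ore_mult D a b) c = ore_mult D a (ore_mult D b c)"
  by (induction a rule: pm_add_induct)
    (simp_all add: mult_zero_left mult_add_left mult_single' mult_coeff mult_monom)

lemma mult_one_left: "ore_mult D 1 b = b"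
  using mult_single'[of 0 1 b] by (simp add: monom_zero)

lemma mult_one_right: "ore_mult D a 1 = a"
  by (induction a rule: pm_add_induct)
    (simp_all add: mult_zero_left mult_add_left mult_single' monom_one mult_single)

end

text \<open>$p^\alpha \mapsto p^{w\alpha}$ with $(w\alpha)_{w(i)} = \alpha_i$, together with \<open>s\<close> on the coefficients.\<close>

definition ore_perm :: "'n perm \<Rightarrow> ('k \<Rightarrow> 'k) \<Rightarrow> (('n \<Rightarrow>\<^sub>0 nat) \<Rightarrow>\<^sub>0 'k::zero) \<Rightarrow> (('n \<Rightarrow>\<^sub>0 nat) \<Rightarrow>\<^sub>0 'k)" where
  "ore_perm w s a = Poly_Mapping.map_key (Poly_Mapping.map_key (\<lambda>i. w \<langle>$\<rangle> i)) (pm_map s a)"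

definition midx_perm :: "'n perm \<Rightarrow> ('n \<Rightarrow>\<^sub>0 nat) \<Rightarrow> ('n \<Rightarrow>\<^sub>0 nat)" where
  "midx_perm w \<alpha> = Poly_Mapping.map_key (\<lambda>i. inverse w \<langle>$\<rangle> i) \<alpha>"

lemma inj_apply: "inj (\<lambda>i. w \<langle>$\<rangle> i)"
  by (simp add: inj_def apply_inj)

lemma lookup_midx_perm: "pm_lookup (midx_perm w \<alpha>) i = pm_lookup \<alpha> (inverse w \<langle>$\<rangle> i)"
  by (simp add: midx_perm_def map_key.rep_eq inj_apply)

lemma midx_perm_inv_eq: "Poly_Mapping.map_key (\<lambda>i. w \<langle>$\<rangle> i) = midx_perm (inverse w)"
  by (simp add: fun_eq_iff midx_perm_def)

lemma midx_perm_inv [simp]: "midx_perm w (midx_perm (inverse w) \<alpha>) = \<alpha>" "midx_perm (inverse w) (midx_perm w \<alpha>) = \<alpha>"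
  by (rule poly_mapping_eqI, simp add: lookup_midx_perm)+

lemma midx_perm_add: "midx_perm w (\<alpha> + \<beta>) = midx_perm w \<alpha> + midx_perm w \<beta>"
  by (rule poly_mapping_eqI) (simp add: lookup_midx_perm lookup_add)

lemma midx_perm_zero [simp]: "midx_perm w 0 = 0"
  by (rule poly_mapping_eqI) (simp add: lookup_midx_perm)

lemma midx_perm_eq_iff: "midx_perm (inverse w) \<alpha> = \<beta> \<longleftrightarrow> \<alpha> = midx_perm w \<beta>"
  by auto

lemma midx_perm_single: "midx_perm w (pm_single i c) = pm_single (w \<langle>$\<rangle> i) c"
  by (rule poly_mapping_eqI) (auto simp: lookup_midx_perm lookup_single when_def)

lemma inj_midx_perm: "inj (midx_perm w)"
  by (rule inj_on_inverseI[where g = "midx_perm (inverse w)"]) simp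

lemma lookup_ore_perm:
  "s 0 = 0 \<Longrightarrow> pm_lookup (ore_perm w s a) \<alpha> = s (pm_lookup a (midx_perm (inverse w) \<alpha>))"
  by (simp add: ore_perm_def midx_perm_inv_eq map_key.rep_eq inj_midx_perm Poly_Mapping.map.rep_eq when_def)

locale equivariant = commuting_derivations D for D :: "'n::{finite,linorder} \<Rightarrow> 'k \<Rightarrow> 'k::comm_ring_1" +
  fixes w :: "'n perm" and s :: "'k \<Rightarrow> 'k"
  assumes s_add: "s (a + b) = s a + s b" and s_mult: "s (a * b) = s a * s b" and s_one: "s 1 = 1"
    and s_D: "D (w \<langle>$\<rangle> i) (s a) = s (D i a)"
begin

abbreviation "T \<equiv> ore_perm w s"

lemma s_zero [simp]: "s 0 = 0" using s_add[of 0 0] by simp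

lemma T_add: "T (a + b) = T a + T b"
  by (rule poly_mapping_eqI) (simp add: lookup_ore_perm lookup_add s_add)

lemma T_zero: "T 0 = 0"
  using T_add[of 0 0] by simp

lemma T_single: "T (pm_single \<alpha> c) = pm_single (midx_perm w \<alpha>) (s c)"
  by (rule poly_mapping_eqI) (auto simp: lookup_ore_perm lookup_single when_def midx_perm_eq_iff)

lemma T_single_mult: "T (pm_single \<alpha> c * b) = pm_single (midx_perm w \<alpha>) (s c) * T b"
  by (induction b rule: pm_add_induct)
    (simp_all add: T_zero T_single T_add mult_single midx_perm_add s_mult distrib_left)

lemma T_gen: "T (ore_gen D i b) = ore_gen D (w \<langle>$\<rangle> i) (T b)"
proof -
  have "T (pm_map (D i) b) = pm_map (D (w \<langle>$\<rangle> i)) (T b)"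
    by (rule poly_mapping_eqI) (simp add: lookup_ore_perm lookup_map_D s_D)
  then show ?thesis
    by (simp add: ore_gen_def T_add T_single_mult midx_perm_single s_one)
qed

lemma T_monom: "T (ore_monom D \<alpha> b) = ore_monom D (midx_perm w \<alpha>) (T b)"
  by (induction \<alpha> rule: multiidx_induct)
    (simp_all only: monom_zero monom_step T_gen midx_perm_add midx_perm_single midx_perm_zero)

lemma T_mult: "T (ore_mult D a b) = ore_mult D (T a) (T b)"
  by (induction a rule: pm_add_induct)
    (simp_all add: mult_zero_left mult_add_left mult_single' T_zero T_single T_add T_single_mult T_monom)

end

section \<open>The algebras $A_0$ and $A_\hbar$\<close>

type_synonym 'n classical = "('n \<Rightarrow>\<^sub>0 nat) \<Rightarrow>\<^sub>0 'n mero"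

text \<open>Coefficients of $A_\hbar$: the variable of the power series is $\hbar$.\<close>

definition hbar_deriv :: "'n::finite \<Rightarrow> 'n mero fps \<Rightarrow> 'n mero fps" where
  "hbar_deriv i f = fps_X * Abs_fps (\<lambda>k. mero_deriv i (fps_nth f k))"

definition coeff_perm :: "'n perm \<Rightarrow> 'n::finite mero fps \<Rightarrow> 'n mero fps" where
  "coeff_perm w f = Abs_fps (\<lambda>k. mero_perm w (fps_nth f k))"

lemma hbar_deriv_nth: "fps_nth (hbar_deriv i f) k = (if k = 0 then 0 else mero_deriv i (fps_nth f (k - 1)))"
  by (simp add: hbar_deriv_def)

lemma mero_deriv_sum: "mero_deriv i (sum f A) = (\<Sum>x\<in>A. mero_deriv i (f x))"
  by (induction A rule: infinite_finite_induct) (simp_all add: mero_deriv_add)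

lemma mero_perm_sum: "mero_perm w (sum f A) = (\<Sum>x\<in>A. mero_perm w (f x))"
  by (induction A rule: infinite_finite_induct) (simp_all add: mero_perm_add)

interpretation hbar: commuting_derivations "hbar_deriv :: 'n::{finite,linorder} \<Rightarrow> _"
proof
  fix i j :: 'n and a b :: "'n mero fps"
  let ?d = "\<lambda>i (f::'n mero fps). Abs_fps (\<lambda>k. mero_deriv i (fps_nth f k))"
  have add: "?d i (a + b) = ?d i a + ?d i b" for i a b
    by (rule fps_ext) (simp add: mero_deriv_add)
  show "hbar_deriv i (a + b) = hbar_deriv i a + hbar_deriv i b"
    unfolding hbar_deriv_def add by (simp add: algebra_simps)
  have mult: "?d i (a * b) = ?d i a * b + a * ?d i b"
    by (rule fps_ext) (simp add: fps_mult_nth mero_deriv_sum mero_deriv_mult sum.distrib)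
  show "hbar_deriv i (a * b) = hbar_deriv i a * b + a * hbar_deriv i b"
    unfolding hbar_deriv_def mult by (simp add: algebra_simps)
  show "hbar_deriv i (hbar_deriv j a) = hbar_deriv j (hbar_deriv i a)"
    by (rule fps_ext) (simp add: hbar_deriv_nth mero_deriv_commute[of i j])
qed

interpretation hbar: equivariant "hbar_deriv :: 'n::{finite,linorder} \<Rightarrow> _" w "coeff_perm w"
proof
  fix i :: 'n and a b :: "'n mero fps"
  show "coeff_perm w (a + b) = coeff_perm w a + coeff_perm w b"
    by (rule fps_ext) (simp add: coeff_perm_def mero_perm_add)
  show "coeff_perm w (a * b) = coeff_perm w a * coeff_perm w b"
    by (rule fps_ext) (simp add: coeff_perm_def fps_mult_nth mero_perm_sum mero_perm_mult)
  show "coeff_perm w 1 = 1"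
    by (rule fps_ext) (simp add: coeff_perm_def mero_perm_one)
  show "hbar_deriv (w \<langle>$\<rangle> i) (coeff_perm w a) = coeff_perm w (hbar_deriv i a)"
    by (rule fps_ext) (simp add: hbar_deriv_nth coeff_perm_def mero_deriv_perm)
qed

text \<open>$A_\hbar$ is realised as $\mathbb{C}(V)[[\hbar]][\hat p_1,\dots,\hat p_n]$, which contains
  $\mathbb{C}[[\hbar]]\otimes\mathbb{C}(V)[\hat p_1,\dots,\hat p_n]$ also when the tensor product is not completed;
  \<open>symbol\<close> records the normally ordered coefficients: $a = \sum_\alpha f_\alpha(x,\hbar)\,\hat p^\alpha$.\<close>

typedef (overloaded) 'n quantum = "UNIV :: (('n::{finite,linorder} \<Rightarrow>\<^sub>0 nat) \<Rightarrow>\<^sub>0 'n mero fps) set"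
  morphisms symbol Quantum ..

setup_lifting type_definition_quantum

instantiation quantum :: ("{finite,linorder}") ring_1
begin

lift_definition zero_quantum :: "'a quantum" is 0 .
lift_definition one_quantum :: "'a quantum" is 1 .
lift_definition plus_quantum :: "'a quantum \<Rightarrow> 'a quantum \<Rightarrow> 'a quantum" is "(+)" .
lift_definition minus_quantum :: "'a quantum \<Rightarrow> 'a quantum \<Rightarrow> 'a quantum" is "(-)" .
lift_definition uminus_quantum :: "'a quantum \<Rightarrow> 'a quantum" is "uminus" .
lift_definition times_quantum :: "'a quantum \<Rightarrow> 'a quantum \<Rightarrow> 'a quantum" is "ore_mult hbar_deriv" .

instance
  by standard (transfer, simp add: algebra_simps hbar.mult_assoc hbar.mult_one_left hbar.mult_one_right
    hbar.mult_add_left hbar.mult_add_right)+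

end

definition coeff_q :: "'n::{finite,linorder} mero fps \<Rightarrow> 'n quantum" where
  "coeff_q f = Quantum (pm_single 0 f)"

definition fun_q :: "'n::{finite,linorder} mero \<Rightarrow> 'n quantum" where
  "fun_q f = coeff_q (fps_const f)"

definition const_q :: "complex \<Rightarrow> 'n::{finite,linorder} quantum" where
  "const_q c = fun_q (mero_const c)"

definition hbar_q :: "'n::{finite,linorder} quantum" where
  "hbar_q = coeff_q fps_X"

lift_definition p_hat :: "'n::{finite,linorder} \<Rightarrow> 'n quantum" is "\<lambda>i. pm_single (pm_single i 1) 1" .

lift_definition perm_q :: "'n perm \<Rightarrow> 'n::{finite,linorder} quantum \<Rightarrow> 'n quantum" is
  "\<lambda>w. ore_perm w (coeff_perm w)" .

definition eta0 :: "'n::{finite,linorder} quantum \<Rightarrow> 'n classical" where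
  "eta0 a = pm_map (\<lambda>f. fps_nth f 0) (symbol a)"

lemma p_hat_commutator: "p_hat i * fun_q f - fun_q f * p_hat i = hbar_q * fun_q (mero_deriv i f)"
proof -
  have d: "hbar_deriv i (fps_const f) = fps_X * fps_const (mero_deriv i f)" for i f
    by (rule fps_ext) (auto simp: hbar_deriv_nth)
  have "symbol (p_hat i * fun_q f) = symbol (fun_q f * p_hat i + hbar_q * fun_q (mero_deriv i f))"
    using hbar.monom_step[of 0 i]
    by (simp add: times_quantum.rep_eq plus_quantum.rep_eq p_hat.rep_eq fun_q_def coeff_q_def hbar_q_def
        Quantum_inverse hbar.mult_single' hbar.monom_zero ore_gen_def hbar.map_D_single d mult_single)
  then show ?thesis by (simp add: symbol_inject)
qed

lemma perm_q_add: "perm_q w (a + b) = perm_q w a + perm_q w b"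
  by transfer (rule hbar.T_add)

lemma perm_q_mult: "perm_q w (a * b) = perm_q w a * perm_q w b"
  by transfer (rule hbar.T_mult)

lemma perm_q_one: "perm_q w 1 = 1"
  by transfer (metis hbar.T_single hbar.s_one midx_perm_zero single_one)

lemma perm_q_zero: "perm_q w 0 = 0"
  by transfer (rule hbar.T_zero)

lemma perm_q_id: "perm_q 1 a = (a :: 'n::{finite,linorder} quantum)"
proof -
  have "symbol (perm_q 1 a) = symbol a"
  proof (rule poly_mapping_eqI)
    fix k :: "'n \<Rightarrow>\<^sub>0 nat"
    have "midx_perm 1 k = k" by (rule poly_mapping_eqI) (simp add: lookup_midx_perm)
    moreover have "coeff_perm 1 f = f" for f :: "'n mero fps"
      by (rule fps_ext) (simp add: coeff_perm_def mero_perm_id)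
    ultimately show "pm_lookup (symbol (perm_q 1 a)) k = pm_lookup (symbol a) k"
      by (simp add: perm_q.rep_eq lookup_ore_perm)
  qed
  then show ?thesis by (simp add: symbol_inject)
qed

lemma perm_q_times: "perm_q (u * w) a = perm_q u (perm_q w a)"
proof (transfer, rule poly_mapping_eqI)
  fix u w :: "'a perm" and a :: "('a \<Rightarrow>\<^sub>0 nat) \<Rightarrow>\<^sub>0 'a mero fps" and k
  have "midx_perm (inverse w * inverse u) k = midx_perm (inverse w) (midx_perm (inverse u) k)"
    by (rule poly_mapping_eqI) (simp add: lookup_midx_perm apply_times)
  moreover have "coeff_perm (u * w) f = coeff_perm u (coeff_perm w f)" for f :: "'a mero fps"
    by (rule fps_ext) (simp add: coeff_perm_def mero_perm_times)
  ultimately show "pm_lookup (ore_perm (u * w) (coeff_perm (u * w)) a) k =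
      pm_lookup (ore_perm u (coeff_perm u) (ore_perm w (coeff_perm w) a)) k"
    by (simp add: lookup_ore_perm)
qed

lemma perm_q_sum: "perm_q w (sum f A) = (\<Sum>x\<in>A. perm_q w (f x))"
  by (induction A rule: infinite_finite_induct) (simp_all add: perm_q_add perm_q_zero)



definition deriv_x :: "'n::finite \<Rightarrow> 'n classical \<Rightarrow> 'n classical" where
  "deriv_x i a = pm_map (mero_deriv i) a"

definition deriv_p :: "'n::finite \<Rightarrow> 'n classical \<Rightarrow> 'n classical" where
  "deriv_p i a = (\<Sum>\<alpha>\<in>pm_keys a.
     pm_single (\<alpha> - pm_single i 1) (of_nat (pm_lookup \<alpha> i) * pm_lookup a \<alpha>))"

definition poisson :: "'n::finite classical \<Rightarrow> 'n classical \<Rightarrow> 'n classical" where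
  "poisson a b = (\<Sum>i\<in>UNIV. deriv_p i a * deriv_x i b - deriv_x i a * deriv_p i b)"

section \<open>Square matrices over a noncommutative ring\<close>

typedef ('a, 'k) sqmat = "UNIV :: ('k \<Rightarrow> 'k \<Rightarrow> 'a) set"
  morphisms entry Sqmat ..

setup_lifting type_definition_sqmat

lemma entry_Sqmat [simp]: "entry (Sqmat f) = f"
  by (simp add: Sqmat_inverse)

lemma sqmat_eqI: "(\<And>i j. entry A i j = entry B i j) \<Longrightarrow> A = B"
  by (metis entry_inverse ext)

instantiation sqmat :: (ring_1, finite) ring_1
begin

lift_definition zero_sqmat :: "('a, 'b) sqmat" is "\<lambda>_ _. 0" .
lift_definition one_sqmat :: "('a, 'b) sqmat" is "\<lambda>i j. if i = j then 1 else 0" .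
lift_definition plus_sqmat :: "('a, 'b) sqmat \<Rightarrow> ('a, 'b) sqmat \<Rightarrow> ('a, 'b) sqmat" is
  "\<lambda>A B i j. A i j + B i j" .
lift_definition minus_sqmat :: "('a, 'b) sqmat \<Rightarrow> ('a, 'b) sqmat \<Rightarrow> ('a, 'b) sqmat" is
  "\<lambda>A B i j. A i j - B i j" .
lift_definition uminus_sqmat :: "('a, 'b) sqmat \<Rightarrow> ('a, 'b) sqmat" is
  "\<lambda>A i j. - A i j" .
lift_definition times_sqmat :: "('a, 'b) sqmat \<Rightarrow> ('a, 'b) sqmat \<Rightarrow> ('a, 'b) sqmat" is
  "\<lambda>A B i j. \<Sum>k\<in>UNIV. A i k * B k j" .

instance
proof
  fix a b c :: "('a, 'b) sqmat"
  have d1: "(\<Sum>k\<in>UNIV. (if i = k then 1 else 0) * f k) = f i" for f :: "'b \<Rightarrow> 'a" and i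
    by (subst sum.cong[OF refl, of _ _ "\<lambda>k. if i = k then f k else 0"]) auto
  have d2: "(\<Sum>k\<in>UNIV. f k * (if k = i then 1 else 0)) = f i" for f :: "'b \<Rightarrow> 'a" and i
    by (subst sum.cong[OF refl, of _ _ "\<lambda>k. if i = k then f k else 0"]) auto
  show "a * b * c = a * (b * c)"
  proof (transfer, intro ext)
    fix a b c :: "'b \<Rightarrow> 'b \<Rightarrow> 'a" and i j
    have "(\<Sum>k\<in>UNIV. (\<Sum>l\<in>UNIV. a i l * b l k) * c k j) = (\<Sum>k\<in>UNIV. \<Sum>l\<in>UNIV. a i l * b l k * c k j)"
      by (simp add: sum_distrib_right)
    also have "\<dots> = (\<Sum>l\<in>UNIV. \<Sum>k\<in>UNIV. a i l * b l k * c k j)" by (rule sum.swap)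
    also have "\<dots> = (\<Sum>l\<in>UNIV. a i l * (\<Sum>k\<in>UNIV. b l k * c k j))"
      by (simp add: sum_distrib_left mult.assoc)
    finally show "(\<Sum>k\<in>UNIV. (\<Sum>l\<in>UNIV. a i l * b l k) * c k j) = (\<Sum>k\<in>UNIV. a i k * (\<Sum>l\<in>UNIV. b k l * c l j))" .
  qed
  show "1 * a = a" by transfer (simp add: d1)
  show "a * 1 = a" by transfer (simp add: d2)
  show "a + b + c = a + (b + c)" by transfer (simp add: add.assoc)
  show "a + b = b + a" by transfer (simp add: add.commute)
  show "0 + a = a" by transfer simp
  show "- a + a = 0" by transfer simp
  show "a - b = a + - b" by transfer simp
  show "(a + b) * c = a * c + b * c" by transfer (simp add: distrib_right sum.distrib)
  show "a * (b + c) = a * b + a * c" by transfer (simp add: distrib_left sum.distrib)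
  show "(0::('a, 'b) sqmat) \<noteq> 1" by transfer (simp add: fun_eq_iff)
qed

end

definition scalar_mat :: "'a::zero \<Rightarrow> ('a, 'k) sqmat" where
  "scalar_mat a = Sqmat (\<lambda>i j. if i = j then a else 0)"

definition map_mat :: "('a \<Rightarrow> 'b) \<Rightarrow> ('a, 'k) sqmat \<Rightarrow> ('b, 'k) sqmat" where
  "map_mat f A = Sqmat (\<lambda>i j. f (entry A i j))"

definition commutator :: "'a::ring \<Rightarrow> 'a \<Rightarrow> 'a" where
  "commutator a b = a * b - b * a"

section \<open>The crossed product\<close>

text \<open>The basis of \<open>U\<close> is indexed by \<open>s :: 'n \<Rightarrow> 'd\<close>, for $e_{s(1)}\otimes\dots\otimes e_{s(n)}$. Since
  \<open>w\<close> maps the basis vector of \<open>s\<close> to the one of $s\circ w^{-1}$, $(wbw^{-1})_{s,t} = b_{s\circ w, t\circ w}$.\<close>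

type_synonym ('n, 'd) qEnd = "('n quantum, 'n \<Rightarrow> 'd) sqmat"

definition perm_qEnd :: "'n perm \<Rightarrow> ('n::{finite,linorder}, 'd) qEnd \<Rightarrow> ('n, 'd) qEnd" where
  "perm_qEnd w b = Sqmat (\<lambda>s t. perm_q w (entry b (\<lambda>i. s (w \<langle>$\<rangle> i)) (\<lambda>i. t (w \<langle>$\<rangle> i))))"

lemma perm_qEnd_add: "perm_qEnd w (a + b) = perm_qEnd w a + perm_qEnd w (b :: ('n::{finite,linorder}, 'd::finite) qEnd)"
  by (rule sqmat_eqI) (simp add: perm_qEnd_def plus_sqmat.rep_eq perm_q_add)

lemma perm_qEnd_zero: "perm_qEnd w (0 :: ('n::{finite,linorder}, 'd::finite) qEnd) = 0"
  using perm_qEnd_add[of w 0 0] by simp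

lemma perm_qEnd_sum: "perm_qEnd w (sum f A) = (\<Sum>x\<in>A. perm_qEnd w (f x :: ('n::{finite,linorder}, 'd::finite) qEnd))"
  by (induction A rule: infinite_finite_induct) (simp_all add: perm_qEnd_add perm_qEnd_zero)

lemma bij_comp_perm: "bij (\<lambda>(s::'n \<Rightarrow> 'd) i. s (w \<langle>$\<rangle> i))"
  by (rule bij_betw_byWitness[where f' = "\<lambda>s i. s (inverse w \<langle>$\<rangle> i)"]) auto

lemma perm_qEnd_mult:
  "perm_qEnd w (a * b) = perm_qEnd w a * perm_qEnd w (b :: ('n::{finite,linorder}, 'd::finite) qEnd)"
proof (rule sqmat_eqI)
  fix s t :: "'n \<Rightarrow> 'd"
  let ?c = "\<lambda>(s::'n \<Rightarrow> 'd) i. s (w \<langle>$\<rangle> i)"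
  have "(\<Sum>k\<in>UNIV. perm_q w (entry a (?c s) k) * perm_q w (entry b k (?c t))) =
      (\<Sum>k\<in>UNIV. perm_q w (entry a (?c s) (?c k)) * perm_q w (entry b (?c k) (?c t)))"
    by (rule sum.reindex_bij_betw[OF bij_comp_perm, symmetric])
  then show "entry (perm_qEnd w (a * b)) s t = entry (perm_qEnd w a * perm_qEnd w b) s t"
    by (simp add: perm_qEnd_def times_sqmat.rep_eq perm_q_sum perm_q_mult)
qed

lemma perm_qEnd_one: "perm_qEnd w (1 :: ('n::{finite,linorder}, 'd::finite) qEnd) = 1"
proof (rule sqmat_eqI)
  fix s t :: "'n \<Rightarrow> 'd"
  have "(\<lambda>i. s (w \<langle>$\<rangle> i)) = (\<lambda>i. t (w \<langle>$\<rangle> i)) \<longleftrightarrow> s = t"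
    using inj_eq[OF bij_is_inj[OF bij_comp_perm[of w]], of s t] by simp
  then show "entry (perm_qEnd w 1) s t = entry 1 s t"
    by (simp add: perm_qEnd_def one_sqmat.rep_eq perm_q_one perm_q_zero)
qed

lemma perm_qEnd_id: "perm_qEnd 1 b = b"
  by (rule sqmat_eqI) (simp add: perm_qEnd_def perm_q_id)

lemma perm_qEnd_times: "perm_qEnd (u * w) b = perm_qEnd u (perm_qEnd w b)"
  by (rule sqmat_eqI) (simp add: perm_qEnd_def perm_q_times apply_times)

instance perm :: (finite) finite
proof
  have "inj (Perm.apply :: 'a perm \<Rightarrow> 'a \<Rightarrow> 'a)" by (rule injI) (simp add: apply_inject)
  then show "finite (UNIV :: 'a perm set)" by (rule finite_imageD[rotated]) simp
qed

text \<open>\<open>Crossed a\<close> is $\sum_w a_w \widehat w$.\<close>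

typedef (overloaded) ('n, 'd) crossed = "UNIV :: ('n perm \<Rightarrow> ('n::{finite,linorder}, 'd) qEnd) set"
  morphisms crossed_coeff Crossed ..

setup_lifting type_definition_crossed

instantiation crossed :: ("{finite,linorder}", finite) ring_1
begin

lift_definition zero_crossed :: "('a, 'b) crossed" is "\<lambda>_. 0" .
lift_definition one_crossed :: "('a, 'b) crossed" is "\<lambda>w. if w = 1 then 1 else 0" .
lift_definition plus_crossed :: "('a, 'b) crossed \<Rightarrow> ('a, 'b) crossed \<Rightarrow> ('a, 'b) crossed" is
  "\<lambda>a b w. a w + b w" .
lift_definition minus_crossed :: "('a, 'b) crossed \<Rightarrow> ('a, 'b) crossed \<Rightarrow> ('a, 'b) crossed" is
  "\<lambda>a b w. a w - b w" .
lift_definition uminus_crossed :: "('a, 'b) crossed \<Rightarrow> ('a, 'b) crossed" is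
  "\<lambda>a w. - a w" .
lift_definition times_crossed :: "('a, 'b) crossed \<Rightarrow> ('a, 'b) crossed \<Rightarrow> ('a, 'b) crossed" is
  "\<lambda>a b w. \<Sum>u\<in>UNIV. a u * perm_qEnd u (b (inverse u * w))" .

instance
proof
  fix a b c :: "('a, 'b) crossed"
  show "a * b * c = a * (b * c)"
  proof (transfer, intro ext)
    fix a b c :: "'a perm \<Rightarrow> ('a, 'b) qEnd" and w
    have "(\<Sum>u\<in>UNIV. (\<Sum>v\<in>UNIV. a v * perm_qEnd v (b (inverse v * u))) * perm_qEnd u (c (inverse u * w))) =
       (\<Sum>u\<in>UNIV. \<Sum>v\<in>UNIV. a v * perm_qEnd v (b (inverse v * u)) * perm_qEnd u (c (inverse u * w)))"
      by (simp add: sum_distrib_right)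
    also have "\<dots> = (\<Sum>v\<in>UNIV. \<Sum>u\<in>UNIV. a v * perm_qEnd v (b (inverse v * u)) * perm_qEnd u (c (inverse u * w)))"
      by (rule sum.swap)
    also have "\<dots> = (\<Sum>v\<in>UNIV. \<Sum>u\<in>UNIV. a v * perm_qEnd v (b u) * perm_qEnd (v * u) (c (inverse u * (inverse v * w))))"
    proof (rule sum.cong[OF refl])
      fix v :: "'a perm"
      have bij: "bij (\<lambda>u. v * u)"
        by (rule bij_betw_byWitness[where f' = "\<lambda>u. inverse v * u"]) (auto simp: mult.assoc[symmetric])
      show "(\<Sum>u\<in>UNIV. a v * perm_qEnd v (b (inverse v * u)) * perm_qEnd u (c (inverse u * w))) =
         (\<Sum>u\<in>UNIV. a v * perm_qEnd v (b u) * perm_qEnd (v * u) (c (inverse u * (inverse v * w))))"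
        by (subst sum.reindex_bij_betw[OF bij, symmetric]) (simp add: mult.assoc mult.assoc[symmetric, of "inverse v" v])
    qed
    also have "\<dots> = (\<Sum>v\<in>UNIV. a v * perm_qEnd v (\<Sum>u\<in>UNIV. b u * perm_qEnd u (c (inverse u * (inverse v * w)))))"
      by (simp add: perm_qEnd_sum perm_qEnd_mult perm_qEnd_times sum_distrib_left mult.assoc)
    finally show "(\<Sum>u\<in>UNIV. (\<Sum>v\<in>UNIV. a v * perm_qEnd v (b (inverse v * u))) * perm_qEnd u (c (inverse u * w))) =
       (\<Sum>v\<in>UNIV. a v * perm_qEnd v (\<Sum>u\<in>UNIV. b u * perm_qEnd u (c (inverse u * (inverse v * w)))))" .
  qed
  show "1 * a = a"
  proof (transfer, intro ext)
    fix a :: "'a perm \<Rightarrow> ('a, 'b) qEnd" and w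
    have "(\<Sum>u\<in>UNIV. (if u = 1 then 1 else 0) * perm_qEnd u (a (inverse u * w))) =
       (\<Sum>u\<in>UNIV. if 1 = u then perm_qEnd u (a (inverse u * w)) else 0)"
      by (rule sum.cong) auto
    then show "(\<Sum>u\<in>UNIV. (if u = 1 then 1 else 0) * perm_qEnd u (a (inverse u * w))) = a w"
      by (simp add: perm_qEnd_id)
  qed
  show "a * 1 = a"
  proof (transfer, intro ext)
    fix a :: "'a perm \<Rightarrow> ('a, 'b) qEnd" and w
    have e: "inverse u * w = 1 \<longleftrightarrow> w = u" for u :: "'a perm"
      by (metis mult.assoc perm.left_inverse perm.right_inverse mult_1_left mult_1_right)
    have "(\<Sum>u\<in>UNIV. a u * perm_qEnd u (if inverse u * w = 1 then 1 else 0)) =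
       (\<Sum>u\<in>UNIV. if w = u then a u else 0)"
      by (rule sum.cong) (auto simp: e perm_qEnd_one perm_qEnd_zero)
    then show "(\<Sum>u\<in>UNIV. a u * perm_qEnd u (if inverse u * w = 1 then 1 else 0)) = a w"
      by simp
  qed
  show "a + b + c = a + (b + c)" by transfer (simp add: add.assoc)
  show "a + b = b + a" by transfer (simp add: add.commute)
  show "0 + a = a" by transfer simp
  show "- a + a = 0" by transfer simp
  show "a - b = a + - b" by transfer simp
  show "(a + b) * c = a * c + b * c" by transfer (simp add: distrib_right sum.distrib)
  show "a * (b + c) = a * b + a * c" by transfer (simp add: distrib_left sum.distrib perm_qEnd_add)
  show "(0::('a, 'b) crossed) \<noteq> 1" by transfer (auto simp: fun_eq_iff)
qed

end

definition emb :: "('n::{finite,linorder}, 'd::finite) qEnd \<Rightarrow> ('n, 'd) crossed" where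
  "emb b = Crossed (\<lambda>w. if w = 1 then b else 0)"

definition hat :: "'n perm \<Rightarrow> ('n::{finite,linorder}, 'd::finite) crossed" where
  "hat w = Crossed (\<lambda>u. if u = w then 1 else 0)"

definition scal :: "'n::{finite,linorder} quantum \<Rightarrow> ('n, 'd::finite) crossed" where
  "scal a = emb (scalar_mat a)"

lemma hat_emb:
  fixes w :: "'n::{finite,linorder} perm"
  shows "hat w * emb b = emb (perm_qEnd w b) * hat w"
proof -
  have "crossed_coeff (hat w * emb b) v = crossed_coeff (emb (perm_qEnd w b) * hat w) v" for v
  proof -
    have e: "inverse u * v = 1 \<longleftrightarrow> v = u" for u :: "'n perm"
      by (metis mult.assoc perm.left_inverse perm.right_inverse mult_1_left mult_1_right)
    have "crossed_coeff (hat w * emb b) v = (\<Sum>u\<in>UNIV. if w = u then (if v = u then perm_qEnd u b else 0) else 0)"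
      unfolding times_crossed.rep_eq
      by (rule sum.cong) (auto simp: hat_def emb_def Crossed_inverse e perm_qEnd_zero)
    moreover have "crossed_coeff (emb (perm_qEnd w b) * hat w) v =
        (\<Sum>u::'n perm\<in>UNIV. if 1 = u then (if v = w then perm_qEnd w b else 0) else 0)"
      unfolding times_crossed.rep_eq
      by (rule sum.cong) (auto simp: hat_def emb_def Crossed_inverse perm_qEnd_zero perm_qEnd_one)
    ultimately show ?thesis by simp
  qed
  then have "crossed_coeff (hat w * emb b) = crossed_coeff (emb (perm_qEnd w b) * hat w)" by (rule ext)
  then show ?thesis by (simp add: crossed_coeff_inject)
qed

text \<open>The index 1 and the subgroup of permutations of the other indices.\<close>

definition first :: "'n::{finite,linorder}" where
  "first = Min UNIV"

definition W_prime :: "'n::{finite,linorder} perm set" where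
  "W_prime = {w. w \<langle>$\<rangle> first = first}"

definition e_prime :: "('n::{finite,linorder}, 'd::finite) crossed" where
  "e_prime = scal (const_q (1 / fact (CARD('n) - 1))) * (\<Sum>w\<in>W_prime. hat w)"

definition rep_matrix :: "('n::{finite,linorder}, 'd::finite) crossed \<Rightarrow> (('n, 'd) qEnd, 'n) sqmat" where
  "rep_matrix a = (THE A. \<forall>i. a * e_prime * hat \<langle>first \<leftrightarrow> i\<rangle> =
     (\<Sum>j\<in>UNIV. e_prime * hat \<langle>first \<leftrightarrow> j\<rangle> * emb (entry A j i)))"

section \<open>Elliptic functions and the Baxter--Belavin $R$-matrix\<close>

definition theta :: "complex \<Rightarrow> complex \<Rightarrow> complex" where
  "theta z \<tau> = - (\<Sum>\<^sub>\<infinity>k::int. exp (pi * \<i> * (of_int k + 1/2)\<^sup>2 * \<tau> + 2 * pi * \<i> * (of_int k + 1/2) * (z + 1/2)))"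

definition phi :: "complex \<Rightarrow> complex \<Rightarrow> complex \<Rightarrow> complex" where
  "phi z \<mu> \<tau> = deriv (\<lambda>z. theta z \<tau>) 0 * theta (z + \<mu>) \<tau> / (theta z \<tau> * theta \<mu> \<tau>)"

definition weierstrass_p :: "complex \<Rightarrow> complex \<Rightarrow> complex" where
  "weierstrass_p \<tau> z = 1 / z\<^sup>2 + (\<Sum>\<^sub>\<infinity>(m::int, k::int)\<in>UNIV - {(0, 0)}.
     1 / (z - (of_int m + of_int k * \<tau>))\<^sup>2 - 1 / (of_int m + of_int k * \<tau>)\<^sup>2)"

definition lattice :: "complex \<Rightarrow> complex set" where
  "lattice \<tau> = {of_int m + of_int k * \<tau> | m k. True}"

definition R_coeff :: "complex \<Rightarrow> nat \<Rightarrow> int \<Rightarrow> int \<Rightarrow> int \<Rightarrow> int \<Rightarrow> complex \<Rightarrow> complex \<Rightarrow> complex" where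
  "R_coeff \<tau> d \<alpha> \<beta> \<gamma> \<delta> z \<mu> = (if (\<alpha> + \<gamma>) mod int d = (\<beta> + \<delta>) mod int d then
      exp (2 * pi * \<i> / of_nat d * (of_int ((\<gamma> - \<beta>) * (\<beta> - \<alpha>)) * \<tau> + of_int (\<gamma> - \<beta>) * \<mu> + of_int (\<beta> - \<alpha>) * z)) *
      phi (z + of_int (\<gamma> - \<beta>) * \<tau>) (\<mu> + of_int (\<beta> - \<alpha>) * \<tau>) (of_nat d * \<tau>)
    else 0)"

text \<open>The position, from 1 to \<open>d\<close>, of an element of a linearly ordered type with \<open>d\<close> elements.\<close>

definition pos :: "'d::{finite,linorder} \<Rightarrow> int" where
  "pos a = int (card {..a})"

text \<open>\<open>R_op \<tau> i j \<mu>\<close> is $R_{ij}(x_i - x_j, \mu)$.\<close>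

definition R_op :: "complex \<Rightarrow> 'n \<Rightarrow> 'n \<Rightarrow> complex \<Rightarrow> ('n::{finite,linorder}, 'd::{finite,linorder}) qEnd" where
  "R_op \<tau> i j \<mu> = Sqmat (\<lambda>s t. if \<forall>k. k \<noteq> i \<and> k \<noteq> j \<longrightarrow> s k = t k
     then fun_q (abs_mero (\<lambda>x. R_coeff \<tau> CARD('d) (pos (s i)) (pos (t i)) (pos (s j)) (pos (t j)) (x $ i - x $ j) \<mu>))
     else 0)"

definition dunkl :: "complex \<Rightarrow> complex \<Rightarrow> complex^('n::{finite,linorder}) \<Rightarrow> 'n \<Rightarrow> ('n, 'd::{finite,linorder}) crossed" where
  "dunkl \<tau> g l i = scal (p_hat i) -
     scal (const_q g) * (\<Sum>j\<in>UNIV - {i}. emb (R_op \<tau> i j (l $ i - l $ j)) * hat \<langle>i \<leftrightarrow> j\<rangle>)"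

section \<open>Elliptic Calogero--Moser Hamiltonians\<close>

definition pairings :: "nat \<Rightarrow> ('n::finite set set \<times> 'n set) set" where
  "pairings r = {(M, K). (\<forall>e\<in>M. card e = 2) \<and> pairwise disjnt M \<and> K \<inter> \<Union>M = {} \<and> 2 * card M + card K = r}"

text \<open>The expression $h_r$ with \<open>u i j\<close> in place of $g^2\wp(x_i-x_j)$ and \<open>p\<close> in place of the momenta;
  the factors indexed by \<open>K\<close> are multiplied in increasing order.\<close>

definition eCM_poly :: "nat \<Rightarrow> ('s::comm_ring_1 \<Rightarrow> 'a::ring_1) \<Rightarrow> ('n::{finite,linorder} \<Rightarrow> 'n \<Rightarrow> 's) \<Rightarrow> ('n \<Rightarrow> 'a) \<Rightarrow> 'a" where
  "eCM_poly r \<iota> u p = (\<Sum>(M, K)\<in>pairings r.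
     \<iota> (\<Prod>e\<in>M. u (Min e) (Max e)) * prod_list (map p (sorted_list_of_set K)))"

definition eCM_classical :: "complex \<Rightarrow> complex \<Rightarrow> nat \<Rightarrow> 'n::{finite,linorder} classical" where
  "eCM_classical \<tau> g r = eCM_poly r (pm_single 0)
     (\<lambda>i j. abs_mero (\<lambda>x. g\<^sup>2 * weierstrass_p \<tau> (x $ i - x $ j))) (\<lambda>k. pm_single (pm_single k 1) 1)"

text \<open>$h_r(\lambda, y)$\<close>

definition eCM_dunkl :: "complex \<Rightarrow> complex \<Rightarrow> nat \<Rightarrow> complex^('n::{finite,linorder}) \<Rightarrow> ('n, 'd::{finite,linorder}) crossed" where
  "eCM_dunkl \<tau> g r l = eCM_poly r (\<lambda>c. scal (const_q c))
     (\<lambda>i j. g\<^sup>2 * weierstrass_p \<tau> (l $ i - l $ j)) (dunkl \<tau> g l)"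

definition W_invariant :: "'n::{finite,linorder} quantum \<Rightarrow> bool" where
  "W_invariant a \<longleftrightarrow> (\<forall>w. perm_q w a = a)"

definition quantum_eCM_lifts :: "complex \<Rightarrow> complex \<Rightarrow> (nat \<Rightarrow> 'n::{finite,linorder} quantum) \<Rightarrow> bool" where
  "quantum_eCM_lifts \<tau> g Ht \<longleftrightarrow>
     (\<forall>r\<in>{1..CARD('n)}. W_invariant (Ht r) \<and> eta0 (Ht r) = eCM_classical \<tau> g r) \<and>
     (\<forall>r\<in>{1..CARD('n)}. \<forall>s\<in>{1..CARD('n)}. commutator (Ht r) (Ht s) = 0) \<and>
     Ht 1 = (\<Sum>i\<in>UNIV. p_hat i) \<and>
     (CARD('n) \<ge> 2 \<longrightarrow> (Ht 1)\<^sup>2 - 2 * Ht 2 = (\<Sum>i\<in>UNIV. (p_hat i)\<^sup>2) -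
        2 * const_q g * (const_q g - hbar_q) *
        (\<Sum>(i, j)\<in>{(i, j). i < j}. fun_q (abs_mero (\<lambda>x. weierstrass_p \<tau> (x $ i - x $ j)))))"

inductive_set complex_subalgebra :: "'n::{finite,linorder} quantum set \<Rightarrow> 'n quantum set" for S where
  const: "const_q c \<in> complex_subalgebra S"
| gen: "a \<in> S \<Longrightarrow> a \<in> complex_subalgebra S"
| add: "a \<in> complex_subalgebra S \<Longrightarrow> b \<in> complex_subalgebra S \<Longrightarrow> a + b \<in> complex_subalgebra S"
| mult: "a \<in> complex_subalgebra S \<Longrightarrow> b \<in> complex_subalgebra S \<Longrightarrow> a * b \<in> complex_subalgebra S"

section \<open>Dependence on the spectral variables\<close>

definition joint :: "complex^'n \<Rightarrow> complex^'n \<Rightarrow> complex^('n + 'n)" where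
  "joint x l = (\<chi> k. case k of Inl i \<Rightarrow> x $ i | Inr i \<Rightarrow> l $ i)"

text \<open>A family of meromorphic functions of \<open>x\<close> is regular on \<open>N\<close> if it is given by one function, holomorphic
  in \<open>(x, \<lambda>)\<close> on an open set that meets each fibre over \<open>N\<close> in a dense subset.\<close>

definition regular_family :: "(complex^'n) set \<Rightarrow> (complex^'n \<Rightarrow> 'n mero) \<Rightarrow> bool" where
  "regular_family N F \<longleftrightarrow> (\<exists>\<Omega> f. f mholo_on \<Omega> \<and> (\<forall>l\<in>N. closure {x. joint x l \<in> \<Omega>} = UNIV \<and>
     (\<exists>q. meromorphic_fun q \<and> F l = abs_mero q \<and> (\<forall>x. joint x l \<in> \<Omega> \<longrightarrow> q x = f (joint x l)))))"

definition regular_crossed :: "(complex^('n::{finite,linorder})) set \<Rightarrow> (complex^('n::{finite,linorder}) \<Rightarrow> ('n, 'd::finite) crossed) \<Rightarrow> bool" where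
  "regular_crossed N a \<longleftrightarrow> (\<forall>w s t \<alpha> k.
     regular_family N (\<lambda>l. fps_nth (pm_lookup (symbol (entry (crossed_coeff (a l) w) s t)) \<alpha>) k))"

text \<open>$h_r(\lambda,y)$ is defined for $\lambda_i-\lambda_j \notin \mathbb{Z}+\mathbb{Z}\tau$.\<close>

definition eCM_decomposition :: "complex \<Rightarrow> complex \<Rightarrow> (nat \<Rightarrow> 'n quantum) \<Rightarrow> nat \<Rightarrow> 'n quantum \<Rightarrow>
    (complex^('n::{finite,linorder}) \<Rightarrow> ('n, 'd::{finite,linorder}) crossed) \<Rightarrow> bool" where
  "eCM_decomposition \<tau> g Ht r H a \<longleftrightarrow>
     H \<in> complex_subalgebra (Ht ` {1..CARD('n)}) \<and> W_invariant H \<and>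
     (\<exists>N. open N \<and> 0 \<in> N \<and> regular_crossed N a \<and>
        (\<forall>l\<in>N. (\<forall>i j. i \<noteq> j \<longrightarrow> l $ i - l $ j \<notin> lattice \<tau>) \<longrightarrow>
           eCM_dunkl \<tau> g r l = scal H + scal hbar_q * a l))"

text \<open>$\lambda^0 = (\mu, 0, \dots, 0)$\<close>

definition special_point :: "complex \<Rightarrow> complex^('n::{finite,linorder})" where
  "special_point \<mu> = (\<chi> i. if i = first then \<mu> else 0)"

end

theory Submission
  imports Defs
begin

text \<open>
  The Lax equation is the identity \<open>[h\<^sub>r(\<lambda>, y), y\<^sub>1] = 0\<close>, read in the right module
  \<open>e' * crossed product\<close>. The Dunkl operators \<open>y\<^sub>i(\<lambda>)\<close> commute, hence so do \<open>h\<^sub>r(\<lambda>, y) = H\<^sub>r + \<hbar> a\<^sub>r\<close> and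
  \<open>y\<^sub>1\<close>; and since the scalar invariant \<open>H\<^sub>r\<close> is represented by \<open>H\<^sub>r\<close> times the identity matrix, taking
  matrices turns \<open>[H\<^sub>r + \<hbar> a\<^sub>r, y\<^sub>1] = 0\<close> into \<open>[H\<^sub>r 1, L] = \<hbar> [L, A\<^sub>r]\<close>.

  Commutativity of the \<open>y\<^sub>i\<close> (\<open>dunkl_commute\<close>) rests on two properties of the R-matrix: skew-symmetry, and the
  associative Yang--Baxter equation
  \<open>R\<^sub>i\<^sub>j(x, a) R\<^sub>i\<^sub>k(x + y, b) + R\<^sub>i\<^sub>k(x + y, a + b) R\<^sub>j\<^sub>k(y, - a) = R\<^sub>j\<^sub>k(y, b) R\<^sub>i\<^sub>j(x, a + b)\<close>
  (\<open>R_op_AYBE\<close>). The indices of \<open>R\<close> are conserved modulo \<open>d\<close>, so each matrix entry of such a product has a single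
  intermediate state, and the equation reduces to the Fay identity of the Kronecker function \<open>phi\<close>. That
  identity is in turn a Pluecker relation: \<open>theta (x + y) * theta (x - y)\<close> has the form
  \<open>F x * G y - G x * F y\<close> (\<open>theta_product\<close>).

  At \<open>\<lambda>\<^sup>0 = (\<mu>, 0, \<dots>, 0)\<close> the operators \<open>y\<^sub>i\<close> with \<open>i > 1\<close> are singular as soon as \<open>n > 2\<close>, and the decomposition of \<open>h\<^sub>r(\<lambda>, y)\<close> is given for
  generic \<open>\<lambda>\<close> only. The identities are therefore proved for generic \<open>\<lambda>\<close> and carried to \<open>\<lambda>\<^sup>0\<close> by continuity: both
  \<open>a\<^sub>r\<close> and \<open>y\<^sub>1\<close> are regular there, regular families are closed under the operations of the crossed product,
  and a regular family that vanishes at generic points vanishes everywhere (\<open>regular_crossed_limit\<close>).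
  In the same way the equivariance \<open>w h\<^sub>r(\<lambda>, y) = h\<^sub>r(w \<lambda>, y) w\<close> gives that \<open>a\<^sub>r\<close> commutes with the stabiliser of the
  first index at \<open>\<lambda>\<^sup>0\<close>, which that stabiliser fixes.

  The classical statement follows because \<open>eta0\<close> is multiplicative and sends \<open>\<hbar>\<^sup>-\<^sup>1 [a, b]\<close> to the Poisson bracket
  (\<open>poisson_eta0\<close>).
\<close>

text \<open>The notation is kept for summability of the norms in the sense of \<open>infsum\<close>.\<close>

no_notation Infinite_Set_Sum.abs_summable_on (infix \<open>abs'_summable'_on\<close> 50)

section \<open>The theta function\<close>

definition theta_term :: "complex \<Rightarrow> complex \<Rightarrow> complex \<Rightarrow> complex" where
  "theta_term \<tau> z p = exp (pi * \<i> * p\<^sup>2 * \<tau> + 2 * pi * \<i> * p * z)"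

text \<open>Theta series over the shifted lattice \<open>\<int> + r\<close>. The Jacobi function is the case \<open>r = 1/2\<close>; the product formula for it
  needs both \<open>r = 0\<close> and \<open>r = 1/2\<close>, at the doubled modulus.\<close>

definition theta_char :: "real \<Rightarrow> complex \<Rightarrow> complex \<Rightarrow> complex" where
  "theta_char r \<tau> z = (\<Sum>\<^sub>\<infinity>k::int. theta_term \<tau> z (of_int k + of_real r))"

lemma exp_two_pi_int: "exp (2 * pi * \<i> * of_int k) = 1"
  using exp_integer_2pi[of "of_int k"] by (simp add: mult_ac)

lemma theta_eq: "theta z \<tau> = - theta_char (1/2) \<tau> (z + 1/2)"
  by (simp add: theta_def theta_char_def theta_term_def)

lemma summable_exp_abs: "(\<lambda>k::int. exp (- \<bar>real_of_int k\<bar>)) summable_on UNIV"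
proof -
  have geo: "(\<lambda>n::nat. exp (- real n)) summable_on UNIV"
  proof (rule norm_summable_imp_summable_on)
    have "norm (exp (- real n)) = exp (-1 :: real) ^ n" for n
      by (simp add: exp_of_nat_mult[symmetric])
    then show "summable (\<lambda>n. norm (exp (- real n)))" by (simp add: summable_geometric)
  qed
  have "(\<lambda>k::int. exp (- \<bar>real_of_int k\<bar>)) summable_on range int"
    using geo by (subst summable_on_reindex) (auto simp: o_def)
  moreover have "(\<lambda>k::int. exp (- \<bar>real_of_int k\<bar>)) summable_on range (\<lambda>n. - int n)"
    using geo by (subst summable_on_reindex) (auto simp: o_def inj_def)
  moreover have "range (\<lambda>n. - int n) - range int \<subseteq> range (\<lambda>n. - int n)" by auto
  ultimately have "(\<lambda>k::int. exp (- \<bar>real_of_int k\<bar>)) summable_on range int \<union> (range (\<lambda>n. - int n) - range int)"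
    by (intro summable_on_Un_disjoint) (auto intro: summable_on_subset_banach)
  moreover have "range int \<union> (range (\<lambda>n. - int n) - range int) = UNIV"
  proof -
    have "k \<in> range int \<or> k \<in> range (\<lambda>n. - int n)" for k
      by (metis int_cases2 rangeI)
    then show ?thesis by blast
  qed
  ultimately show ?thesis by simp
qed

text \<open>Completing the square: the quadratic exponent absorbs any linear one, uniformly on horizontal strips. The
  right-hand side is summable and depends on \<open>z\<close> only through \<open>B\<close>, which yields both absolute and locally uniform convergence.\<close>

lemma theta_term_bound:
  fixes k :: int
  assumes "Im \<tau> > 0" "\<bar>Im z\<bar> \<le> B"
  shows "norm (theta_term \<tau> z (of_int k + of_real r)) \<le>
     exp ((2 * pi * B + 1)\<^sup>2 / (4 * (pi * Im \<tau>)) + \<bar>r\<bar>) * exp (- \<bar>real_of_int k\<bar>)"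
proof -
  define p where "p = real_of_int k + r"
  define c where "c = pi * Im \<tau>"
  have c: "c > 0" using assms by (simp add: c_def)
  have B: "B \<ge> 0" using assms(2) by linarith
  have e: "of_int k + of_real r = (of_real p :: complex)" by (simp add: p_def)
  have "norm (theta_term \<tau> z (of_real p)) = exp (- c * p\<^sup>2 - 2 * pi * p * Im z)"
    by (simp add: theta_term_def norm_exp_eq_Re c_def power2_eq_square algebra_simps)
  also have "- 2 * pi * p * Im z \<le> 2 * pi * B * \<bar>p\<bar>"
  proof -
    have "- (p * Im z) \<le> \<bar>p\<bar> * \<bar>Im z\<bar>" by (metis abs_ge_minus_self abs_mult)
    also have "\<dots> \<le> \<bar>p\<bar> * B" using assms by (simp add: mult_left_mono)
    finally have "2 * pi * (- (p * Im z)) \<le> 2 * pi * (\<bar>p\<bar> * B)" by (intro mult_left_mono) auto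
    then show ?thesis by (simp add: algebra_simps)
  qed
  then have "- c * p\<^sup>2 - 2 * pi * p * Im z \<le> - c * p\<^sup>2 + 2 * pi * B * \<bar>p\<bar>" by simp
  also have "\<dots> \<le> (2 * pi * B + 1)\<^sup>2 / (4 * c) - \<bar>p\<bar>"
  proof -
    have "0 \<le> c * (\<bar>p\<bar> - (2 * pi * B + 1) / (2 * c))\<^sup>2" using c by simp
    also have "\<dots> = c * p\<^sup>2 - (2 * pi * B + 1) * \<bar>p\<bar> + (2 * pi * B + 1)\<^sup>2 / (4 * c)"
      using c by (simp add: power2_eq_square field_simps)
    finally show ?thesis by (simp add: algebra_simps)
  qed
  also have "\<dots> \<le> (2 * pi * B + 1)\<^sup>2 / (4 * c) + \<bar>r\<bar> - \<bar>real_of_int k\<bar>"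
    by (simp add: p_def)
  finally have "norm (theta_term \<tau> z (of_real p)) \<le> exp ((2 * pi * B + 1)\<^sup>2 / (4 * c) + \<bar>r\<bar> - \<bar>real_of_int k\<bar>)"
    by simp
  then show ?thesis by (simp add: e c_def exp_diff exp_minus field_simps)
qed

lemma theta_bound_summable: "(\<lambda>k::int. C * exp (- \<bar>real_of_int k\<bar>)) summable_on UNIV"
  by (intro summable_on_cmult_right summable_exp_abs)

lemma theta_term_abs_summable:
  assumes "Im \<tau> > 0"
  shows "(\<lambda>k::int. theta_term \<tau> z (of_int k + of_real r)) abs_summable_on UNIV"
proof (rule Infinite_Sum.abs_summable_on_comparison_test)
  let ?C = "exp ((2 * pi * \<bar>Im z\<bar> + 1)\<^sup>2 / (4 * (pi * Im \<tau>)) + \<bar>r\<bar>)"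
  show "(\<lambda>k::int. ?C * exp (- \<bar>real_of_int k\<bar>)) abs_summable_on UNIV"
    using theta_bound_summable[of ?C] by simp
  show "norm (theta_term \<tau> z (of_int k + of_real r)) \<le> norm (?C * exp (- \<bar>real_of_int k\<bar>))" for k :: int
    using theta_term_bound[OF assms order.refl, of z k r] by simp
qed

lemma theta_char_uniform:
  assumes "Im \<tau> > 0"
  shows "uniform_limit {z. \<bar>Im z\<bar> \<le> B} (\<lambda>X z. \<Sum>k\<in>X. theta_term \<tau> z (of_int k + of_real r))
    (theta_char r \<tau>) (finite_subsets_at_top UNIV)"
proof -
  have "uniform_limit {z. \<bar>Im z\<bar> \<le> B} (\<lambda>X z. \<Sum>k\<in>X. theta_term \<tau> z (of_int k + of_real r))
    (\<lambda>z. \<Sum>\<^sub>\<infinity>k. theta_term \<tau> z (of_int k + of_real r)) (finite_subsets_at_top UNIV)"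
    by (rule Weierstrass_m_test_general[OF theta_term_bound theta_bound_summable]) (use assms in auto)
  then show ?thesis by (simp add: theta_char_def[abs_def])
qed

lemma theta_char_holomorphic:
  assumes "Im \<tau> > 0" shows "theta_char r \<tau> holomorphic_on UNIV"
proof -
  have "theta_char r \<tau> field_differentiable at z" for z
  proof -
    have sub: "cball z 1 \<subseteq> {w. \<bar>Im w\<bar> \<le> \<bar>Im z\<bar> + 1}"
    proof
      fix w assume "w \<in> cball z 1"
      then have "\<bar>Im (z - w)\<bar> \<le> 1" using abs_Im_le_cmod[of "z - w"] by (simp add: dist_norm)
      then show "w \<in> {w. \<bar>Im w\<bar> \<le> \<bar>Im z\<bar> + 1}" by simp
    qed
    have "theta_char r \<tau> holomorphic_on ball z 1"
    proof (rule holomorphic_uniform_limit[OF _ uniform_limit_on_subset[OF theta_char_uniform[OF assms] sub]])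
      show "\<forall>\<^sub>F X in finite_subsets_at_top UNIV.
         continuous_on (cball z 1) (\<lambda>z. \<Sum>k\<in>X. theta_term \<tau> z (of_int k + of_real r)) \<and>
         (\<lambda>z. \<Sum>k\<in>X. theta_term \<tau> z (of_int k + of_real r)) holomorphic_on ball z 1"
        unfolding theta_term_def
        by (intro always_eventually allI conjI) (intro continuous_intros holomorphic_intros)+
    qed (auto simp: finite_subsets_at_top_neq_bot)
    then show ?thesis by (simp add: holomorphic_on_open field_differentiable_def)
  qed
  then show ?thesis by (auto simp: holomorphic_on_def intro: field_differentiable_at_within)
qed

lemma theta_holomorphic:
  assumes "Im \<tau> > 0" shows "(\<lambda>z. theta z \<tau>) holomorphic_on S"
proof -
  have "(theta_char (1/2) \<tau> \<circ> (\<lambda>z. z + 1/2)) holomorphic_on UNIV"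
    by (intro holomorphic_on_compose holomorphic_intros holomorphic_on_subset[OF theta_char_holomorphic[OF assms]]) auto
  then have "(\<lambda>z. - theta_char (1/2) \<tau> (z + 1/2)) holomorphic_on UNIV"
    by (intro holomorphic_intros) (simp add: o_def)
  then show ?thesis unfolding theta_eq by (rule holomorphic_on_subset) simp
qed

lemma theta_odd: "theta (- z) \<tau> = - theta z \<tau>"
proof -
  have b: "bij (\<lambda>k::int. - 1 - k)" by (rule bij_betw_byWitness[where f' = "\<lambda>k. - 1 - k"]) auto
  have "theta_char (1/2) \<tau> (- z + 1/2) = (\<Sum>\<^sub>\<infinity>k. theta_term \<tau> (- z + 1/2) (of_int (- 1 - k) + of_real (1/2)))"
    unfolding theta_char_def by (rule infsum_reindex_bij_betw[OF b, symmetric])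
  also have "\<dots> = (\<Sum>\<^sub>\<infinity>k. - theta_term \<tau> (z + 1/2) (of_int k + of_real (1/2)))"
  proof (rule infsum_cong)
    fix k :: int
    have "theta_term \<tau> (- z + 1/2) (of_int (- 1 - k) + of_real (1/2)) =
      theta_term \<tau> (z + 1/2) (of_int k + of_real (1/2)) * exp (2 * pi * \<i> * of_int (- k - 1) + pi * \<i>)"
      unfolding theta_term_def exp_add[symmetric]
      by (rule arg_cong[of _ _ exp]) (simp add: power2_eq_square algebra_simps)
    also have "exp (2 * pi * \<i> * of_int (- k - 1) + pi * \<i>) = -1"
      unfolding exp_add exp_two_pi_int by simp
    finally show "theta_term \<tau> (- z + 1/2) (of_int (- 1 - k) + of_real (1/2)) =
      - theta_term \<tau> (z + 1/2) (of_int k + of_real (1/2))" by simp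
  qed
  also have "\<dots> = - theta_char (1/2) \<tau> (z + 1/2)" by (simp add: theta_char_def infsum_uminus)
  finally show ?thesis by (simp add: theta_eq)
qed

lemma theta_quasi_periodic: "theta (z + \<tau>) \<tau> = - exp (- pi * \<i> * \<tau> - 2 * pi * \<i> * z) * theta z \<tau>"
proof -
  have b: "bij (\<lambda>k::int. k + 1)" by (rule bij_betw_byWitness[where f' = "\<lambda>k. k - 1"]) auto
  let ?c = "- exp (- pi * \<i> * \<tau> - 2 * pi * \<i> * z)"
  have "?c * theta_char (1/2) \<tau> (z + 1/2) = ?c * (\<Sum>\<^sub>\<infinity>k. theta_term \<tau> (z + 1/2) (of_int (k + 1) + of_real (1/2)))"
    unfolding theta_char_def by (subst infsum_reindex_bij_betw[OF b]) simp
  also have "\<dots> = (\<Sum>\<^sub>\<infinity>k. ?c * theta_term \<tau> (z + 1/2) (of_int (k + 1) + of_real (1/2)))"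
    by (rule infsum_cmult_right'[symmetric])
  also have "\<dots> = theta_char (1/2) \<tau> (z + \<tau> + 1/2)"
    unfolding theta_char_def
  proof (rule infsum_cong)
    fix k :: int
    have "theta_term \<tau> (z + \<tau> + 1/2) (of_int k + of_real (1/2)) =
      exp (- pi * \<i>) * exp (- pi * \<i> * \<tau> - 2 * pi * \<i> * z) * theta_term \<tau> (z + 1/2) (of_int (k + 1) + of_real (1/2))"
      unfolding theta_term_def exp_add[symmetric]
      by (rule arg_cong[of _ _ exp]) (simp add: power2_eq_square field_simps)
    also have "exp (- pi * \<i>) = -1" by (simp add: exp_minus)
    finally show "?c * theta_term \<tau> (z + 1/2) (of_int (k + 1) + of_real (1/2)) =
       theta_term \<tau> (z + \<tau> + 1/2) (of_int k + of_real (1/2))" by simp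
  qed
  finally show ?thesis by (simp add: theta_eq)
qed

text \<open>The zeroth Fourier coefficient of \<open>exp (- \<i> pi z) * theta_char (1/2) \<tau> z\<close> is \<open>exp (pi \<i> \<tau> / 4)\<close>, which is not zero. It
  is the limit of the integrals of the partial sums over \<open>{0..1}\<close>, because the series converges uniformly there.\<close>

lemma theta_not_identically_zero:
  assumes "Im \<tau> > 0" shows "\<exists>z. theta z \<tau> \<noteq> 0"
proof (rule ccontr)
  assume "\<not> ?thesis"
  then have z: "theta_char (1/2) \<tau> z = 0" for z
    using theta_eq[of "z - 1/2" \<tau>] by (metis add.inverse_inverse diff_add_cancel neg_0_equal_iff_equal)
  let ?f = "\<lambda>X t. \<Sum>k\<in>X. theta_term \<tau> (of_real t) (of_int k + of_real (1/2)) * exp (- (\<i> * pi) * of_real t)"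
  have lim: "uniform_limit {0..1::real} (\<lambda>X t. \<Sum>k\<in>X. theta_term \<tau> (of_real t) (of_int k + of_real (1/2)))
     (\<lambda>t. 0) (finite_subsets_at_top UNIV)"
    using uniform_limit_compose'[OF theta_char_uniform[OF assms, where B = 0 and r = "1/2"], of "of_real" "{0..1}"]
    by (simp add: z o_def)
  have lim': "uniform_limit {0..1} ?f (\<lambda>t. 0) (finite_subsets_at_top UNIV)"
    unfolding uniform_limit_iff
  proof (intro allI impI)
    fix e :: real assume "e > 0"
    with lim have "\<forall>\<^sub>F X in finite_subsets_at_top UNIV. \<forall>t\<in>{0..1}.
      dist (\<Sum>k\<in>X. theta_term \<tau> (of_real t) (of_int k + of_real (1/2))) 0 < e"
      by (rule uniform_limitD)
    then show "\<forall>\<^sub>F X in finite_subsets_at_top UNIV. \<forall>t\<in>{0..1}. dist (?f X t) 0 < e"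
      by eventually_elim (simp add: sum_distrib_right[symmetric] norm_mult)
  qed
  have int: "(?f X has_integral (if 0 \<in> X then exp (pi * \<i> * \<tau> / 4) else 0)) {0..1}" if "finite X" for X :: "int set"
  proof -
    have "((\<lambda>t. theta_term \<tau> (of_real t) (of_int k + of_real (1/2)) * exp (- (\<i> * pi) * of_real t)) has_integral
       (if k = 0 then exp (pi * \<i> * \<tau> / 4) else 0)) {0..1}" for k :: int
    proof -
      define c where "c = exp (pi * \<i> * (of_int k + 1/2)\<^sup>2 * \<tau>)"
      have e: "theta_term \<tau> (of_real t) (of_int k + of_real (1/2)) * exp (- (\<i> * pi) * of_real t) =
         c * exp (2 * pi * \<i> * of_int k * of_real t)" for t
        unfolding theta_term_def c_def exp_add[symmetric]
        by (rule arg_cong[of _ _ exp]) (simp add: algebra_simps)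
      show ?thesis
      proof (cases "k = 0")
        case True
        have "((\<lambda>t::real. c) has_integral c) {0..1}" using has_integral_const_real[of c 0 1] by simp
        then show ?thesis unfolding e using True by (simp add: c_def power2_eq_square)
      next
        case False
        let ?g = "\<lambda>t. c * (exp (2 * pi * \<i> * of_int k * t) / (2 * pi * \<i> * of_int k))"
        have d: "(?g has_field_derivative (c * exp (2 * pi * \<i> * of_int k * t))) (at t)" for t
          by (rule derivative_eq_intros refl | use False in simp)+
        have "((\<lambda>t. c * exp (2 * pi * \<i> * of_int k * of_real t)) has_integral ?g (of_real 1) - ?g (of_real 0)) {0..1}"
        proof (rule fundamental_theorem_of_calculus)
          fix t :: real
          show "((\<lambda>x. ?g (of_real x)) has_vector_derivative c * exp (2 * pi * \<i> * of_int k * of_real t)) (at t within {0..1})"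
            using has_vector_derivative_real_field[OF d] by (rule has_vector_derivative_at_within)
        qed simp
        then show ?thesis unfolding e using False exp_two_pi_int[of k] by simp
      qed
    qed
    then have "(?f X has_integral (\<Sum>k\<in>X. if k = 0 then exp (pi * \<i> * \<tau> / 4) else 0)) {0..1}"
      by (intro has_integral_sum that) auto
    then show ?thesis using that by simp
  qed
  have cont: "continuous_on {0..1} (?f X)" for X
    unfolding theta_term_def by (intro continuous_intros)
  obtain I J where IJ: "\<And>X. (?f X has_integral I X) {0..1}" "((\<lambda>t::real. 0) has_integral J) {0..1}"
     "(I \<longlongrightarrow> J) (finite_subsets_at_top (UNIV :: int set))"
    by (rule uniform_limit_integral[OF lim' cont finite_subsets_at_top_neq_bot]) (rule that)
  have J: "J = 0" using IJ(2) has_integral_0 has_integral_unique by blast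
  have "\<forall>\<^sub>F X in finite_subsets_at_top (UNIV :: int set). I X = exp (pi * \<i> * \<tau> / 4)"
    unfolding eventually_finite_subsets_at_top
  proof (intro exI[of _ "{0}"] conjI allI impI)
    fix X :: "int set" assume "finite X \<and> {0} \<subseteq> X \<and> X \<subseteq> UNIV"
    then show "I X = exp (pi * \<i> * \<tau> / 4)"
      using has_integral_unique[OF IJ(1)[of X] int[of X]] by simp
  qed auto
  then have "(I \<longlongrightarrow> exp (pi * \<i> * \<tau> / 4)) (finite_subsets_at_top (UNIV :: int set))"
    by (rule tendsto_eventually)
  with IJ(3) have "J = exp (pi * \<i> * \<tau> / 4)"
    using tendsto_unique finite_subsets_at_top_neq_bot by blast
  with J show False by simp
qed

lemma infsum_mult_product:
  fixes f :: "'a \<Rightarrow> complex" and g :: "'b \<Rightarrow> complex"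
  assumes "f abs_summable_on A" "g abs_summable_on B"
  shows "(\<lambda>(x, y). f x * g y) abs_summable_on A \<times> B"
    and "infsum f A * infsum g B = (\<Sum>\<^sub>\<infinity>(x, y)\<in>A \<times> B. f x * g y)"
proof -
  show s: "(\<lambda>(x, y). f x * g y) abs_summable_on A \<times> B"
    unfolding Infinite_Sum.abs_summable_on_Sigma_iff
  proof (intro conjI ballI)
    show "(\<lambda>y. case (x, y) of (x, y) \<Rightarrow> f x * g y) abs_summable_on B" for x
      using assms(2) by (simp add: norm_mult summable_on_cmult_right)
    have "(\<Sum>\<^sub>\<infinity>y\<in>B. norm (case (x, y) of (x, y) \<Rightarrow> f x * g y)) = norm (f x) * (\<Sum>\<^sub>\<infinity>y\<in>B. norm (g y))" for x
      by (simp add: norm_mult infsum_cmult_right')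
    moreover have "(\<Sum>\<^sub>\<infinity>y\<in>B. norm (g y)) \<ge> 0" by (rule infsum_nonneg) simp
    ultimately show "(\<lambda>x. \<Sum>\<^sub>\<infinity>y\<in>B. norm (case (x, y) of (x, y) \<Rightarrow> f x * g y)) abs_summable_on A"
      using assms(1) by (simp add: summable_on_cmult_left)
  qed
  then have "(\<lambda>(x, y). f x * g y) summable_on A \<times> B" by (rule abs_summable_summable)
  from infsum_Sigma_banach[OF this]
  have "(\<Sum>\<^sub>\<infinity>x\<in>A. \<Sum>\<^sub>\<infinity>y\<in>B. f x * g y) = (\<Sum>\<^sub>\<infinity>(x, y)\<in>A \<times> B. f x * g y)" by simp
  then show "infsum f A * infsum g B = (\<Sum>\<^sub>\<infinity>(x, y)\<in>A \<times> B. f x * g y)"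
    by (simp add: infsum_cmult_right' infsum_cmult_left')
qed

text \<open>In the double series for the left-hand side put \<open>u = m + n + 1\<close> and \<open>v = m - n\<close>. The exponent separates, since
  \<open>(m + 1/2)\<^sup>2 + (n + 1/2)\<^sup>2 = (u\<^sup>2 + v\<^sup>2) / 2\<close>, and exactly one of \<open>u\<close>, \<open>v\<close> is even; the case \<open>u\<close> odd carries a sign.\<close>

lemma theta_product:
  assumes "Im \<tau> > 0"
  shows "theta (x + y) \<tau> * theta (x - y) \<tau> =
     theta_char 0 (2 * \<tau>) (2 * x) * theta_char (1/2) (2 * \<tau>) (2 * y) -
     theta_char (1/2) (2 * \<tau>) (2 * x) * theta_char 0 (2 * \<tau>) (2 * y)"
proof -
  let ?t = "\<lambda>z k. theta_term \<tau> (z + 1/2) (of_int k + of_real (1/2))"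
  let ?F = "\<lambda>z k. theta_term (2 * \<tau>) (2 * z) (of_int k + of_real 0)"
  let ?G = "\<lambda>z k. theta_term (2 * \<tau>) (2 * z) (of_int k + of_real (1/2))"
  define P where "P = (\<lambda>(m::int, n::int). ?t (x + y) m * ?t (x - y) n)"
  define A where "A = (\<lambda>(k::int, l::int). (k + l, k - l - 1))"
  define B where "B = (\<lambda>(k::int, l::int). (k + l, k - l))"
  have t2: "Im (2 * \<tau>) > 0" using assms by simp
  note s = theta_term_abs_summable[OF assms] and s2 = theta_term_abs_summable[OF t2]
  have injA: "inj A" and injB: "inj B" by (auto simp: A_def B_def inj_def)
  \<comment> \<open>\<open>A\<close> parametrises the pairs with \<open>m + n\<close> odd and \<open>B\<close> those with \<open>m + n\<close> even\<close>
  have disj: "range A \<inter> range B = {}"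
  proof -
    have "A p \<noteq> B q" for p q
    proof
      assume "A p = B q"
      then have "fst p + snd p = fst q + snd q" "fst p - snd p - 1 = fst q - snd q"
        by (auto simp: A_def B_def split_beta)
      then have "2 * fst p - 1 = 2 * fst q" by linarith
      then show False by presburger
    qed
    then show ?thesis by blast
  qed
  have un: "range A \<union> range B = UNIV"
  proof -
    have "(m, n) \<in> range A \<union> range B" for m n
    proof (cases "even (m + n)")
      case True
      then have "(m, n) = B ((m + n) div 2, (m - n) div 2)" by (auto simp: B_def) presburger+
      then show ?thesis by blast
    next
      case False
      then have "(m, n) = A ((m + n + 1) div 2, (m - n - 1) div 2)" by (auto simp: A_def) presburger+
      then show ?thesis by blast
    qed
    then show ?thesis by auto
  qed
  have P: "P abs_summable_on UNIV"
    using infsum_mult_product(1)[OF s s, of "x + y + 1/2" "1/2" "x - y + 1/2" "1/2"]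
    by (simp add: P_def split_beta)
  have PA: "P (A (k, l)) = ?F x k * ?G y l" for k l
  proof -
    have "P (A (k, l)) = ?F x k * ?G y l * exp (2 * pi * \<i> * of_int k)"
      unfolding P_def A_def theta_term_def prod.case exp_add[symmetric]
      by (rule arg_cong[of _ _ exp]) (simp add: power2_eq_square field_simps)
    then show ?thesis unfolding exp_two_pi_int by simp
  qed
  have PB: "P (B (k, l)) = - (?G x k * ?F y l)" for k l
  proof -
    have "P (B (k, l)) = ?G x k * ?F y l * exp (2 * pi * \<i> * of_int k + pi * \<i>)"
      unfolding P_def B_def theta_term_def prod.case exp_add[symmetric]
      by (rule arg_cong[of _ _ exp]) (simp add: power2_eq_square field_simps)
    then show ?thesis unfolding exp_add exp_two_pi_int by simp
  qed
  have oA: "P \<circ> A = (\<lambda>(k, l). ?F x k * ?G y l)" and oB: "P \<circ> B = (\<lambda>(k, l). - (?G x k * ?F y l))"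
    by (rule ext; simp only: o_def split_paired_all prod.case PA PB)+
  have "theta (x + y) \<tau> * theta (x - y) \<tau> = theta_char (1/2) \<tau> (x + y + 1/2) * theta_char (1/2) \<tau> (x - y + 1/2)"
    by (simp add: theta_eq)
  also have "\<dots> = infsum P (UNIV \<times> UNIV)"
    unfolding theta_char_def P_def by (rule infsum_mult_product(2)[OF s s])
  also have "\<dots> = infsum P (range A \<union> range B)" by (simp add: un)
  also have "\<dots> = infsum P (range A) + infsum P (range B)"
    by (intro infsum_Un_disjoint disj summable_on_subset_banach[OF abs_summable_summable[OF P]]) auto
  also have "infsum P (range A) = (\<Sum>\<^sub>\<infinity>(k, l)\<in>UNIV \<times> UNIV. ?F x k * ?G y l)"
    by (subst infsum_reindex[OF injA]) (simp only: oA UNIV_Times_UNIV)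
  also have "\<dots> = theta_char 0 (2 * \<tau>) (2 * x) * theta_char (1/2) (2 * \<tau>) (2 * y)"
    unfolding theta_char_def by (rule infsum_mult_product(2)[OF s2 s2, symmetric])
  also have "infsum P (range B) = (\<Sum>\<^sub>\<infinity>(k, l)\<in>UNIV \<times> UNIV. - (?G x k * ?F y l))"
    by (subst infsum_reindex[OF injB]) (simp only: oB UNIV_Times_UNIV)
  also have "\<dots> = - (\<Sum>\<^sub>\<infinity>(k, l)\<in>UNIV \<times> UNIV. ?G x k * ?F y l)"
    unfolding split_beta by (rule infsum_uminus)
  also have "(\<Sum>\<^sub>\<infinity>(k, l)\<in>UNIV \<times> UNIV. ?G x k * ?F y l) = theta_char (1/2) (2 * \<tau>) (2 * x) * theta_char 0 (2 * \<tau>) (2 * y)"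
    unfolding theta_char_def by (rule infsum_mult_product(2)[OF s2 s2, symmetric])
  finally show ?thesis by simp
qed

text \<open>The Pluecker relation for the four vectors \<open>(F, G)\<close> at \<open>a\<close>, \<open>b\<close>, \<open>c\<close>, \<open>e\<close>.\<close>

lemma theta_three_term:
  assumes "Im \<tau> > 0"
  shows "theta (a + b) \<tau> * theta (a - b) \<tau> * (theta (c + e) \<tau> * theta (c - e) \<tau>) +
    theta (b + c) \<tau> * theta (b - c) \<tau> * (theta (a + e) \<tau> * theta (a - e) \<tau>) +
    theta (c + a) \<tau> * theta (c - a) \<tau> * (theta (b + e) \<tau> * theta (b - e) \<tau>) = 0"
  unfolding theta_product[OF assms] by (simp add: algebra_simps)

lemma phi_Fay:
  assumes t: "Im \<tau> > 0"
    and nz: "theta z1 \<tau> \<noteq> 0" "theta z2 \<tau> \<noteq> 0" "theta (z2 - z1) \<tau> \<noteq> 0"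
      "theta m1 \<tau> \<noteq> 0" "theta m2 \<tau> \<noteq> 0" "theta (m1 + m2) \<tau> \<noteq> 0"
  shows "phi z1 m1 \<tau> * phi z2 m2 \<tau> = phi z1 (m1 + m2) \<tau> * phi (z2 - z1) m2 \<tau> + phi z2 (m1 + m2) \<tau> * phi (z1 - z2) m1 \<tau>"
proof -
  let ?t = "\<lambda>z. theta z \<tau>"
  have n12: "?t (z1 - z2) = - ?t (z2 - z1)" using theta_odd[of "z2 - z1" \<tau>] by simp
  have key: "?t (z1 + m1) * ?t (z2 + m2) * (?t (z2 - z1) * ?t (m1 + m2)) =
     ?t (z1 + (m1 + m2)) * ?t (z2 - z1 + m2) * (?t z2 * ?t m1) -
     ?t (z2 + (m1 + m2)) * ?t (z1 - z2 + m1) * (?t z1 * ?t m2)"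
  proof -
    \<comment> \<open>the four points are solved from: a + b = z1 + m1, a - b = z2 + m2, c + e = z2 - z1, c - e = m1 + m2\<close>
    define a where "a = (z1 + m1 + z2 + m2) / 2"
    define b where "b = (z1 + m1 - z2 - m2) / 2"
    define c where "c = (z2 - z1 + m1 + m2) / 2"
    define e where "e = (z2 - z1 - m1 - m2) / 2"
    have E: "a + b = z1 + m1" "a - b = z2 + m2" "c + e = z2 - z1" "c - e = m1 + m2"
      "b + c = m1" "b - c = - (z2 - z1 + m2)" "a + e = z2" "a - e = z1 + (m1 + m2)"
      "c + a = z2 + (m1 + m2)" "c - a = - z1" "b + e = - m2" "b - e = z1 - z2 + m1"
      by (simp_all add: a_def b_def c_def e_def field_simps)
    show ?thesis
      using theta_three_term[OF t, of a b c e] unfolding E theta_odd by algebra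
  qed
  define k where "k = deriv (\<lambda>z. theta z \<tau>) 0"
  have "phi z1 m1 \<tau> * phi z2 m2 \<tau> = k\<^sup>2 * (?t (z1 + m1) * ?t (z2 + m2) * (?t (z2 - z1) * ?t (m1 + m2))) /
    (?t z1 * ?t m1 * (?t z2 * ?t m2) * (?t (z2 - z1) * ?t (m1 + m2)))"
    using nz by (simp add: phi_def k_def power2_eq_square mult_ac)
  also have "\<dots> = k * ?t (z1 + (m1 + m2)) / (?t z1 * ?t (m1 + m2)) * (k * ?t (z2 - z1 + m2) / (?t (z2 - z1) * ?t m2)) +
     k * ?t (z2 + (m1 + m2)) / (?t z2 * ?t (m1 + m2)) * (k * ?t (z1 - z2 + m1) / (- ?t (z2 - z1) * ?t m1))"
    unfolding key using nz by (simp add: field_simps power2_eq_square)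
  finally show ?thesis by (simp add: phi_def k_def n12)
qed


section \<open>The coefficients of the R-matrix\<close>

text \<open>The exponential makes the quasi-periodic \<open>phi\<close> periodic under \<open>T\<close> in both arguments. For \<open>T = d \<tau>\<close> all coefficients of
  the R-matrix are, up to a common exponential factor, values of this one function at translates by multiples of \<open>\<tau>\<close>, and the translates matter modulo \<open>d\<close> only.\<close>

definition Phi :: "complex \<Rightarrow> complex \<Rightarrow> complex \<Rightarrow> complex" where
  "Phi T z \<mu> = exp (2 * pi * \<i> * z * \<mu> / T) * phi z \<mu> T"

lemma Phi_sym: "Phi T z \<mu> = Phi T \<mu> z"
  by (simp add: Phi_def phi_def mult_ac add.commute)

lemma Phi_odd: "Phi T (- z) (- \<mu>) = - Phi T z \<mu>"
  using theta_odd[of "z + \<mu>" T] by (simp add: Phi_def phi_def theta_odd)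

lemma Phi_shift: "T \<noteq> 0 \<Longrightarrow> Phi T (z + T) \<mu> = Phi T z \<mu>"
proof -
  assume T: "T \<noteq> 0"
  have 1: "theta (z + T + \<mu>) T = exp (- 2 * pi * \<i> * \<mu>) * (- exp (- pi * \<i> * T - 2 * pi * \<i> * z)) * theta (z + \<mu>) T"
    using theta_quasi_periodic[of "z + \<mu>" T]
    by (simp add: exp_add[symmetric] algebra_simps)
  have 2: "exp (2 * pi * \<i> * (z + T) * \<mu> / T) = exp (2 * pi * \<i> * z * \<mu> / T) * exp (2 * pi * \<i> * \<mu>)"
    using T by (simp add: exp_add[symmetric] field_simps)
  have 3: "exp (2 * pi * \<i> * \<mu>) * exp (- 2 * pi * \<i> * \<mu>) = 1" by (simp add: exp_minus)
  define c where "c = - exp (- pi * \<i> * T - 2 * pi * \<i> * z)"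
  have c: "c \<noteq> 0" by (simp add: c_def)
  define q where "q = exp (2 * pi * \<i> * \<mu>)"
  define q' where "q' = exp (- 2 * pi * \<i> * \<mu>)"
  have q: "q * q' = 1" using 3 by (simp add: q_def q'_def)
  define k where "k = deriv (\<lambda>z. theta z T) 0"
  have "Phi T (z + T) \<mu> = exp (2 * pi * \<i> * z * \<mu> / T) * q * (k * (q' * c * theta (z + \<mu>) T) / (c * theta z T * theta \<mu> T))"
    unfolding Phi_def phi_def 1 2 theta_quasi_periodic k_def[symmetric] c_def[symmetric] q_def[symmetric] q'_def[symmetric] by simp
  also have "\<dots> = (q * q') * (exp (2 * pi * \<i> * z * \<mu> / T) * (k * theta (z + \<mu>) T / (theta z T * theta \<mu> T)))"
    using c by (simp add: divide_simps)
  finally show ?thesis by (simp add: q Phi_def phi_def k_def)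
qed

lemma int_periodic:
  fixes f :: "complex \<Rightarrow> 'a" and n :: int
  assumes "\<And>z. f (z + T) = f z"
  shows "f (z + of_int n * T) = f z"
proof (induction n rule: int_induct[where k = 0])
  case (step1 i)
  then show ?case using assms[of "z + of_int i * T"] by (simp add: algebra_simps)
next
  case (step2 i)
  then show ?case using assms[of "z + of_int (i - 1) * T"] by (simp add: algebra_simps)
qed simp

lemma Phi_periodic:
  assumes "T \<noteq> 0" shows "Phi T (z + of_int m * T) (\<mu> + of_int n * T) = Phi T z \<mu>"
proof -
  have "Phi T (z + of_int m * T) (\<mu> + of_int n * T) = Phi T z (\<mu> + of_int n * T)"
    by (rule int_periodic) (rule Phi_shift[OF assms])
  also have "\<dots> = Phi T (\<mu> + of_int n * T) z" by (rule Phi_sym)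
  also have "\<dots> = Phi T \<mu> z" by (rule int_periodic) (rule Phi_shift[OF assms])
  finally show ?thesis by (simp add: Phi_sym)
qed

text \<open>At such arguments no coefficient of the R-matrix has a pole.\<close>

definition theta_regular :: "complex \<Rightarrow> nat \<Rightarrow> complex \<Rightarrow> bool" where
  "theta_regular \<tau> d z \<longleftrightarrow> (\<forall>m::int. theta (z + of_int m * \<tau>) (of_nat d * \<tau>) \<noteq> 0)"

text \<open>By quasi-periodicity the residues modulo \<open>d\<close> suffice, so that this condition is open.\<close>

lemma theta_regular_finite:
  assumes "d > 0"
  shows "theta_regular \<tau> d z \<longleftrightarrow> (\<forall>m\<in>{0..<int d}. theta (z + of_int m * \<tau>) (of_nat d * \<tau>) \<noteq> 0)"
proof -
  have p: "(theta (w + of_int k * (of_nat d * \<tau>)) (of_nat d * \<tau>) = 0) = (theta w (of_nat d * \<tau>) = 0)" for w and k :: int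
    by (rule int_periodic[where f = "\<lambda>w. theta w (of_nat d * \<tau>) = 0"]) (simp add: theta_quasi_periodic)
  have "theta (z + of_int m * \<tau>) (of_nat d * \<tau>) = 0 \<longleftrightarrow> theta (z + of_int (m mod int d) * \<tau>) (of_nat d * \<tau>) = 0" for m
  proof -
    have "of_int m = (of_int (m div int d) * of_nat d + of_int (m mod int d) :: complex)"
      by (metis of_int_add of_int_mult of_int_of_nat_eq div_mult_mod_eq)
    then have "z + of_int m * \<tau> = (z + of_int (m mod int d) * \<tau>) + of_int (m div int d) * (of_nat d * \<tau>)"
      by (simp add: algebra_simps)
    then show ?thesis using p by metis
  qed
  moreover have "m mod int d \<in> {0..<int d}" for m using assms by simp
  ultimately show ?thesis unfolding theta_regular_def by blast
qed

context
  fixes \<tau> :: complex and d :: nat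
  assumes tau: "Im \<tau> > 0" and d: "d > 0"
begin

lemma period_nonzero: "of_nat d * \<tau> \<noteq> 0"
  using tau d by auto

lemma Im_period: "Im (of_nat d * \<tau>) > 0"
  using tau d by simp

text \<open>The differences \<open>\<gamma> - \<beta>\<close> and \<open>\<beta> - \<alpha>\<close> may be replaced by any representatives \<open>m\<close>, \<open>l\<close> modulo \<open>d\<close>. A good choice of
  representatives is what turns products of coefficients into instances of the Fay identity.\<close>

lemma R_coeff_eq_Phi:
  assumes "\<alpha> + \<gamma> = \<beta> + \<delta> + int d * r" "\<gamma> - \<beta> = m + int d * p" "\<beta> - \<alpha> = l + int d * q"
  shows "R_coeff \<tau> d \<alpha> \<beta> \<gamma> \<delta> z \<mu> =
    exp (- 2 * pi * \<i> * z * \<mu> / (of_nat d * \<tau>)) * Phi (of_nat d * \<tau>) (z + of_int m * \<tau>) (\<mu> + of_int l * \<tau>)"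
proof -
  define T where "T = of_nat d * \<tau>"
  have t0: "\<tau> \<noteq> 0" "of_nat d \<noteq> (0::complex)" using tau d by auto
  have T0: "T \<noteq> 0" using period_nonzero by (simp add: T_def)
  define M where "M = z + of_int (\<gamma> - \<beta>) * \<tau>"
  define L where "L = \<mu> + of_int (\<beta> - \<alpha>) * \<tau>"
  have "M = z + of_int m * \<tau> + of_int p * T" "L = \<mu> + of_int l * \<tau> + of_int q * T"
    unfolding M_def L_def assms(2,3) by (simp_all add: T_def algebra_simps)
  then have P: "Phi T M L = Phi T (z + of_int m * \<tau>) (\<mu> + of_int l * \<tau>)"
    using Phi_periodic[OF T0] by metis
  have c: "(\<alpha> + \<gamma>) mod int d = (\<beta> + \<delta>) mod int d" unfolding assms(1) by simp
  have e: "2 * pi * \<i> / of_nat d * (of_int ((\<gamma> - \<beta>) * (\<beta> - \<alpha>)) * \<tau> + of_int (\<gamma> - \<beta>) * \<mu> + of_int (\<beta> - \<alpha>) * z) =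
      - 2 * pi * \<i> * z * \<mu> / T + 2 * pi * \<i> * M * L / T"
    using t0 by (simp add: T_def M_def L_def field_simps)
  have "R_coeff \<tau> d \<alpha> \<beta> \<gamma> \<delta> z \<mu> = exp (2 * pi * \<i> / of_nat d * (of_int ((\<gamma> - \<beta>) * (\<beta> - \<alpha>)) * \<tau> +
      of_int (\<gamma> - \<beta>) * \<mu> + of_int (\<beta> - \<alpha>) * z)) * phi M L T"
    using c by (simp add: R_coeff_def M_def L_def T_def)
  also have "\<dots> = exp (- 2 * pi * \<i> * z * \<mu> / T) * Phi T M L"
    unfolding e exp_add Phi_def by (simp add: mult.assoc)
  finally show ?thesis using P by (simp add: T_def)
qed

lemma R_coeff_zero: "\<not> int d dvd (\<alpha> + \<gamma> - \<beta> - \<delta>) \<Longrightarrow> R_coeff \<tau> d \<alpha> \<beta> \<gamma> \<delta> z \<mu> = 0"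
  by (simp add: R_coeff_def mod_eq_dvd_iff diff_diff_eq)

lemma R_coeff_skew: "R_coeff \<tau> d \<gamma> \<delta> \<alpha> \<beta> (- z) (- \<mu>) = - R_coeff \<tau> d \<alpha> \<beta> \<gamma> \<delta> z \<mu>"
proof (cases "int d dvd (\<alpha> + \<gamma> - \<beta> - \<delta>)")
  case True
  then obtain r where r: "\<alpha> + \<gamma> - \<beta> - \<delta> = int d * r" by (auto elim: dvdE)
  have 1: "R_coeff \<tau> d \<alpha> \<beta> \<gamma> \<delta> z \<mu> = exp (- 2 * pi * \<i> * z * \<mu> / (of_nat d * \<tau>)) *
     Phi (of_nat d * \<tau>) (z + of_int (\<gamma> - \<beta>) * \<tau>) (\<mu> + of_int (\<beta> - \<alpha>) * \<tau>)"
    by (rule R_coeff_eq_Phi[where r = r and p = 0 and q = 0]) (use r in auto)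
  have 2: "R_coeff \<tau> d \<gamma> \<delta> \<alpha> \<beta> (- z) (- \<mu>) = exp (- 2 * pi * \<i> * (- z) * (- \<mu>) / (of_nat d * \<tau>)) *
     Phi (of_nat d * \<tau>) (- z + of_int (- (\<gamma> - \<beta>)) * \<tau>) (- \<mu> + of_int (- (\<beta> - \<alpha>)) * \<tau>)"
    by (rule R_coeff_eq_Phi[where r = r and p = r and q = "- r"]) (use r in auto)
  show ?thesis unfolding 1 2
    using Phi_odd[of "of_nat d * \<tau>" "z + of_int (\<gamma> - \<beta>) * \<tau>" "\<mu> + of_int (\<beta> - \<alpha>) * \<tau>"]
    by (simp add: algebra_simps)
next
  case False
  moreover have "\<gamma> + \<alpha> - \<delta> - \<beta> = \<alpha> + \<gamma> - \<beta> - \<delta>" by simp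
  ultimately have "\<not> int d dvd \<gamma> + \<alpha> - \<delta> - \<beta>" by metis
  with False show ?thesis by (simp add: R_coeff_zero)
qed

text \<open>The exponents agree: \<open>X A + (X + Y) B = (X + Y) (A + B) - Y A = Y B + X (A + B)\<close>.\<close>

lemma Phi_Fay:
  assumes "theta X T \<noteq> 0" "theta (X + Y) T \<noteq> 0" "theta Y T \<noteq> 0"
    "theta A T \<noteq> 0" "theta B T \<noteq> 0" "theta (A + B) T \<noteq> 0" and T: "T = of_nat d * \<tau>"
  shows "Phi T X A * Phi T (X + Y) B + Phi T (X + Y) (A + B) * Phi T Y (- A) = Phi T Y B * Phi T X (A + B)"
proof -
  have T0: "T \<noteq> 0" using T period_nonzero by simp
  have "phi X A T * phi (X + Y) B T = phi X (A + B) T * phi Y B T + phi (X + Y) (A + B) T * phi (- Y) A T"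
    using phi_Fay[of T X "X + Y" A B] assms Im_period by simp
  moreover have "phi (- Y) A T = - phi Y (- A) T"
    using theta_odd[of "Y - A" T] by (simp add: phi_def theta_odd)
  ultimately have F: "phi X A T * phi (X + Y) B T + phi (X + Y) (A + B) T * phi Y (- A) T = phi Y B T * phi X (A + B) T"
    by simp
  define E where "E = exp (2 * pi * \<i> * (X * A + (X + Y) * B) / T)"
  have e: "exp (2 * pi * \<i> * X * A / T) * exp (2 * pi * \<i> * (X + Y) * B / T) = E"
    "exp (2 * pi * \<i> * (X + Y) * (A + B) / T) * exp (2 * pi * \<i> * Y * (- A) / T) = E"
    "exp (2 * pi * \<i> * Y * B / T) * exp (2 * pi * \<i> * X * (A + B) / T) = E"
    unfolding E_def exp_add[symmetric] by (simp_all add: add_divide_distrib diff_divide_distrib ring_distribs mult_ac add_ac)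
  have "Phi T X A * Phi T (X + Y) B = E * (phi X A T * phi (X + Y) B T)"
    unfolding Phi_def e(1)[symmetric] by (simp only: mult_ac)
  moreover have "Phi T (X + Y) (A + B) * Phi T Y (- A) = E * (phi (X + Y) (A + B) T * phi Y (- A) T)"
    unfolding Phi_def e(2)[symmetric] by (simp only: mult_ac)
  moreover have "Phi T Y B * Phi T X (A + B) = E * (phi Y B T * phi X (A + B) T)"
    unfolding Phi_def e(3)[symmetric] by (simp only: mult_ac)
  ultimately show ?thesis using F by (simp add: distrib_left[symmetric])
qed

text \<open>One entry of the associative Yang--Baxter equation, for incoming indices \<open>si, sj, sk\<close> and outgoing \<open>ti, tj, tk\<close>;
  \<open>u\<close>, \<open>v\<close>, \<open>w\<close> are the intermediate indices that conservation forces. If the total index is conserved, the shifts are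
  compatible with addition of the arguments and the claim is \<open>Phi_Fay\<close>; otherwise every product contains a zero factor.\<close>

lemma R_coeff_AYBE:
  assumes ok: "theta_regular \<tau> d x" "theta_regular \<tau> d y" "theta_regular \<tau> d (x + y)"
    "theta_regular \<tau> d a" "theta_regular \<tau> d b" "theta_regular \<tau> d (a + b)"
  and u: "u = si + sj - tj + int d * k1" and v: "v = si + sk - ti + int d * k2" and w: "w = sj + sk - tk + int d * k3"
  shows "R_coeff \<tau> d si u sj tj x a * R_coeff \<tau> d u ti sk tk (x + y) b +
     R_coeff \<tau> d si ti sk v (x + y) (a + b) * R_coeff \<tau> d sj tj v tk y (- a) =
     R_coeff \<tau> d sj w sk tk y b * R_coeff \<tau> d si ti w tj x (a + b)"
proof (cases "int d dvd (si + sj + sk - ti - tj - tk)")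
  case True
  then obtain k0 where k0: "si + sj + sk - ti - tj - tk = int d * k0" by (auto elim: dvdE)
  then have k0': "tk = si + sj + sk - ti - tj - int d * k0" by simp
  define T where "T = of_nat d * \<tau>"
  define X where "X = x + of_int (tj - si) * \<tau>"
  define Y where "Y = y + of_int (tk - sj) * \<tau>"
  define A where "A = a + of_int (sj - tj) * \<tau>"
  define B where "B = b + of_int (sk - tk) * \<tau>"
  define e where "e = (\<lambda>z. exp (- 2 * pi * \<i> * z / T))"
  let ?mZ = "(tj - si) + (tk - sj)" and ?lC = "(sj - tj) + (sk - tk)"
  have Z: "x + y + of_int ?mZ * \<tau> = X + Y" and C: "a + b + of_int ?lC * \<tau> = A + B"
    and A': "- a + of_int (- (sj - tj)) * \<tau> = - A"
    by (simp_all add: X_def Y_def A_def B_def algebra_simps)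
  have r1: "R_coeff \<tau> d si u sj tj x a = e (x * a) * Phi T X A"
    unfolding X_def A_def e_def
    by (subst R_coeff_eq_Phi[where r = "- k1" and p = "- k1" and q = k1 and m = "tj - si" and l = "sj - tj"]) (use u in \<open>auto simp: T_def mult.assoc\<close>)
  have r2: "R_coeff \<tau> d u ti sk tk (x + y) b = e ((x + y) * b) * Phi T (X + Y) B"
    unfolding Z[symmetric] B_def e_def
    by (subst R_coeff_eq_Phi[where r = "k0 + k1" and p = "k0" and q = "- k0 - k1" and m = ?mZ and l = "sk - tk"])
      (use u k0 in \<open>auto simp: T_def mult.assoc algebra_simps\<close>)
  have r3: "R_coeff \<tau> d si ti sk v (x + y) (a + b) = e ((x + y) * (a + b)) * Phi T (X + Y) (A + B)"
    unfolding Z[symmetric] C[symmetric] e_def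
    by (subst R_coeff_eq_Phi[where r = "- k2" and p = "k0" and q = "- k0" and m = ?mZ and l = ?lC])
      (use v k0 in \<open>auto simp: T_def mult.assoc algebra_simps\<close>)
  have r4: "R_coeff \<tau> d sj tj v tk y (- a) = e (y * (- a)) * Phi T Y (- A)"
    unfolding A'[symmetric] Y_def e_def
    by (subst R_coeff_eq_Phi[where r = "k0 + k2" and p = "k0 + k2" and q = "0" and m = "tk - sj" and l = "- (sj - tj)"])
      (use v k0 in \<open>auto simp: T_def mult.assoc algebra_simps\<close>)
  have r5: "R_coeff \<tau> d sj w sk tk y b = e (y * b) * Phi T Y B"
    unfolding B_def Y_def e_def
    by (subst R_coeff_eq_Phi[where r = "- k3" and p = "- k3" and q = "k3" and m = "tk - sj" and l = "sk - tk"])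
      (use w in \<open>auto simp: T_def mult.assoc algebra_simps\<close>)
  have r6: "R_coeff \<tau> d si ti w tj x (a + b) = e (x * (a + b)) * Phi T X (A + B)"
    unfolding C[symmetric] X_def e_def
    by (subst R_coeff_eq_Phi[where r = "k0 + k3" and p = "k0 + k3" and q = "- k0" and m = "tj - si" and l = ?lC])
      (use w k0 in \<open>auto simp: T_def mult.assoc algebra_simps\<close>)
  define E where "E = e (x * a + (x + y) * b)"
  have e: "e p * e q = e (p + q)" for p q
    unfolding e_def exp_add[symmetric] by (simp add: diff_divide_distrib ring_distribs)
  have E: "e (x * a) * e ((x + y) * b) = E" "e ((x + y) * (a + b)) * e (y * (- a)) = E"
    "e (y * b) * e (x * (a + b)) = E"
    unfolding e E_def by (simp_all add: algebra_simps)
  have "Phi T X A * Phi T (X + Y) B + Phi T (X + Y) (A + B) * Phi T Y (- A) = Phi T Y B * Phi T X (A + B)"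
  proof (rule Phi_Fay[OF _ _ _ _ _ _ T_def])
    note nz = ok[unfolded theta_regular_def, folded T_def, rule_format]
    show "theta X T \<noteq> 0" unfolding X_def by (rule nz)
    show "theta Y T \<noteq> 0" unfolding Y_def by (rule nz)
    show "theta (X + Y) T \<noteq> 0" unfolding Z[symmetric] by (rule nz)
    show "theta A T \<noteq> 0" unfolding A_def by (rule nz)
    show "theta B T \<noteq> 0" unfolding B_def by (rule nz)
    show "theta (A + B) T \<noteq> 0" unfolding C[symmetric] by (rule nz)
  qed
  then have "E * (Phi T X A * Phi T (X + Y) B) + E * (Phi T (X + Y) (A + B) * Phi T Y (- A)) = E * (Phi T Y B * Phi T X (A + B))"
    by (simp add: distrib_left[symmetric])
  then have "(e (x * a) * e ((x + y) * b)) * (Phi T X A * Phi T (X + Y) B) +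
     (e ((x + y) * (a + b)) * e (y * (- a))) * (Phi T (X + Y) (A + B) * Phi T Y (- A)) =
     (e (y * b) * e (x * (a + b))) * (Phi T Y B * Phi T X (A + B))" by (simp only: E)
  then show ?thesis unfolding r1 r2 r3 r4 r5 r6 by (simp only: mult_ac)
next
  case False
  have "R_coeff \<tau> d u ti sk tk (x + y) b = 0"
  proof (rule R_coeff_zero)
    have "u + sk - ti - tk = (si + sj + sk - ti - tj - tk) + int d * k1" using u by simp
    then show "\<not> int d dvd (u + sk - ti - tk)" using False by (metis dvd_add_left_iff dvd_triv_left)
  qed
  moreover have "R_coeff \<tau> d sj tj v tk y (- a) = 0"
  proof (rule R_coeff_zero)
    have "sj + v - tj - tk = (si + sj + sk - ti - tj - tk) + int d * k2" using v by simp
    then show "\<not> int d dvd (sj + v - tj - tk)" using False by (metis dvd_add_left_iff dvd_triv_left)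
  qed
  moreover have "R_coeff \<tau> d si ti w tj x (a + b) = 0"
  proof (rule R_coeff_zero)
    have "si + w - ti - tj = (si + sj + sk - ti - tj - tk) + int d * k3" using w by simp
    then show "\<not> int d dvd (si + w - ti - tj)" using False by (metis dvd_add_left_iff dvd_triv_left)
  qed
  ultimately show ?thesis by simp
qed

end

section \<open>The R-matrix on tensor powers\<close>

lemma pos_bounds: "1 \<le> pos (a :: 'd::{finite,linorder})" "pos a \<le> int CARD('d)"
proof -
  have "card {..a} > 0" by (auto simp: card_gt_0_iff)
  then show "1 \<le> pos a" by (simp add: pos_def)
  show "pos a \<le> int CARD('d)" by (simp add: pos_def card_mono)
qed

lemma inj_pos: "inj (pos :: 'd::{finite,linorder} \<Rightarrow> int)"
proof -
  have "pos a < pos b" if "a < b" for a b :: 'd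
    using that by (auto simp: pos_def intro!: psubset_card_mono)
  then show ?thesis by (metis injI less_irrefl linorder_cases)
qed

lemma pos_cong_eq:
  fixes a b :: "'d::{finite,linorder}"
  assumes "int CARD('d) dvd pos a - pos b" shows "a = b"
proof -
  have "\<bar>pos a - pos b\<bar> < int CARD('d)" using pos_bounds[of a] pos_bounds[of b] by auto
  with assms have "pos a - pos b = 0" using dvd_imp_le_int[of "pos a - pos b" "int CARD('d)"] by linarith
  then have "pos a = pos b" by simp
  then show ?thesis by (rule injD[OF inj_pos])
qed

lemma pos_surj: "\<exists>v :: 'd::{finite,linorder}. \<exists>k. pos v = c + int CARD('d) * k"
proof -
  let ?f = "\<lambda>v :: 'd. pos v mod int CARD('d)"
  have "inj ?f" by (rule injI) (simp add: mod_eq_dvd_iff pos_cong_eq)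
  then have "card (range ?f) = card {0..<int CARD('d)}" by (simp add: card_image)
  moreover have "range ?f \<subseteq> {0..<int CARD('d)}" by auto
  ultimately have "range ?f = {0..<int CARD('d)}" by (intro card_subset_eq) auto
  moreover have "c mod int CARD('d) \<in> {0..<int CARD('d)}" by simp
  ultimately obtain v where "c mod int CARD('d) = ?f v" by blast
  then have "int CARD('d) dvd pos v - c" by (metis mod_eq_dvd_iff)
  then obtain k where "pos v - c = int CARD('d) * k" by (auto elim: dvdE)
  then show ?thesis by (intro exI[of _ v] exI[of _ k]) simp
qed

text \<open>\<open>R\<^sub>i\<^sub>j(z, \<mu>)\<close> at a fixed point, as a matrix in the basis of the tensor power.\<close>

definition R_mat :: "complex \<Rightarrow> 'n \<Rightarrow> 'n \<Rightarrow> complex \<Rightarrow> complex \<Rightarrow> ('n \<Rightarrow> 'd::{finite,linorder}) \<Rightarrow> ('n \<Rightarrow> 'd) \<Rightarrow> complex" where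
  "R_mat \<tau> i j z \<mu> s t = (if \<forall>k. k \<noteq> i \<and> k \<noteq> j \<longrightarrow> s k = t k
     then R_coeff \<tau> CARD('d) (pos (s i)) (pos (t i)) (pos (s j)) (pos (t j)) z \<mu> else 0)"

lemma sum_UNIV_single:
  fixes f :: "'a::finite \<Rightarrow> 'b::comm_monoid_add"
  shows "(\<And>u. u \<noteq> c \<Longrightarrow> f u = 0) \<Longrightarrow> sum f UNIV = f c"
  using sum.mono_neutral_right[of UNIV "{c}" f] by auto

lemma R_mat_skew:
  fixes s t :: "'n \<Rightarrow> 'd::{finite,linorder}"
  assumes "Im \<tau> > 0"
  shows "R_mat \<tau> j i (- z) (- \<mu>) s t = - R_mat \<tau> i j z \<mu> s t"
proof -
  have "0 < CARD('d)" by simp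
  then show ?thesis
    using R_coeff_skew[OF assms] by (auto simp: R_mat_def)
qed

lemma R_mat_conserves:
  fixes s t :: "'n \<Rightarrow> 'd::{finite,linorder}"
  assumes "R_mat \<tau> i j z \<mu> s t \<noteq> 0"
  shows "int CARD('d) dvd pos (s i) + pos (s j) - pos (t i) - pos (t j)" "\<And>k. k \<noteq> i \<Longrightarrow> k \<noteq> j \<Longrightarrow> s k = t k"
  using assms by (auto simp: R_mat_def R_coeff_def mod_eq_dvd_iff diff_diff_eq split: if_splits)

lemma R_mat_disjoint_commute:
  fixes s t :: "'n::finite \<Rightarrow> 'd::{finite,linorder}"
  assumes "i \<noteq> j" "i \<noteq> k" "i \<noteq> l" "j \<noteq> k" "j \<noteq> l" "k \<noteq> l"
  shows "(\<Sum>u\<in>UNIV. R_mat \<tau> i j z \<mu> s u * R_mat \<tau> k l z' \<mu>' u t) =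
     (\<Sum>u\<in>UNIV. R_mat \<tau> k l z' \<mu>' s u * R_mat \<tau> i j z \<mu> u t)"
proof -
  have 1: "(\<Sum>u\<in>UNIV. R_mat \<tau> i j z \<mu> s u * R_mat \<tau> k l z' \<mu>' u t) =
     R_mat \<tau> i j z \<mu> s (s(i := t i, j := t j)) * R_mat \<tau> k l z' \<mu>' (s(i := t i, j := t j)) t" 
    if "i \<noteq> j" "i \<noteq> k" "i \<noteq> l" "j \<noteq> k" "j \<noteq> l" "k \<noteq> l" for i j k l z \<mu> z' \<mu>'
  proof (rule sum_UNIV_single)
    fix u assume u: "u \<noteq> s(i := t i, j := t j)"
    show "R_mat \<tau> i j z \<mu> s u * R_mat \<tau> k l z' \<mu>' u t = 0"
    proof (rule ccontr)
      assume "\<not> ?thesis"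
      then have nz: "R_mat \<tau> i j z \<mu> s u \<noteq> 0" "R_mat \<tau> k l z' \<mu>' u t \<noteq> 0" by auto
      from that R_mat_conserves(2)[OF nz(1)] R_mat_conserves(2)[OF nz(2)]
      have "u = s(i := t i, j := t j)" by (auto simp: fun_eq_iff)
      with u show False by simp
    qed
  qed
  show ?thesis
    unfolding 1[OF assms] 1[OF assms(6) assms(2)[symmetric] assms(4)[symmetric] assms(3)[symmetric] assms(5)[symmetric] assms(1)]
    using assms by (auto simp: R_mat_def)
qed

text \<open>Away from the two sites on which they act, the factors force the intermediate state to equal \<open>s\<close> or \<open>t\<close>; conservation
  fixes the one remaining index. Hence every sum over intermediate states has at most one nonzero term.\<close>

lemma R_mat_AYBE:
  fixes s t :: "'n::finite \<Rightarrow> 'd::{finite,linorder}"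
  assumes tau: "Im \<tau> > 0" and ijk: "i \<noteq> j" "i \<noteq> k" "j \<noteq> k"
    and ok: "theta_regular \<tau> CARD('d) x" "theta_regular \<tau> CARD('d) y" "theta_regular \<tau> CARD('d) (x + y)"
    "theta_regular \<tau> CARD('d) a" "theta_regular \<tau> CARD('d) b" "theta_regular \<tau> CARD('d) (a + b)"
  shows "(\<Sum>u\<in>UNIV. R_mat \<tau> i j x a s u * R_mat \<tau> i k (x + y) b u t) +
     (\<Sum>u\<in>UNIV. R_mat \<tau> i k (x + y) (a + b) s u * R_mat \<tau> j k y (- a) u t) =
     (\<Sum>u\<in>UNIV. R_mat \<tau> j k y b s u * R_mat \<tau> i j x (a + b) u t)"
proof -
  let ?R = "R_coeff \<tau> CARD('d)"
  obtain u k1 where u: "pos (u::'d) = pos (s i) + pos (s j) - pos (t j) + int CARD('d) * k1"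
    using pos_surj by blast
  obtain v k2 where v: "pos (v::'d) = pos (s i) + pos (s k) - pos (t i) + int CARD('d) * k2"
    using pos_surj by blast
  obtain w k3 where w: "pos (w::'d) = pos (s j) + pos (s k) - pos (t k) + int CARD('d) * k3"
    using pos_surj by blast
  have only: "y = x" if "pos (x::'d) = c + int CARD('d) * k" "int CARD('d) dvd c - pos (y::'d)" for x y c k
  proof -
    have "int CARD('d) dvd pos x - pos y"
    proof -
      have "pos x - pos y = (c - pos y) + int CARD('d) * k" using that(1) by simp
      then show ?thesis using that(2) by (metis dvd_add dvd_triv_left)
    qed
    then show ?thesis using pos_cong_eq by blast
  qed
  let ?e = "\<forall>m. m \<noteq> i \<and> m \<noteq> j \<and> m \<noteq> k \<longrightarrow> s m = t m"
  have 1: "(\<Sum>u\<in>UNIV. R_mat \<tau> i j x a s u * R_mat \<tau> i k (x + y) b u t) =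
    (if ?e then ?R (pos (s i)) (pos u) (pos (s j)) (pos (t j)) x a * ?R (pos u) (pos (t i)) (pos (s k)) (pos (t k)) (x + y) b else 0)"
  proof (subst sum_UNIV_single[where c = "s(i := u, j := t j)"])
    fix u' assume u': "u' \<noteq> s(i := u, j := t j)"
    show "R_mat \<tau> i j x a s u' * R_mat \<tau> i k (x + y) b u' t = 0"
    proof (rule ccontr)
      assume "\<not> ?thesis"
      then have nz: "R_mat \<tau> i j x a s u' \<noteq> 0" "R_mat \<tau> i k (x + y) b u' t \<noteq> 0" by auto
      from R_mat_conserves(2)[OF nz(1)] R_mat_conserves(2)[OF nz(2)] ijk
      have *: "u' j = t j" "\<And>m. m \<noteq> i \<Longrightarrow> m \<noteq> j \<Longrightarrow> u' m = s m" by auto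
      have "u' i = u" by (rule only[OF u]) (use R_mat_conserves(1)[OF nz(1)] * in \<open>simp add: algebra_simps\<close>)
      with * have "u' x = (s(i := u, j := t j)) x" for x by (simp add: fun_upd_def)
      with u' show False by (simp add: fun_eq_iff)
    qed
  qed (use ijk in \<open>auto simp: R_mat_def\<close>)
  have 2: "(\<Sum>u\<in>UNIV. R_mat \<tau> i k (x + y) (a + b) s u * R_mat \<tau> j k y (- a) u t) =
    (if ?e then ?R (pos (s i)) (pos (t i)) (pos (s k)) (pos v) (x + y) (a + b) * ?R (pos (s j)) (pos (t j)) (pos v) (pos (t k)) y (- a) else 0)"
  proof (subst sum_UNIV_single[where c = "s(i := t i, k := v)"])
    fix u' assume u': "u' \<noteq> s(i := t i, k := v)"
    show "R_mat \<tau> i k (x + y) (a + b) s u' * R_mat \<tau> j k y (- a) u' t = 0"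
    proof (rule ccontr)
      assume "\<not> ?thesis"
      then have nz: "R_mat \<tau> i k (x + y) (a + b) s u' \<noteq> 0" "R_mat \<tau> j k y (- a) u' t \<noteq> 0" by auto
      from R_mat_conserves(2)[OF nz(1)] R_mat_conserves(2)[OF nz(2)] ijk
      have *: "u' i = t i" "\<And>m. m \<noteq> i \<Longrightarrow> m \<noteq> k \<Longrightarrow> u' m = s m" by auto
      have "u' k = v" by (rule only[OF v]) (use R_mat_conserves(1)[OF nz(1)] * in \<open>simp add: algebra_simps\<close>)
      with * have "u' x = (s(i := t i, k := v)) x" for x by (simp add: fun_upd_def)
      with u' show False by (simp add: fun_eq_iff)
    qed
  qed (use ijk in \<open>auto simp: R_mat_def\<close>)
  have 3: "(\<Sum>u\<in>UNIV. R_mat \<tau> j k y b s u * R_mat \<tau> i j x (a + b) u t) =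
    (if ?e then ?R (pos (s j)) (pos w) (pos (s k)) (pos (t k)) y b * ?R (pos (s i)) (pos (t i)) (pos w) (pos (t j)) x (a + b) else 0)"
  proof (subst sum_UNIV_single[where c = "s(j := w, k := t k)"])
    fix u' assume u': "u' \<noteq> s(j := w, k := t k)"
    show "R_mat \<tau> j k y b s u' * R_mat \<tau> i j x (a + b) u' t = 0"
    proof (rule ccontr)
      assume "\<not> ?thesis"
      then have nz: "R_mat \<tau> j k y b s u' \<noteq> 0" "R_mat \<tau> i j x (a + b) u' t \<noteq> 0" by auto
      from R_mat_conserves(2)[OF nz(1)] R_mat_conserves(2)[OF nz(2)] ijk
      have *: "u' k = t k" "\<And>m. m \<noteq> j \<Longrightarrow> m \<noteq> k \<Longrightarrow> u' m = s m" by auto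
      have "u' j = w" by (rule only[OF w]) (use R_mat_conserves(1)[OF nz(1)] * in \<open>simp add: algebra_simps\<close>)
      with * have "u' x = (s(j := w, k := t k)) x" for x by (simp add: fun_upd_def)
      with u' show False by (simp add: fun_eq_iff)
    qed
  qed (use ijk in \<open>auto simp: R_mat_def\<close>)
  have d: "CARD('d) > 0" by simp
  have "(if e then A else 0) + (if e then B else 0) = (if e then C else 0)" if "A + B = C" for e and A B C :: complex
    using that by simp
  then show ?thesis unfolding 1 2 3 using R_coeff_AYBE[OF tau d ok u v w] .
qed


section \<open>Meromorphic functions of coordinate differences\<close>

lemma abs_mero_eqI:
  assumes "meromorphic_fun f" "meromorphic_fun g" "open D" "closure D = UNIV" "\<And>x. x \<in> D \<Longrightarrow> f x = g x"
  shows "abs_mero f = abs_mero g"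
  by (rule Quotient_rel_abs[OF Quotient_mero]) (use assms in \<open>auto simp: mero_eq_def\<close>)

lemma abs_mero_add: "meromorphic_fun f \<Longrightarrow> meromorphic_fun g \<Longrightarrow> abs_mero f + abs_mero g = abs_mero (\<lambda>x. f x + g x)"
  by (rule plus_mero.abs_eq) (auto intro: mero_eq_refl)

lemma abs_mero_mult: "meromorphic_fun f \<Longrightarrow> meromorphic_fun g \<Longrightarrow> abs_mero f * abs_mero g = abs_mero (\<lambda>x. f x * g x)"
  by (rule times_mero.abs_eq) (auto intro: mero_eq_refl)

lemma abs_mero_uminus: "meromorphic_fun f \<Longrightarrow> - abs_mero f = abs_mero (\<lambda>x. - f x)"
  by (rule uminus_mero.abs_eq) (auto intro: mero_eq_refl)

lemma abs_mero_zero: "abs_mero (\<lambda>_. 0) = 0"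
  by (simp add: zero_mero_def)

lemma meromorphic_sum: "(\<And>i. i \<in> A \<Longrightarrow> meromorphic_fun (F i)) \<Longrightarrow> meromorphic_fun (\<lambda>x. \<Sum>i\<in>A. F i x)"
  by (induction A rule: infinite_finite_induct) (auto intro: meromorphic_const meromorphic_add)

lemma abs_mero_sum:
  "(\<And>i. i \<in> A \<Longrightarrow> meromorphic_fun (F i)) \<Longrightarrow> (\<Sum>i\<in>A. abs_mero (F i)) = abs_mero (\<lambda>x. \<Sum>i\<in>A. F i x)"
  by (induction A rule: infinite_finite_induct) (simp_all add: abs_mero_zero abs_mero_add meromorphic_sum)

lemma mholo_comp:
  assumes f: "f mholo_on S" and h: "h holomorphic_on UNIV"
  shows "(\<lambda>z. h (f z)) mholo_on S"
proof (rule mholo_onI)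
  show "open S" by (rule mholo_open[OF f])
  show "continuous_on S (\<lambda>z. h (f z))"
    by (rule continuous_on_compose2[OF holomorphic_on_imp_continuous_on[OF h] mholo_cont[OF f]]) auto
  fix z i assume z: "z \<in> S"
  have "(h has_field_derivative deriv h (f (upd z i (z $ i)))) (at (f (upd z i (z $ i))))"
    using h by (rule holomorphic_derivI) auto
  from DERIV_chain2[OF this mholo_onD'[OF f z, of i]]
  show "((\<lambda>t. h (f (upd z i t))) has_field_derivative deriv h (f z) * pd i f z) (at (z $ i))" by simp
qed

lemma mholo_coord:
  fixes S :: "(complex^'k) set"
  shows "open S \<Longrightarrow> (\<lambda>z. z $ i) mholo_on S"
proof (rule mholo_onI)
  fix z :: "complex^'k" and k
  show "((\<lambda>t. upd z k t $ i) has_field_derivative (if i = k then 1 else 0)) (at (z $ k))"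
    by (cases "i = k") auto
qed (auto intro!: continuous_intros)

lemma mholo_diff: "f mholo_on S \<Longrightarrow> g mholo_on S \<Longrightarrow> (\<lambda>z. f z - g z) mholo_on S"
  using mholo_add[of f S, OF _ mholo_uminus[of g S]] by simp

lemma dense_nonzero:
  fixes h :: "complex \<Rightarrow> complex" and i j :: "'n::finite"
  assumes h: "h holomorphic_on UNIV" "h c \<noteq> 0" and ij: "i \<noteq> j"
  shows "closure {x :: complex^'n. h (x $ i - x $ j) \<noteq> 0} = UNIV"
proof -
  have "x \<in> closure {x :: complex^'n. h (x $ i - x $ j) \<noteq> 0}" for x
    unfolding closure_approachable
  proof (intro allI impI)
    fix e :: real assume e: "e > 0"
    let ?g = "\<lambda>t. h (t - x $ j)"
    have "(h \<circ> (\<lambda>t. t - x $ j)) holomorphic_on UNIV"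
      by (intro holomorphic_on_compose holomorphic_intros holomorphic_on_subset[OF h(1)]) auto
    then have "?g holomorphic_on UNIV" by (simp add: o_def)
    from non_zero_neighbour_alt[OF this, of "x $ i" "c + x $ j"] h(2)
    have "\<forall>\<^sub>F t in at (x $ i). ?g t \<noteq> 0" by (simp add: connected_UNIV)
    moreover have "\<forall>\<^sub>F t in at (x $ i). dist t (x $ i) < e"
      using e by (auto simp: eventually_at)
    ultimately have "\<forall>\<^sub>F t in at (x $ i). ?g t \<noteq> 0 \<and> dist t (x $ i) < e" by (rule eventually_conj)
    then obtain t where "?g t \<noteq> 0" "dist t (x $ i) < e"
      using eventually_happens[of _ "at (x $ i)"] by auto
    then show "\<exists>y\<in>{x. h (x $ i - x $ j) \<noteq> 0}. dist y x < e"
      using ij dist_upd[of x i t]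
      by (intro bexI[of _ "upd x i t"]) (auto simp: dist_commute dist_norm[of t])
  qed
  then show ?thesis by auto
qed

lemma meromorphic_quotient:
  fixes h :: "complex \<Rightarrow> complex" and i j :: "'n::finite"
  assumes h: "h holomorphic_on UNIV" "h c \<noteq> 0" and ij: "i \<noteq> j" and f: "f holomorphic_on UNIV"
  shows "meromorphic_fun (\<lambda>x :: complex^'n. f (x $ i - x $ j) / h (x $ i - x $ j))"
proof -
  have "(\<lambda>x :: complex^'n. f (x $ i - x $ j)) mholo_on UNIV" "(\<lambda>x :: complex^'n. h (x $ i - x $ j)) mholo_on UNIV"
    by (intro mholo_comp[OF _ f] mholo_comp[OF _ h(1)] mholo_diff mholo_coord; simp)+
  then show ?thesis
    unfolding meromorphic_fun_def using dense_nonzero[OF assms(1-3)]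
    by (intro allI exI[of _ UNIV] exI[of _ "\<lambda>x. f (x $ i - x $ j)"] exI[of _ "\<lambda>x. h (x $ i - x $ j)"]) simp
qed

lemma theta_shift_holomorphic:
  assumes "Im T > 0" shows "(\<lambda>z. theta (z + c) T) holomorphic_on UNIV"
proof -
  have "((\<lambda>z. theta z T) \<circ> (\<lambda>z. z + c)) holomorphic_on UNIV"
    by (intro holomorphic_on_compose holomorphic_intros theta_holomorphic assms)
  then show ?thesis by (simp add: o_def)
qed

lemma theta_shift_nonzero:
  assumes "Im T > 0" shows "\<exists>z. theta (z + c) T \<noteq> 0"
  using theta_not_identically_zero[OF assms] by (metis diff_add_cancel)

lemma R_coeff_meromorphic:
  fixes i j :: "'n::finite"
  assumes tau: "Im \<tau> > 0" and d: "d > 0" and ij: "i \<noteq> j"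
  shows "meromorphic_fun (\<lambda>x :: complex^'n. R_coeff \<tau> d \<alpha> \<beta> \<gamma> \<delta> (x $ i - x $ j) \<mu>)"
proof (cases "(\<alpha> + \<gamma>) mod int d = (\<beta> + \<delta>) mod int d")
  case True
  define T where "T = of_nat d * \<tau>"
  have T: "Im T > 0" using tau d by (simp add: T_def)
  define m where "m = of_int (\<gamma> - \<beta>) * \<tau>"
  define \<mu>' where "\<mu>' = \<mu> + of_int (\<beta> - \<alpha>) * \<tau>"
  define f where "f = (\<lambda>z. exp (2 * pi * \<i> / of_nat d * (of_int ((\<gamma> - \<beta>) * (\<beta> - \<alpha>)) * \<tau> + of_int (\<gamma> - \<beta>) * \<mu> + of_int (\<beta> - \<alpha>) * z)) *
    (deriv (\<lambda>z. theta z T) 0 * theta (z + (m + \<mu>')) T / theta \<mu>' T))"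
  obtain c where c: "theta (c + m) T \<noteq> 0" using theta_shift_nonzero[OF T] by blast
  have "f holomorphic_on UNIV"
    unfolding f_def divide_inverse by (intro holomorphic_intros theta_shift_holomorphic[OF T])
  from meromorphic_quotient[OF theta_shift_holomorphic[OF T] c ij this]
  have "meromorphic_fun (\<lambda>x :: complex^'n. f (x $ i - x $ j) / theta (x $ i - x $ j + m) T)" .
  moreover have "f z / theta (z + m) T = R_coeff \<tau> d \<alpha> \<beta> \<gamma> \<delta> z \<mu>" for z
    unfolding R_coeff_def phi_def if_P[OF True] f_def T_def m_def \<mu>'_def by (simp add: add.assoc mult_ac)
  ultimately show ?thesis by simp
next
  case False
  then show ?thesis by (simp add: R_coeff_def meromorphic_const)
qed

text \<open>Invariance under simultaneous translation of \<open>x\<^sub>i\<close> and \<open>x\<^sub>j\<close>.\<close>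

lemma mero_deriv_difference:
  fixes i j :: "'n::finite"
  assumes h: "meromorphic_fun (\<lambda>x :: complex^'n. h (x $ i - x $ j))" and ij: "i \<noteq> j"
  shows "mero_deriv i (abs_mero (\<lambda>x. h (x $ i - x $ j))) = - mero_deriv j (abs_mero (\<lambda>x. h (x $ i - x $ j)))"
    and "k \<noteq> i \<Longrightarrow> k \<noteq> j \<Longrightarrow> mero_deriv k (abs_mero (\<lambda>x. h (x $ i - x $ j))) = 0"
proof -
  let ?f = "\<lambda>x :: complex^'n. h (x $ i - x $ j)"
  have a: "mero_deriv k (abs_mero ?f) = abs_mero (pd k ?f)" for k
    by (rule mero_deriv.abs_eq) (rule mero_eq_refl[OF h])
  have "mero_eq (pd i ?f) (\<lambda>x. - pd j ?f x)"
  proof (rule mero_local_eqI[OF h h])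
    fix S x assume S: "?f mholo_on S" and x: "x \<in> S"
    have "((\<lambda>t. h (t - x $ j)) has_field_derivative pd i ?f x) (at (x $ i))"
      using mholo_onD'[OF S x, of i] ij by simp
    then have "(h has_field_derivative pd i ?f x) (at (x $ i - x $ j))"
      using DERIV_shift[of h "pd i ?f x" "x $ i" "- x $ j"] by simp
    then have "((\<lambda>t. h (x $ i - t)) has_field_derivative pd i ?f x * (0 - 1)) (at (x $ j))"
      by (rule DERIV_chain2) (auto intro!: derivative_eq_intros)
    moreover have "((\<lambda>t. ?f (upd x j t)) has_field_derivative pd j ?f x) (at (x $ j))"
      by (rule mholo_onD'[OF S x])
    ultimately show "pd i ?f x = - pd j ?f x"
      using ij DERIV_unique by fastforce
  qed (auto intro: meromorphic_pd meromorphic_uminus h)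
  then show "mero_deriv i (abs_mero ?f) = - mero_deriv j (abs_mero ?f)"
    unfolding a abs_mero_uminus[OF meromorphic_pd[OF h]] by (rule Quotient_rel_abs[OF Quotient_mero])
  assume "k \<noteq> i" "k \<noteq> j"
  then have "pd k ?f = (\<lambda>_. 0)" by (simp add: pd_def fun_eq_iff)
  then show "mero_deriv k (abs_mero ?f) = 0" unfolding a by (simp add: abs_mero_zero)
qed

section \<open>Matrices of meromorphic functions\<close>

lemma quantum_eqI: "symbol a = symbol b \<Longrightarrow> a = b"
  by (simp add: symbol_inject)

lemma symbol_coeff_q: "symbol (coeff_q f) = pm_single 0 f"
  by (simp add: coeff_q_def Quantum_inverse)

lemma fun_q_add: "fun_q (f + g) = fun_q f + fun_q g"
  by (rule quantum_eqI) (simp add: fun_q_def symbol_coeff_q plus_quantum.rep_eq single_add[symmetric])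

lemma fun_q_zero: "fun_q 0 = 0"
  using fun_q_add[of 0 0] by simp

lemma fun_q_uminus: "fun_q (- f) = - fun_q f"
  using fun_q_add[of f "- f"] by (simp add: fun_q_zero minus_unique)

lemma fun_q_sum: "fun_q (sum f A) = (\<Sum>x\<in>A. fun_q (f x))"
  by (induction A rule: infinite_finite_induct) (simp_all add: fun_q_zero fun_q_add)

lemma coeff_q_mult: "coeff_q f * coeff_q g = coeff_q (f * g)"
  by (rule quantum_eqI) (simp add: symbol_coeff_q times_quantum.rep_eq hbar.mult_single' hbar.monom_zero mult_single)

lemma fun_q_mult: "fun_q f * fun_q g = fun_q (f * g)"
  by (simp add: fun_q_def coeff_q_mult)

text \<open>The passage from pointwise matrices to operators. On matrices with meromorphic entries it is a ring homomorphism, and it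
  sees its argument on a dense open set only, so identities between R-matrices can be checked at points without poles.\<close>

definition mero_mat :: "(complex^('n::{finite,linorder}) \<Rightarrow> ('n \<Rightarrow> 'd) \<Rightarrow> ('n \<Rightarrow> 'd) \<Rightarrow> complex) \<Rightarrow> ('n, 'd::finite) qEnd" where
  "mero_mat F = Sqmat (\<lambda>s t. fun_q (abs_mero (\<lambda>x. F x s t)))"

definition mero_entries :: "(complex^('n::finite) \<Rightarrow> ('n \<Rightarrow> 'd) \<Rightarrow> ('n \<Rightarrow> 'd) \<Rightarrow> complex) \<Rightarrow> bool" where
  "mero_entries F \<longleftrightarrow> (\<forall>s t. meromorphic_fun (\<lambda>x. F x s t))"

lemma mero_mat_add:
  "mero_entries F \<Longrightarrow> mero_entries G \<Longrightarrow> mero_mat F + mero_mat G = mero_mat (\<lambda>x s t. F x s t + G x s t)"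
  by (rule sqmat_eqI) (simp add: mero_mat_def mero_entries_def plus_sqmat.rep_eq fun_q_add[symmetric] abs_mero_add)

lemma mero_mat_uminus: "mero_entries F \<Longrightarrow> - mero_mat F = mero_mat (\<lambda>x s t. - F x s t)"
  by (rule sqmat_eqI) (simp add: mero_mat_def mero_entries_def uminus_sqmat.rep_eq fun_q_uminus[symmetric] abs_mero_uminus)

lemma mero_mat_mult:
  "mero_entries F \<Longrightarrow> mero_entries G \<Longrightarrow> mero_mat F * mero_mat G = mero_mat (\<lambda>x s t. \<Sum>u\<in>UNIV. F x s u * G x u t)"
  by (rule sqmat_eqI) (simp add: mero_mat_def mero_entries_def times_sqmat.rep_eq fun_q_mult abs_mero_mult
      abs_mero_sum meromorphic_mult fun_q_sum[symmetric])

lemma mero_entries_add: "mero_entries F \<Longrightarrow> mero_entries G \<Longrightarrow> mero_entries (\<lambda>x s t. F x s t + G x s t)"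
  by (simp add: mero_entries_def meromorphic_add)

lemma mero_entries_mult:
  fixes F G :: "complex^('n::finite) \<Rightarrow> ('n \<Rightarrow> 'd::finite) \<Rightarrow> ('n \<Rightarrow> 'd) \<Rightarrow> complex"
  shows "mero_entries F \<Longrightarrow> mero_entries G \<Longrightarrow> mero_entries (\<lambda>x s t. \<Sum>u\<in>UNIV. F x s u * G x u t)"
  by (simp add: mero_entries_def meromorphic_mult meromorphic_sum)

lemma mero_mat_eqI:
  assumes "mero_entries F" "mero_entries G" "open D" "closure D = UNIV" "\<And>x s t. x \<in> D \<Longrightarrow> F x s t = G x s t"
  shows "mero_mat F = mero_mat G"
  by (rule sqmat_eqI) (use assms in \<open>auto simp: mero_mat_def mero_entries_def intro!: arg_cong[of _ _ fun_q] abs_mero_eqI[where D = D]\<close>)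

definition R_fun :: "complex \<Rightarrow> 'n \<Rightarrow> 'n \<Rightarrow> complex \<Rightarrow> complex^('n::finite) \<Rightarrow> ('n \<Rightarrow> 'd::{finite,linorder}) \<Rightarrow> ('n \<Rightarrow> 'd) \<Rightarrow> complex" where
  "R_fun \<tau> i j \<mu> x = R_mat \<tau> i j (x $ i - x $ j) \<mu>"

lemma fun_q_if: "fun_q (abs_mero (\<lambda>x. if C then f x else 0)) = (if C then fun_q (abs_mero f) else 0)"
  by (cases C) (simp_all add: abs_mero_zero fun_q_zero)

lemma meromorphic_if: "(C \<Longrightarrow> meromorphic_fun f) \<Longrightarrow> meromorphic_fun (\<lambda>x. if C then f x else 0)"
  by (cases C) (simp_all add: meromorphic_const)

lemma R_op_eq_mero_mat: "R_op \<tau> i j \<mu> = mero_mat (R_fun \<tau> i j \<mu>)"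
  by (rule sqmat_eqI) (simp add: R_op_def mero_mat_def R_fun_def R_mat_def fun_q_if)

lemma R_fun_mero:
  fixes i j :: "'n::finite"
  assumes "Im \<tau> > 0" "i \<noteq> j"
  shows "mero_entries (R_fun \<tau> i j \<mu> :: _ \<Rightarrow> ('n \<Rightarrow> 'd::{finite,linorder}) \<Rightarrow> _)"
  unfolding mero_entries_def R_fun_def R_mat_def
  by (intro allI meromorphic_if R_coeff_meromorphic[OF assms(1) _ assms(2)]) simp

lemma finite_INT_open_dense:
  fixes F :: "'i \<Rightarrow> 'a::topological_space set"
  assumes "finite I" "\<And>i. i \<in> I \<Longrightarrow> open (F i) \<and> closure (F i) = UNIV"
  shows "open (\<Inter>i\<in>I. F i) \<and> closure (\<Inter>i\<in>I. F i) = UNIV"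
  using assms
proof (induction I)
  case (insert i I)
  then show ?case using dense_Int[of "F i" "\<Inter>i\<in>I. F i"] by auto
qed auto

definition theta_regular_set :: "complex \<Rightarrow> nat \<Rightarrow> (complex^'n) set" where
  "theta_regular_set \<tau> d = {x. \<forall>i j. i \<noteq> j \<longrightarrow> theta_regular \<tau> d (x $ i - x $ j)}"

lemma theta_regular_set_open_dense:
  assumes tau: "Im \<tau> > 0" and d: "d > 0"
  shows "open (theta_regular_set \<tau> d :: (complex^'n::finite) set) \<and> closure (theta_regular_set \<tau> d :: (complex^'n) set) = UNIV"
proof -
  let ?I = "{(i, j, m). i \<noteq> (j::'n) \<and> m \<in> {0..<int d}}"
  let ?F = "\<lambda>(i, j, m). {x :: complex^'n. theta (x $ i - x $ j + of_int m * \<tau>) (of_nat d * \<tau>) \<noteq> 0}"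
  have T: "Im (of_nat d * \<tau>) > 0" using tau d by simp
  have e: "theta_regular_set \<tau> d = (\<Inter>p\<in>?I. ?F p)"
    unfolding theta_regular_set_def theta_regular_finite[OF d] by fastforce
  have "finite ?I"
    by (rule finite_subset[of _ "UNIV \<times> UNIV \<times> {0..<int d}"]) auto
  moreover have "open (?F p) \<and> closure (?F p) = UNIV" if p: "p \<in> ?I" for p
  proof -
    obtain i j m where ijm: "p = (i, j, m)" "i \<noteq> j" using p by auto
    let ?h = "\<lambda>z. theta (z + of_int m * \<tau>) (of_nat d * \<tau>)"
    have h: "?h holomorphic_on UNIV" by (rule theta_shift_holomorphic[OF T])
    have "(\<lambda>x :: complex^'n. ?h (x $ i - x $ j)) mholo_on UNIV"
      by (intro mholo_comp[OF _ h] mholo_diff mholo_coord) auto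
    from mholo_nonzero_open[OF this] have "open (?F p)" by (simp add: ijm)
    moreover obtain c where "?h c \<noteq> 0" using theta_shift_nonzero[OF T] by blast
    from dense_nonzero[OF h this ijm(2)] have "closure (?F p) = UNIV" by (simp add: ijm)
    ultimately show ?thesis by blast
  qed
  ultimately show ?thesis unfolding e by (rule finite_INT_open_dense)
qed

section \<open>Identities of the R-matrix operators\<close>

lemma R_op_skew:
  fixes i j :: "'n::{finite,linorder}"
  assumes tau: "Im \<tau> > 0" and ij: "i \<noteq> j"
  shows "(R_op \<tau> j i (- \<mu>) :: ('n, 'd::{finite,linorder}) qEnd) = - R_op \<tau> i j \<mu>"
proof -
  have "R_fun \<tau> j i (- \<mu>) x s t = - R_fun \<tau> i j \<mu> x s (t :: 'n \<Rightarrow> 'd)" for x s t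
    using R_mat_skew[OF tau, of j i "x $ i - x $ j" \<mu> s t] by (simp add: R_fun_def)
  then have "R_fun \<tau> j i (- \<mu>) = (\<lambda>x s t. - R_fun \<tau> i j \<mu> x s (t :: 'n \<Rightarrow> 'd))"
    by (simp add: fun_eq_iff)
  then show ?thesis
    unfolding R_op_eq_mero_mat mero_mat_uminus[OF R_fun_mero[OF tau ij]] by simp
qed

lemma R_op_disjoint_commute:
  fixes i j k l :: "'n::{finite,linorder}"
  assumes tau: "Im \<tau> > 0" and ne: "i \<noteq> j" "i \<noteq> k" "i \<noteq> l" "j \<noteq> k" "j \<noteq> l" "k \<noteq> l"
  shows "R_op \<tau> i j \<mu> * (R_op \<tau> k l \<nu> :: ('n, 'd::{finite,linorder}) qEnd) = R_op \<tau> k l \<nu> * R_op \<tau> i j \<mu>"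
  unfolding R_op_eq_mero_mat mero_mat_mult[OF R_fun_mero[OF tau ne(1)] R_fun_mero[OF tau ne(6)]]
    mero_mat_mult[OF R_fun_mero[OF tau ne(6)] R_fun_mero[OF tau ne(1)]]
  unfolding R_fun_def R_mat_disjoint_commute[OF ne] ..

text \<open>The three differences of coordinates add up, as the pointwise equation requires:
  \<open>(x\<^sub>i - x\<^sub>j) + (x\<^sub>j - x\<^sub>k) = x\<^sub>i - x\<^sub>k\<close>.\<close>

lemma R_op_AYBE:
  fixes i j k :: "'n::{finite,linorder}"
  assumes tau: "Im \<tau> > 0" and ijk: "i \<noteq> j" "i \<noteq> k" "j \<noteq> k"
    and ok: "theta_regular \<tau> CARD('d::{finite,linorder}) a" "theta_regular \<tau> CARD('d) b" "theta_regular \<tau> CARD('d) (a + b)"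
  shows "R_op \<tau> i j a * R_op \<tau> i k b + R_op \<tau> i k (a + b) * R_op \<tau> j k (- a) =
     R_op \<tau> j k b * (R_op \<tau> i j (a + b) :: ('n, 'd) qEnd)"
proof -
  have d: "CARD('d) > 0" by simp
  note M = R_fun_mero[OF tau ijk(1)] R_fun_mero[OF tau ijk(2)] R_fun_mero[OF tau ijk(3)]
  note D = theta_regular_set_open_dense[OF tau d, where 'n = 'n]
  show ?thesis
    unfolding R_op_eq_mero_mat mero_mat_mult[OF M(1,2)] mero_mat_mult[OF M(2,3)] mero_mat_mult[OF M(3,1)]
      mero_mat_add[OF mero_entries_mult[OF M(1,2)] mero_entries_mult[OF M(2,3)]]
  proof (rule mero_mat_eqI[OF mero_entries_add[OF mero_entries_mult[OF M(1,2)] mero_entries_mult[OF M(2,3)]]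
      mero_entries_mult[OF M(3,1)] D[THEN conjunct1] D[THEN conjunct2]])
    fix x :: "(complex, 'n) vec" and s t :: "'n \<Rightarrow> 'd" assume "x \<in> theta_regular_set \<tau> CARD('d)"
    then have ok': "theta_regular \<tau> CARD('d) (x $ i - x $ j)" "theta_regular \<tau> CARD('d) (x $ j - x $ k)"
       "theta_regular \<tau> CARD('d) ((x $ i - x $ j) + (x $ j - x $ k))"
      using ijk by (auto simp: theta_regular_set_def)
    have e: "(x $ i - x $ j) + (x $ j - x $ k) = x $ i - x $ k" by simp
    from R_mat_AYBE[OF tau ijk ok' ok, of s t, unfolded e]
    show "(\<Sum>u\<in>UNIV. R_fun \<tau> i j a x s u * R_fun \<tau> i k b x u t) +
       (\<Sum>u\<in>UNIV. R_fun \<tau> i k (a + b) x s u * R_fun \<tau> j k (- a) x u t) =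
       (\<Sum>u\<in>UNIV. R_fun \<tau> j k b x s u * R_fun \<tau> i j (a + b) x u t)"
      by (simp add: R_fun_def)
  qed
qed

lemma perm_q_coeff_q: "perm_q w (coeff_q f) = coeff_q (coeff_perm w f)"
  by (rule quantum_eqI) (simp add: perm_q.rep_eq symbol_coeff_q hbar.T_single)

lemma perm_q_fun_q: "perm_q w (fun_q f) = fun_q (mero_perm w f)"
proof -
  have "coeff_perm w (fps_const f) = fps_const (mero_perm w f)"
    by (rule fps_ext) (simp add: coeff_perm_def)
  then show ?thesis by (simp add: fun_q_def perm_q_coeff_q)
qed

lemma perm_qEnd_R_op:
  fixes i j :: "'n::{finite,linorder}"
  assumes tau: "Im \<tau> > 0" and ij: "i \<noteq> j"
  shows "perm_qEnd w (R_op \<tau> i j \<mu> :: ('n, 'd::{finite,linorder}) qEnd) = R_op \<tau> (w \<langle>$\<rangle> i) (w \<langle>$\<rangle> j) \<mu>"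
proof (rule sqmat_eqI)
  fix s t :: "'n \<Rightarrow> 'd"
  have m: "meromorphic_fun (\<lambda>x. R_fun \<tau> i j \<mu> x (s \<circ> apply w) (t \<circ> apply w))"
    using R_fun_mero[OF tau ij, of \<mu>, where 'd = 'd] unfolding mero_entries_def by blast
  have "mero_perm w (abs_mero (\<lambda>x. R_fun \<tau> i j \<mu> x (s \<circ> apply w) (t \<circ> apply w))) =
     abs_mero (\<lambda>x. R_fun \<tau> i j \<mu> (vperm (inverse w) x) (s \<circ> apply w) (t \<circ> apply w))"
    by (rule mero_perm.abs_eq) (rule mero_eq_refl[OF m])
  moreover have "R_fun \<tau> i j \<mu> (vperm (inverse w) x) (s \<circ> apply w) (t \<circ> apply w) = R_fun \<tau> (w \<langle>$\<rangle> i) (w \<langle>$\<rangle> j) \<mu> x s t" for x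
  proof -
    have "(\<forall>k. k \<noteq> i \<and> k \<noteq> j \<longrightarrow> s (w \<langle>$\<rangle> k) = t (w \<langle>$\<rangle> k)) \<longleftrightarrow> (\<forall>k. k \<noteq> w \<langle>$\<rangle> i \<and> k \<noteq> w \<langle>$\<rangle> j \<longrightarrow> s k = t k)"
      by (metis perm_inv_apply)
    then show ?thesis unfolding R_fun_def R_mat_def o_def by (simp add: vperm_def cong: if_cong)
  qed
  ultimately show "entry (perm_qEnd w (R_op \<tau> i j \<mu>)) s t = entry (R_op \<tau> (w \<langle>$\<rangle> i) (w \<langle>$\<rangle> j) \<mu>) s t"
    by (simp add: R_op_eq_mero_mat perm_qEnd_def mero_mat_def perm_q_fun_q o_def)
qed

lemma scalar_mat_mult_left: "entry (scalar_mat a * B) s t = a * entry B s (t :: 'k::finite)" for a :: "'a::ring_1"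
proof -
  have "(\<Sum>k\<in>UNIV. (if s = k then a else 0) * entry B k t) = (if s = s then a else 0) * entry B s t"
    by (rule sum_UNIV_single) auto
  then show ?thesis by (simp add: times_sqmat.rep_eq scalar_mat_def)
qed

lemma scalar_mat_mult_right: "entry (B * scalar_mat a) s t = entry B s (t :: 'k::finite) * a" for a :: "'a::ring_1"
proof -
  have "(\<Sum>k\<in>UNIV. entry B s k * (if k = t then a else 0)) = entry B s t * (if t = t then a else 0)"
    by (rule sum_UNIV_single) auto
  then show ?thesis by (simp add: times_sqmat.rep_eq scalar_mat_def)
qed

lemma hbar_q_fun_q_uminus: "hbar_q * fun_q (- f) = - (hbar_q * fun_q f)"
  by (simp add: fun_q_uminus)

lemma R_op_p_hat:
  fixes i j k :: "'n::{finite,linorder}"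
  assumes tau: "Im \<tau> > 0" and ij: "i \<noteq> j"
  shows "k \<noteq> i \<Longrightarrow> k \<noteq> j \<Longrightarrow>
      scalar_mat (p_hat k) * (R_op \<tau> i j \<mu> :: ('n, 'd::{finite,linorder}) qEnd) = R_op \<tau> i j \<mu> * scalar_mat (p_hat k)"
    and "scalar_mat (p_hat i + p_hat j) * (R_op \<tau> i j \<mu> :: ('n, 'd) qEnd) = R_op \<tau> i j \<mu> * scalar_mat (p_hat i + p_hat j)"
proof -
  let ?f = "\<lambda>s t. abs_mero (\<lambda>x. R_fun \<tau> i j \<mu> x s (t :: 'n \<Rightarrow> 'd))"
  have "meromorphic_fun (\<lambda>x. R_fun \<tau> i j \<mu> x s (t :: 'n \<Rightarrow> 'd))" for s t
    using R_fun_mero[OF tau ij, of \<mu>, where 'd = 'd] unfolding mero_entries_def by blast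
  note m = mero_deriv_difference[OF this[unfolded R_fun_def] ij]
  have e: "entry (R_op \<tau> i j \<mu>) s t = fun_q (?f s t)" for s t
    by (simp add: R_op_eq_mero_mat mero_mat_def)
  show "scalar_mat (p_hat i + p_hat j) * (R_op \<tau> i j \<mu> :: ('n, 'd) qEnd) = R_op \<tau> i j \<mu> * scalar_mat (p_hat i + p_hat j)"
  proof (rule sqmat_eqI)
    fix s t
    have "p_hat i * fun_q (?f s t) - fun_q (?f s t) * p_hat i = - (p_hat j * fun_q (?f s t) - fun_q (?f s t) * p_hat j)"
      unfolding p_hat_commutator R_fun_def by (subst m(1)) (rule hbar_q_fun_q_uminus)
    then show "entry (scalar_mat (p_hat i + p_hat j) * R_op \<tau> i j \<mu>) s t = entry (R_op \<tau> i j \<mu> * scalar_mat (p_hat i + p_hat j)) s t"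
      unfolding scalar_mat_mult_left scalar_mat_mult_right e by (simp add: algebra_simps)
  qed
  assume k: "k \<noteq> i" "k \<noteq> j"
  show "scalar_mat (p_hat k) * (R_op \<tau> i j \<mu> :: ('n, 'd::{finite,linorder}) qEnd) = R_op \<tau> i j \<mu> * scalar_mat (p_hat k)"
  proof (rule sqmat_eqI)
    fix s t
    have "p_hat k * fun_q (?f s t) - fun_q (?f s t) * p_hat k = 0"
      unfolding p_hat_commutator R_fun_def by (subst m(2)[OF k]) (simp add: fun_q_zero)
    then show "entry (scalar_mat (p_hat k) * R_op \<tau> i j \<mu>) s t = entry (R_op \<tau> i j \<mu> * scalar_mat (p_hat k)) s t"
      unfolding scalar_mat_mult_left scalar_mat_mult_right e by simp
  qed
qed


section \<open>The crossed product\<close>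

lemma sum_UNIV_eq:
  fixes f :: "'a::finite \<Rightarrow> 'b::comm_monoid_add"
  shows "(\<And>u. u \<noteq> c \<Longrightarrow> f u = 0) \<Longrightarrow> f c = x \<Longrightarrow> sum f UNIV = x"
  using sum_UNIV_single[of c f] by simp

lemma crossed_eqI: "(\<And>w. crossed_coeff a w = crossed_coeff b w) \<Longrightarrow> a = b"
  by (metis crossed_coeff_inverse ext)

lemma perm_eq_mult_iff: "inverse u * w = v \<longleftrightarrow> u = w * inverse v" for u v w :: "'n perm"
  by (metis mult.assoc perm.left_inverse perm.right_inverse mult_1_left mult_1_right)

lemma coeff_emb_mult: "crossed_coeff (emb b * a) w = b * crossed_coeff a w"
proof -
  have "crossed_coeff (emb b * a) w = (\<Sum>u\<in>UNIV. (if u = 1 then b else 0) * perm_qEnd u (crossed_coeff a (inverse u * w)))"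
    by (simp add: times_crossed.rep_eq emb_def Crossed_inverse)
  also have "\<dots> = b * crossed_coeff a w"
    by (rule sum_UNIV_eq[where c = 1]) (auto simp: perm_qEnd_id)
  finally show ?thesis .
qed

lemma coeff_mult_hat: "crossed_coeff (a * hat v) w = crossed_coeff a (w * inverse v)"
proof -
  have "crossed_coeff (a * hat v) w = (\<Sum>u\<in>UNIV. crossed_coeff a u * perm_qEnd u (if inverse u * w = v then 1 else 0))"
    by (simp add: times_crossed.rep_eq hat_def Crossed_inverse)
  also have "\<dots> = crossed_coeff a (w * inverse v)"
    by (rule sum_UNIV_eq[where c = "w * inverse v"]) (simp_all only: perm_eq_mult_iff perm_qEnd_zero perm_qEnd_one if_True if_False mult_zero_right mult_1_right refl)
  finally show ?thesis .
qed

lemma coeff_mult_emb: "crossed_coeff (a * emb b) w = crossed_coeff a w * perm_qEnd w b"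
proof -
  have e: "inverse u * w = 1 \<longleftrightarrow> u = w" for u using perm_eq_mult_iff[of u w 1] by simp
  have "crossed_coeff (a * emb b) w = (\<Sum>u\<in>UNIV. crossed_coeff a u * perm_qEnd u (if inverse u * w = 1 then b else 0))"
    by (simp add: times_crossed.rep_eq emb_def Crossed_inverse)
  also have "\<dots> = crossed_coeff a w * perm_qEnd w b"
    by (rule sum_UNIV_eq[where c = w]) (auto simp: e perm_qEnd_zero)
  finally show ?thesis .
qed

lemma coeff_emb: "crossed_coeff (emb b) w = (if w = 1 then b else 0)"
  by (simp add: emb_def Crossed_inverse)

lemma coeff_hat: "crossed_coeff (hat v) w = (if w = v then 1 else 0)"
  by (simp add: hat_def Crossed_inverse)

lemma coeff_sum: "crossed_coeff (sum f A) w = (\<Sum>x\<in>A. crossed_coeff (f x) w)"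
  by (induction A rule: infinite_finite_induct) (simp_all add: zero_crossed.rep_eq plus_crossed.rep_eq)

lemma emb_mult: "emb a * emb b = emb (a * b)"
  by (rule crossed_eqI) (simp add: coeff_emb_mult coeff_emb)

lemma emb_add: "emb a + emb b = emb (a + b)"
  by (rule crossed_eqI) (simp add: plus_crossed.rep_eq coeff_emb)

lemma emb_uminus: "emb (- a) = - emb a"
  by (rule crossed_eqI) (simp add: uminus_crossed.rep_eq coeff_emb)

lemma hat_mult: "hat u * hat v = hat (u * v)"
proof (rule crossed_eqI)
  fix w :: "'a perm"
  have "w * inverse v = u \<longleftrightarrow> w = u * v"
    by (metis mult.assoc perm.left_inverse perm.right_inverse mult_1_right)
  then show "crossed_coeff (hat u * hat v) w = crossed_coeff (hat (u * v)) w"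
    by (simp add: coeff_mult_hat coeff_hat)
qed

lemma emb_zero: "emb 0 = 0"
  by (rule crossed_eqI) (simp add: coeff_emb zero_crossed.rep_eq)

lemma crossed_expand: "a = (\<Sum>w\<in>UNIV. emb (crossed_coeff a w) * hat w)"
proof (rule crossed_eqI)
  fix v :: "'a perm"
  have "crossed_coeff (\<Sum>w\<in>UNIV. emb (crossed_coeff a w) * hat w) v = (\<Sum>w\<in>UNIV. crossed_coeff a w * (if v = w then 1 else 0))"
    by (simp add: coeff_sum coeff_emb_mult coeff_hat)
  also have "\<dots> = crossed_coeff a v"
    by (rule sum_UNIV_eq[where c = v]) auto
  finally show "crossed_coeff a v = crossed_coeff (\<Sum>w\<in>UNIV. emb (crossed_coeff a w) * hat w) v" by simp
qed

lemma emb_hat_mult: "(emb a * hat u) * (emb b * hat v) = emb (a * perm_qEnd u b) * hat (u * v)"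
proof -
  have "(emb a * hat u) * (emb b * hat v) = emb a * (hat u * emb b) * hat v" by (simp add: mult.assoc)
  also have "\<dots> = (emb a * emb (perm_qEnd u b)) * (hat u * hat v)" by (simp add: hat_emb mult.assoc)
  finally show ?thesis by (simp add: emb_mult hat_mult)
qed

lemma scalar_mat_mult: "scalar_mat a * scalar_mat b = (scalar_mat (a * b) :: ('a::ring_1, 'k::finite) sqmat)"
  by (rule sqmat_eqI) (simp add: scalar_mat_mult_left, simp add: scalar_mat_def)

lemma scalar_mat_add: "scalar_mat a + scalar_mat b = (scalar_mat (a + b) :: ('a::ring_1, 'k::finite) sqmat)"
  by (rule sqmat_eqI) (simp add: plus_sqmat.rep_eq scalar_mat_def)

lemma scalar_mat_one: "scalar_mat 1 = (1 :: ('a::ring_1, 'k::finite) sqmat)"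
  by (rule sqmat_eqI) (simp add: one_sqmat.rep_eq scalar_mat_def)

lemma scalar_mat_central:
  fixes B :: "('a::ring_1, 'k::finite) sqmat"
  assumes "\<And>b. c * b = b * c" shows "scalar_mat c * B = B * scalar_mat c"
  by (rule sqmat_eqI) (simp add: scalar_mat_mult_left scalar_mat_mult_right assms)

lemma scal_mult: "scal a * scal b = scal (a * b)"
  by (simp add: scal_def emb_mult scalar_mat_mult)

lemma scal_add: "scal a + scal b = scal (a + b)"
  by (simp add: scal_def emb_add scalar_mat_add)

lemma perm_qEnd_scalar: "perm_qEnd w (scalar_mat a :: ('n::{finite,linorder}, 'd::finite) qEnd) = scalar_mat (perm_q w a)"
proof (rule sqmat_eqI)
  fix s t :: "'n \<Rightarrow> 'd"
  have "(\<lambda>i. s (w \<langle>$\<rangle> i)) = (\<lambda>i. t (w \<langle>$\<rangle> i)) \<longleftrightarrow> s = t"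
    using inj_eq[OF bij_is_inj[OF bij_comp_perm[of w]], of s t] by simp
  then show "entry (perm_qEnd w (scalar_mat a)) s t = entry (scalar_mat (perm_q w a)) s t"
    by (simp add: perm_qEnd_def scalar_mat_def perm_q_zero)
qed

lemma hat_scal: "hat w * scal a = scal (perm_q w a) * hat w"
  by (simp add: scal_def hat_emb perm_qEnd_scalar)

lemma scal_central:
  assumes "\<And>b. c * b = b * c" "\<And>w. perm_q w c = c"
  shows "scal c * a = a * scal c"
  by (rule crossed_eqI)
    (simp add: scal_def coeff_emb_mult coeff_mult_emb perm_qEnd_scalar assms(2) scalar_mat_central[OF assms(1)])

lemma coeff_q_central:
  assumes "\<And>i. hbar_deriv i f = 0"
  shows "coeff_q f * a = a * coeff_q f"
proof -
  let ?f = "pm_single 0 f"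
  have monom: "ore_monom hbar_deriv \<alpha> ?f = ?f * pm_single \<alpha> 1" for \<alpha>
  proof -
    have "ore_monom hbar_deriv \<alpha> (?f * b) = ?f * ore_monom hbar_deriv \<alpha> b" for b
      by (induction \<alpha> rule: multiidx_induct) (simp_all only: hbar.monom_zero hbar.monom_step hbar.gen_coeff assms single_zero mult_zero_left add_0_right)
    from this[of 1] show ?thesis by (simp add: hbar.monom_one)
  qed
  have "ore_mult hbar_deriv ?f b = ?f * b" for b
    by (simp add: hbar.mult_single' hbar.monom_zero)
  moreover have "ore_mult hbar_deriv b ?f = ?f * b" for b
  proof (induction b rule: pm_add_induct)
    case (single \<alpha> c)
    have "pm_single 0 c * (?f * pm_single \<alpha> 1) = ?f * (pm_single 0 c * pm_single \<alpha> 1)" by (simp add: mult_ac)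
    then show ?case by (simp add: hbar.mult_single' monom mult_single)
  qed (simp_all add: hbar.mult_zero_left hbar.mult_add_left distrib_left)
  ultimately show ?thesis by (intro quantum_eqI) (simp add: times_quantum.rep_eq symbol_coeff_q)
qed

lemma hbar_central: "hbar_q * a = a * hbar_q"
proof -
  have "mero_deriv i 1 = 0" for i :: 'a using mero_deriv_mult[of i 1 1] by simp
  then show ?thesis
    unfolding hbar_q_def by (intro coeff_q_central fps_ext) (simp add: hbar_deriv_nth fps_X_def)
qed

lemma mero_deriv_const: "mero_deriv i (mero_const c) = 0"
  by transfer (simp add: pd_const[abs_def] mero_eq_refl meromorphic_const)

lemma const_central: "const_q c * a = a * const_q c"
  unfolding const_q_def fun_q_def by (intro coeff_q_central fps_ext) (simp add: hbar_deriv_nth mero_deriv_const)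

lemma perm_q_const: "perm_q w (const_q c) = const_q c"
proof -
  have "mero_perm w (mero_const c) = mero_const c" by transfer (simp add: mero_eq_refl meromorphic_const)
  then show ?thesis by (simp add: const_q_def perm_q_fun_q)
qed

lemma perm_q_hbar: "perm_q w hbar_q = hbar_q"
proof -
  have "coeff_perm w fps_X = fps_X"
    by (rule fps_ext) (simp add: coeff_perm_def fps_X_def mero_perm_one)
  then show ?thesis by (simp add: hbar_q_def perm_q_coeff_q)
qed

lemmas scal_const_central = scal_central[OF const_central perm_q_const]

lemma scal_const_left_commute: "a * (scal (const_q c) * b) = scal (const_q c) * (a * b)"
proof -
  have "a * (scal (const_q c) * b) = (a * scal (const_q c)) * b" by (rule mult.assoc[symmetric])
  also have "\<dots> = (scal (const_q c) * a) * b" by (simp only: scal_const_central[of c a])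
  finally show ?thesis by (simp only: mult.assoc)
qed

lemma perm_q_p_hat: "perm_q w (p_hat i) = p_hat (w \<langle>$\<rangle> i)"
  by (rule quantum_eqI) (simp add: perm_q.rep_eq p_hat.rep_eq hbar.T_single midx_perm_single hbar.s_one)

lemma ore_monom_single: "ore_monom hbar_deriv (pm_single i 1) b = ore_gen hbar_deriv i b"
  using hbar.monom_step[of 0 i b] by (simp add: hbar.monom_zero)

lemma p_hat_commute: "p_hat i * p_hat j = p_hat j * p_hat i"
proof -
  have "symbol (p_hat i * p_hat j) = pm_single (pm_single i 1 + pm_single j 1) 1" for i j :: 'a
    unfolding times_quantum.rep_eq p_hat.rep_eq hbar.mult_single' ore_monom_single
    by (simp add: ore_gen_def hbar.map_D_single mult_single)
  then show ?thesis by (intro quantum_eqI) (simp add: add.commute)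
qed

section \<open>Dunkl operators\<close>

lemma apply_swap: "\<langle>i \<leftrightarrow> j\<rangle> \<langle>$\<rangle> k = (if k = i then j else if k = j then i else k)"
  by auto

lemma perm_swap_conj: "w * \<langle>i \<leftrightarrow> j\<rangle> = \<langle>w \<langle>$\<rangle> i \<leftrightarrow> w \<langle>$\<rangle> j\<rangle> * w"
  by (rule perm_eqI) (simp add: apply_times apply_swap apply_inj)

lemma hat_swap: "hat w * hat \<langle>i \<leftrightarrow> j\<rangle> = hat \<langle>w \<langle>$\<rangle> i \<leftrightarrow> w \<langle>$\<rangle> j\<rangle> * hat w"
  by (simp add: hat_mult perm_swap_conj)

text \<open>The terms linear in \<open>G\<close> cancel because \<open>P i + P j\<close> commutes with the skew \<open>X i j\<close>. In the quadratic terms disjoint pairs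
  commute, and for every third index \<open>k\<close> the three remaining commutators sum to the difference of the relation \<open>YB\<close> for
  \<open>i, j, k\<close> and for \<open>j, i, k\<close>.\<close>

lemma dunkl_commute_abstract:
  fixes P :: "'n::finite \<Rightarrow> 'r::ring_1" and X :: "'n \<Rightarrow> 'n \<Rightarrow> 'r" and G :: 'r
  assumes G: "\<And>z. G * z = z * G"
    and PP: "\<And>i j. P i * P j = P j * P i"
    and PX: "\<And>i j k. i \<noteq> j \<Longrightarrow> k \<noteq> i \<Longrightarrow> k \<noteq> j \<Longrightarrow> P k * X i j = X i j * P k"
    and PPX: "\<And>i j. i \<noteq> j \<Longrightarrow> (P i + P j) * X i j = X i j * (P i + P j)"
    and skew: "\<And>i j. i \<noteq> j \<Longrightarrow> X j i = - X i j"
    and XX: "\<And>i j k l. i \<noteq> j \<Longrightarrow> i \<noteq> k \<Longrightarrow> i \<noteq> l \<Longrightarrow> j \<noteq> k \<Longrightarrow> j \<noteq> l \<Longrightarrow> k \<noteq> l \<Longrightarrow> X i j * X k l = X k l * X i j"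
    and YB: "\<And>i j k. i \<noteq> j \<Longrightarrow> i \<noteq> k \<Longrightarrow> j \<noteq> k \<Longrightarrow> X i j * X j k + X i k * X j i = X j k * X i k"
  defines "y \<equiv> \<lambda>i. P i - G * (\<Sum>j\<in>UNIV - {i}. X i j)"
  shows "y i * y j = y j * y i"
proof (cases "i = j")
  case ne: False
  define K where "K = UNIV - {i, j}"
  define A where "A = (\<Sum>k\<in>K. X i k)"
  define B where "B = (\<Sum>k\<in>K. X j k)"
  have "UNIV - {i} = insert j K" "j \<notin> K" "UNIV - {j} = insert i K" "i \<notin> K" using ne by (auto simp: K_def)
  then have S: "(\<Sum>k\<in>UNIV - {i}. X i k) = X i j + A" "(\<Sum>k\<in>UNIV - {j}. X j k) = B - X i j"
    using skew[OF ne] by (simp_all add: A_def B_def)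
  have PB: "P i * B = B * P i" and PA: "P j * A = A * P j"
    unfolding A_def B_def sum_distrib_left sum_distrib_right
    by (rule sum.cong[OF refl]; use ne in \<open>auto simp: K_def intro!: PX\<close>)+
  have k: "(X i j * X j k - X j k * X i j) + (X i j * X i k - X i k * X i j) + (X i k * X j k - X j k * X i k) = 0"
    if "k \<in> K" for k
  proof -
    have d: "i \<noteq> k" "j \<noteq> k" using that by (auto simp: K_def)
    show ?thesis using YB[OF ne d] YB[OF ne[symmetric] d(2,1)] unfolding skew[OF ne] by (simp add: algebra_simps)
  qed
  have AB: "A * B - B * A = (\<Sum>k\<in>K. X i k * X j k - X j k * X i k)"
  proof -
    have "A * B - B * A = (\<Sum>k\<in>K. \<Sum>l\<in>K. X i k * X j l - X j l * X i k)"
      unfolding A_def B_def by (subst (2) sum_product, subst sum.swap) (simp add: sum_product sum_subtractf)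
    also have "\<dots> = (\<Sum>k\<in>K. \<Sum>l\<in>K. if k = l then X i k * X j k - X j k * X i k else 0)"
      using ne by (intro sum.cong refl) (auto simp: K_def intro!: XX)
    finally show ?thesis by simp
  qed
  have "(X i j + A) * (B - X i j) - (B - X i j) * (X i j + A) =
     (X i j * B - B * X i j) + (X i j * A - A * X i j) + (A * B - B * A)"
    by (simp add: algebra_simps)
  also have "\<dots> = (\<Sum>k\<in>K. (X i j * X j k - X j k * X i j) + (X i j * X i k - X i k * X i j) + (X i k * X j k - X j k * X i k))"
    unfolding AB unfolding A_def B_def by (simp add: sum.distrib sum_subtractf sum_distrib_left sum_distrib_right)
  also have "\<dots> = 0" by (rule sum.neutral) (use k in blast)
  finally have SS: "(X i j + A) * (B - X i j) = (B - X i j) * (X i j + A)" by simp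
  have PS: "P i * (B - X i j) + (X i j + A) * P j = (B - X i j) * P i + P j * (X i j + A)"
    using PPX[OF ne] PA PB by (simp add: algebra_simps)
  have expand: "(p - G * s) * (q - G * t) = p * q - G * (p * t + s * q) + G * G * (s * t)" for p q s t
  proof -
    have "p * (G * t) = G * (p * t)" "(G * s) * (G * t) = G * G * (s * t)" "(G * s) * q = G * (s * q)"
      by (metis G mult.assoc)+
    then show ?thesis by (simp only: left_diff_distrib right_diff_distrib distrib_left) simp
  qed
  have "y i * y j = P i * P j - G * (P i * (B - X i j) + (X i j + A) * P j) + G * G * ((X i j + A) * (B - X i j))"
    unfolding y_def S by (rule expand)
  also have "\<dots> = P j * P i - G * (P j * (X i j + A) + (B - X i j) * P i) + G * G * ((B - X i j) * (X i j + A))"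
    unfolding SS PS PP[of i j] add.commute[of "(B - X i j) * P i"] ..
  also have "\<dots> = y j * y i"
    unfolding y_def S by (rule expand[symmetric])
  finally show ?thesis .
qed simp

text \<open>In \<open>X i j = R\<^sub>i\<^sub>j s\<^sub>i\<^sub>j\<close> the transposition permutes the sites but leaves the spectral variables alone. After moving all
  transpositions to the right, \<open>YB\<close> is the associative Yang--Baxter equation times one fixed 3-cycle.\<close>

lemma dunkl_commute:
  fixes l :: "complex^('n::{finite,linorder})" and i j :: 'n
  assumes tau: "Im \<tau> > 0" and l: "l \<in> theta_regular_set \<tau> CARD('d::{finite,linorder})"
  shows "dunkl \<tau> g l i * dunkl \<tau> g l j = dunkl \<tau> g l j * (dunkl \<tau> g l i :: ('n, 'd) crossed)"
proof -
  define R where "R = (\<lambda>i j. R_op \<tau> i j (l $ i - l $ j) :: ('n, 'd) qEnd)"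
  define X where "X = (\<lambda>i j. emb (R i j) * hat \<langle>i \<leftrightarrow> j\<rangle>)"
  have ok: "theta_regular \<tau> CARD('d) (l $ i - l $ j)" if "i \<noteq> j" for i j
    using l that by (simp add: theta_regular_set_def)
  have XX: "X i j * X k m = emb (R i j * R_op \<tau> (\<langle>i \<leftrightarrow> j\<rangle> \<langle>$\<rangle> k) (\<langle>i \<leftrightarrow> j\<rangle> \<langle>$\<rangle> m) (l $ k - l $ m)) * hat (\<langle>i \<leftrightarrow> j\<rangle> * \<langle>k \<leftrightarrow> m\<rangle>)"
    if "k \<noteq> m" for i j k m
    unfolding X_def emb_hat_mult R_def perm_qEnd_R_op[OF tau that] ..
  have y: "dunkl \<tau> g l i = scal (p_hat i) - scal (const_q g) * (\<Sum>j\<in>UNIV - {i}. X i j)" for i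
    by (simp add: dunkl_def X_def R_def)
  show ?thesis
    unfolding y
  proof (rule dunkl_commute_abstract[where P = "\<lambda>i. scal (p_hat i)" and X = X and G = "scal (const_q g)"])
    show "scal (const_q g) * z = z * scal (const_q g)" for z :: "('n, 'd) crossed"
      by (rule scal_const_central)
    show "scal (p_hat i) * scal (p_hat j) = scal (p_hat j) * (scal (p_hat i) :: ('n, 'd) crossed)" for i j
      by (simp add: scal_mult p_hat_commute)
    show "scal (p_hat k) * X i j = X i j * scal (p_hat k)" if "i \<noteq> j" "k \<noteq> i" "k \<noteq> j" for i j k
    proof -
      have "X i j * scal (p_hat k) = emb (R i j) * (hat \<langle>i \<leftrightarrow> j\<rangle> * scal (p_hat k))" by (simp add: X_def mult.assoc)
      also have "\<dots> = (emb (R i j) * scal (p_hat k)) * hat \<langle>i \<leftrightarrow> j\<rangle>"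
        using that by (simp add: hat_scal perm_q_p_hat apply_swap mult.assoc)
      also have "emb (R i j) * scal (p_hat k) = scal (p_hat k) * emb (R i j)"
        by (simp add: scal_def emb_mult R_def R_op_p_hat(1)[OF tau that])
      finally show ?thesis by (simp add: X_def mult.assoc)
    qed
    show "(scal (p_hat i) + scal (p_hat j)) * X i j = X i j * (scal (p_hat i) + scal (p_hat j))" if "i \<noteq> j" for i j
    proof -
      have "X i j * scal (p_hat i + p_hat j) = emb (R i j) * (hat \<langle>i \<leftrightarrow> j\<rangle> * scal (p_hat i + p_hat j))" by (simp add: X_def mult.assoc)
      also have "\<dots> = (emb (R i j) * scal (p_hat i + p_hat j)) * hat \<langle>i \<leftrightarrow> j\<rangle>"
        by (simp add: hat_scal perm_q_p_hat perm_q_add apply_swap mult.assoc add.commute)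
      also have "emb (R i j) * scal (p_hat i + p_hat j) = scal (p_hat i + p_hat j) * emb (R i j)"
        by (simp add: scal_def emb_mult R_def R_op_p_hat(2)[OF tau that])
      finally show ?thesis by (simp add: X_def mult.assoc scal_add)
    qed
    show "X j i = - X i j" if "i \<noteq> j" for i j
      using R_op_skew[OF tau that, of "l $ i - l $ j", where 'd = 'd] swap_sym[of i j] by (simp add: X_def R_def emb_uminus)
    show "X i j * X k m = X k m * X i j" if "i \<noteq> j" "i \<noteq> k" "i \<noteq> m" "j \<noteq> k" "j \<noteq> m" "k \<noteq> m" for i j k m
    proof -
      have "\<langle>i \<leftrightarrow> j\<rangle> * \<langle>k \<leftrightarrow> m\<rangle> = \<langle>k \<leftrightarrow> m\<rangle> * \<langle>i \<leftrightarrow> j\<rangle>"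
        using that by (intro perm_eqI) (simp add: apply_times apply_swap)
      then show ?thesis
        unfolding XX[OF that(6)] XX[OF that(1)] using that
        by (simp add: apply_swap R_def R_op_disjoint_commute[OF tau that])
    qed
    show "X i j * X j k + X i k * X j i = X j k * X i k" if ijk: "i \<noteq> j" "i \<noteq> k" "j \<noteq> k" for i j k
    proof -
      have p: "\<langle>i \<leftrightarrow> j\<rangle> * \<langle>j \<leftrightarrow> k\<rangle> = \<langle>j \<leftrightarrow> k\<rangle> * \<langle>i \<leftrightarrow> k\<rangle>" "\<langle>i \<leftrightarrow> k\<rangle> * \<langle>j \<leftrightarrow> i\<rangle> = \<langle>j \<leftrightarrow> k\<rangle> * \<langle>i \<leftrightarrow> k\<rangle>"
        using ijk by (auto intro!: perm_eqI simp: apply_times apply_swap)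
      have a: "l $ i - l $ j + (l $ j - l $ k) = l $ i - l $ k" "- (l $ i - l $ j) = l $ j - l $ i" by simp_all
      have "R i j * R_op \<tau> i k (l $ j - l $ k) + R i k * R_op \<tau> j k (l $ j - l $ i) = R j k * R_op \<tau> i j (l $ i - l $ k)"
        using R_op_AYBE[OF tau ijk ok[OF ijk(1)] ok[OF ijk(3)]] ok[OF ijk(2)] unfolding a R_def by simp
      then show ?thesis
        unfolding XX[OF ijk(3)] XX[OF ijk(1)[symmetric]] XX[OF ijk(2)] p
        using ijk by (simp add: apply_swap distrib_right[symmetric] emb_add)
    qed
  qed
qed

lemma hat_dunkl:
  fixes l :: "complex^('n::{finite,linorder})" and i :: 'n
  assumes tau: "Im \<tau> > 0"
  shows "hat w * dunkl \<tau> g l i = dunkl \<tau> g (vperm w l) (w \<langle>$\<rangle> i) * (hat w :: ('n, 'd::{finite,linorder}) crossed)"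
proof -
  let ?X = "\<lambda>l i j. emb (R_op \<tau> i j (l $ i - l $ j)) * hat \<langle>i \<leftrightarrow> j\<rangle> :: ('n, 'd) crossed"
  have X: "hat w * ?X l i j = ?X (vperm w l) (w \<langle>$\<rangle> i) (w \<langle>$\<rangle> j) * hat w" if "i \<noteq> j" for j
  proof -
    have "hat w * ?X l i j = emb (perm_qEnd w (R_op \<tau> i j (l $ i - l $ j))) * (hat w * hat \<langle>i \<leftrightarrow> j\<rangle>)"
      by (simp add: mult.assoc[symmetric] hat_emb)
    then show ?thesis
      by (simp add: hat_swap perm_qEnd_R_op[OF tau that] mult.assoc vperm_def)
  qed
  have bij: "bij_betw (\<lambda>j. w \<langle>$\<rangle> j) (UNIV - {i}) (UNIV - {w \<langle>$\<rangle> i})"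
  proof -
    have "range (apply w) = UNIV" by (metis surjI perm_inv_apply(2))
    then show ?thesis
      using image_set_diff[OF inj_apply, of w UNIV "{i}"] by (auto simp: bij_betw_def intro: inj_on_subset[OF inj_apply])
  qed
  have "hat w * (\<Sum>j\<in>UNIV - {i}. ?X l i j) = (\<Sum>j\<in>UNIV - {i}. ?X (vperm w l) (w \<langle>$\<rangle> i) (w \<langle>$\<rangle> j)) * hat w"
    unfolding sum_distrib_left sum_distrib_right by (rule sum.cong[OF refl]) (use X in auto)
  also have "(\<Sum>j\<in>UNIV - {i}. ?X (vperm w l) (w \<langle>$\<rangle> i) (w \<langle>$\<rangle> j)) = (\<Sum>j\<in>UNIV - {w \<langle>$\<rangle> i}. ?X (vperm w l) (w \<langle>$\<rangle> i) j)"
    by (rule sum.reindex_bij_betw[OF bij])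
  finally have S: "hat w * (\<Sum>j\<in>UNIV - {i}. ?X l i j) = (\<Sum>j\<in>UNIV - {w \<langle>$\<rangle> i}. ?X (vperm w l) (w \<langle>$\<rangle> i) j) * hat w" .
  show ?thesis
    unfolding dunkl_def left_diff_distrib right_diff_distrib scal_const_left_commute S by (simp add: hat_scal perm_q_p_hat mult.assoc)
qed

section \<open>Calogero--Moser polynomials of Dunkl operators\<close>

lemma weierstrass_p_even: "weierstrass_p \<tau> (- z) = weierstrass_p \<tau> z"
proof -
  let ?f = "\<lambda>z (m::int, k::int). 1 / (z - (of_int m + of_int k * \<tau>))\<^sup>2 - 1 / (of_int m + of_int k * \<tau>)\<^sup>2"
  have bij: "bij_betw (\<lambda>(m::int, k::int). (- m, - k)) (UNIV - {(0, 0)}) (UNIV - {(0, 0)})"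
    by (rule bij_betw_byWitness[where f' = "\<lambda>(m, k). (- m, - k)"]) auto
  have "infsum (?f (- z)) (UNIV - {(0, 0)}) = (\<Sum>\<^sub>\<infinity>p\<in>UNIV - {(0, 0)}. ?f (- z) ((\<lambda>(m, k). (- m, - k)) p))"
    by (rule infsum_reindex_bij_betw[OF bij, symmetric])
  also have "\<dots> = infsum (?f z) (UNIV - {(0, 0)})"
  proof (rule infsum_cong)
    fix p :: "int \<times> int"
    obtain m k where p: "p = (m, k)" by (cases p)
    have e: "(- z - (of_int (- m) + of_int (- k) * \<tau>))\<^sup>2 = (z - (of_int m + of_int k * \<tau>))\<^sup>2"
      "(of_int (- m) + of_int (- k) * \<tau>)\<^sup>2 = (of_int m + of_int k * \<tau>)\<^sup>2"
      by (simp_all add: power2_eq_square algebra_simps)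
    show "?f (- z) ((\<lambda>(m, k). (- m, - k)) p) = ?f z p"
      unfolding p prod.case e ..
  qed
  finally show ?thesis by (simp add: weierstrass_p_def)
qed

lemma prod_list_commuting_remove:
  fixes f :: "'a \<Rightarrow> 'r::monoid_mult"
  assumes "\<And>a b. f a * f b = f b * f a"
  shows "prod_list (map f (as @ x # bs)) = f x * prod_list (map f (as @ bs))"
  by (induction as) (simp_all, metis assms mult.assoc)

lemma prod_list_commuting_cong:
  fixes f :: "'a \<Rightarrow> 'r::monoid_mult"
  assumes comm: "\<And>a b. f a * f b = f b * f a" and "distinct xs" "distinct ys" "set xs = set ys"
  shows "prod_list (map f xs) = prod_list (map f ys)"
  using assms(2-4)
proof (induction xs arbitrary: ys)
  case (Cons x xs)
  then obtain as bs where ys: "ys = as @ x # bs" by (metis list.set_intros(1) split_list)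
  have s: "set xs = set (as @ bs)" and d: "distinct (as @ bs)" using Cons.prems ys by auto
  have "distinct xs" using Cons.prems by simp
  then have "prod_list (map f xs) = prod_list (map f (as @ bs))" using d s by (rule Cons.IH)
  then show ?case unfolding ys prod_list_commuting_remove[of f, OF comm] by simp
qed simp

lemma prod_list_commutes:
  fixes f :: "'a \<Rightarrow> 'r::monoid_mult"
  assumes "\<And>a. a \<in> set xs \<Longrightarrow> f a * z = z * f a"
  shows "prod_list (map f xs) * z = z * prod_list (map f xs)"
  using assms by (induction xs) (simp_all, metis mult.assoc)

lemma eCM_dunkl_commute:
  fixes l :: "complex^('n::{finite,linorder})"
  assumes tau: "Im \<tau> > 0" and l: "l \<in> theta_regular_set \<tau> CARD('d::{finite,linorder})"
  shows "eCM_dunkl \<tau> g r l * dunkl \<tau> g l i = dunkl \<tau> g l i * (eCM_dunkl \<tau> g r l :: ('n, 'd) crossed)"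
  unfolding eCM_dunkl_def eCM_poly_def sum_distrib_left sum_distrib_right
proof (rule sum.cong[OF refl], clarify)
  fix M :: "'n set set" and K :: "'n set"
  let ?c = "scal (const_q (\<Prod>e\<in>M. g\<^sup>2 * weierstrass_p \<tau> (l $ Min e - l $ Max e))) :: ('n, 'd) crossed"
  let ?p = "prod_list (map (dunkl \<tau> g l) (sorted_list_of_set K)) :: ('n, 'd) crossed"
  have "?p * dunkl \<tau> g l i = dunkl \<tau> g l i * ?p"
    by (rule prod_list_commutes) (rule dunkl_commute[OF tau l])
  then show "?c * ?p * dunkl \<tau> g l i = dunkl \<tau> g l i * (?c * ?p)"
    by (simp only: scal_const_left_commute mult.assoc)
qed

lemma symmetric_Min_Max:
  fixes V :: "'a::linorder \<Rightarrow> 'a \<Rightarrow> 'b"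
  assumes "\<And>a b. V a b = V b a" shows "V (Min {a, b}) (Max {a, b}) = V a b"
  using assms[of a b] by (cases "a \<le> b") (auto simp: min_def max_def)

lemma pairings_perm:
  fixes w :: "'n::finite perm"
  assumes "(M, K) \<in> pairings r"
  shows "((`) (apply w) ` M, apply w ` K) \<in> pairings r"
proof -
  have inj: "inj (apply w)" by (rule inj_apply)
  have "card ((`) (apply w) ` M) = card M" "card (apply w ` K) = card K"
    by (rule card_image, rule inj_on_image, rule inj_on_subset[OF inj subset_UNIV])
      (rule card_image, rule inj_on_subset[OF inj subset_UNIV])
  moreover have "pairwise disjnt ((`) (apply w) ` M)"
    using assms inj unfolding pairings_def pairwise_image
    by (auto simp: pairwise_def disjnt_def image_Int[symmetric])
  moreover have "apply w ` K \<inter> \<Union> ((`) (apply w) ` M) = {}"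
    using assms inj by (auto simp: pairings_def dest: injD)
  moreover have "card (apply w ` e) = card e" for e
    by (rule card_image, rule inj_on_subset[OF inj subset_UNIV])
  ultimately show ?thesis using assms by (auto simp: pairings_def)
qed

text \<open>Relabelling changes the order of the factors in each monomial and the order within each pair. The former is harmless
  because the Dunkl operators commute, the latter because the Weierstrass function is even.\<close>

lemma hat_eCM_dunkl:
  fixes l :: "complex^('n::{finite,linorder})"
  assumes tau: "Im \<tau> > 0" and l: "l \<in> theta_regular_set \<tau> CARD('d::{finite,linorder})"
  shows "hat w * eCM_dunkl \<tau> g r l = eCM_dunkl \<tau> g r (vperm w l) * (hat w :: ('n, 'd) crossed)"
proof -
  let ?l = "vperm w l"
  have l': "?l \<in> theta_regular_set \<tau> CARD('d)"
    using l by (auto simp: theta_regular_set_def vperm_def apply_inj)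
  let ?c = "\<lambda>l M. scal (const_q (\<Prod>e\<in>M. g\<^sup>2 * weierstrass_p \<tau> (l $ Min e - l $ Max e))) :: ('n, 'd) crossed"
  let ?p = "\<lambda>l K. prod_list (map (dunkl \<tau> g l) (sorted_list_of_set K)) :: ('n, 'd) crossed"
  let ?w = "\<lambda>(M, K). ((`) (apply w) ` M, apply w ` K)"
  have bij: "bij_betw ?w (pairings r) (pairings r)"
    by (rule bij_betw_byWitness[where f' = "\<lambda>(M, K). ((`) (apply (inverse w)) ` M, apply (inverse w) ` K)"])
      (auto simp: image_image intro: pairings_perm)
  have c: "?c ?l ((`) (apply w) ` M) = ?c l M" if "\<forall>e\<in>M. card e = 2" for M
  proof -
    have v: "g\<^sup>2 * weierstrass_p \<tau> (?l $ Min (apply w ` e) - ?l $ Max (apply w ` e)) = g\<^sup>2 * weierstrass_p \<tau> (l $ Min e - l $ Max e)"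
      if "e \<in> M" for e
    proof -
      have "card e = 2" using \<open>\<forall>e\<in>M. card e = 2\<close> that by blast
      then obtain a b where e: "e = {a, b}" unfolding card_2_iff by blast
      have s: "weierstrass_p \<tau> (v $ a - v $ b) = weierstrass_p \<tau> (v $ b - v $ a)" for v :: "(complex, 'n) vec" and a b
        using weierstrass_p_even[of \<tau> "v $ a - v $ b"] by simp
      have "weierstrass_p \<tau> (?l $ Min (apply w ` e) - ?l $ Max (apply w ` e)) = weierstrass_p \<tau> (?l $ (w \<langle>$\<rangle> a) - ?l $ (w \<langle>$\<rangle> b))"
        unfolding e image_insert image_empty by (rule symmetric_Min_Max) (rule s)
      also have "\<dots> = weierstrass_p \<tau> (l $ a - l $ b)" by (simp add: vperm_def)
      also have "\<dots> = weierstrass_p \<tau> (l $ Min e - l $ Max e)"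
        unfolding e by (rule symmetric_Min_Max[symmetric]) (rule s)
      finally show ?thesis by simp
    qed
    have inj: "inj_on ((`) (apply w)) M" by (rule inj_on_image, rule inj_on_subset[OF inj_apply subset_UNIV])
    have "(\<Prod>e\<in>(`) (apply w) ` M. g\<^sup>2 * weierstrass_p \<tau> (?l $ Min e - ?l $ Max e)) =
        (\<Prod>e\<in>M. g\<^sup>2 * weierstrass_p \<tau> (l $ Min e - l $ Max e))"
      unfolding prod.reindex[OF inj] by (rule prod.cong[OF refl]) (simp only: o_def v)
    then show ?thesis by (simp only:)
  qed
  have "hat w * prod_list (map (dunkl \<tau> g l) xs) = prod_list (map (dunkl \<tau> g ?l) (map (apply w) xs)) * (hat w :: ('n, 'd) crossed)" for xs
  proof (induction xs)
    case (Cons x xs)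
    have "hat w * prod_list (map (dunkl \<tau> g l) (x # xs)) = (hat w * dunkl \<tau> g l x) * (prod_list (map (dunkl \<tau> g l) xs) :: ('n, 'd) crossed)"
      by (simp add: mult.assoc)
    also have "\<dots> = dunkl \<tau> g ?l (w \<langle>$\<rangle> x) * (hat w * prod_list (map (dunkl \<tau> g l) xs))"
      by (simp only: hat_dunkl[OF tau] mult.assoc)
    finally show ?case unfolding Cons.IH by (simp add: mult.assoc)
  qed simp
  moreover have "prod_list (map (dunkl \<tau> g ?l) (map (apply w) (sorted_list_of_set K))) = ?p ?l (apply w ` K)" for K
    by (rule prod_list_commuting_cong) (auto intro: dunkl_commute[OF tau l'] simp: distinct_map inj_on_subset[OF inj_apply])
  ultimately have p: "hat w * ?p l K = ?p ?l (apply w ` K) * hat w" for K by metis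
  have "hat w * eCM_dunkl \<tau> g r l = (\<Sum>(M, K)\<in>pairings r. ?c l M * (hat w * ?p l K))"
    unfolding eCM_dunkl_def eCM_poly_def sum_distrib_left
    by (rule sum.cong[OF refl]) (clarsimp simp only: scal_const_left_commute split: prod.split)
  also have "\<dots> = (\<Sum>(M, K)\<in>pairings r. ?c ?l ((`) (apply w) ` M) * ?p ?l (apply w ` K)) * hat w"
    unfolding sum_distrib_right by (rule sum.cong[OF refl]) (clarsimp simp: p mult.assoc, simp add: c pairings_def)
  also have "(\<Sum>(M, K)\<in>pairings r. ?c ?l ((`) (apply w) ` M) * ?p ?l (apply w ` K)) =
     (\<Sum>q\<in>pairings r. case ?w q of (M, K) \<Rightarrow> ?c ?l M * ?p ?l K)"
    by (rule sum.cong[OF refl]) auto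
  also have "\<dots> = (\<Sum>(M, K)\<in>pairings r. ?c ?l M * ?p ?l K)"
    by (rule sum.reindex_bij_betw[OF bij])
  finally show ?thesis by (simp add: eCM_dunkl_def eCM_poly_def)
qed


section \<open>Regular families\<close>

lemma joint_nth [simp]: "joint x l $ Inl i = x $ i" "joint x l $ Inr i = l $ i"
  by (simp_all add: joint_def)

lemma sum_split_all: "(\<forall>k. P k) \<longleftrightarrow> (\<forall>i. P (Inl i)) \<and> (\<forall>i. P (Inr i))"
  by (metis sum.exhaust)

lemma upd_joint: "upd (joint x l) (Inl i) t = joint (upd x i t) l"
  by (simp add: vec_eq_iff sum_split_all)

lemma continuous_joint:
  fixes x l :: "complex^'n"
  shows "continuous_on UNIV (\<lambda>x. joint x l)" "continuous_on UNIV (\<lambda>l. joint x l)"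
proof -
  have c: "continuous_on UNIV (\<lambda>x. case k of Inl i \<Rightarrow> x $ i | Inr i \<Rightarrow> l $ i)"
    "continuous_on UNIV (\<lambda>l. case k of Inl i \<Rightarrow> x $ i | Inr i \<Rightarrow> l $ i)" for k :: "'n + 'n"
    by (cases k; auto intro!: continuous_intros)+
  show "continuous_on UNIV (\<lambda>x. joint x l)"
    unfolding joint_def by (rule continuous_on_vec_lambda) (rule c(1))
  show "continuous_on UNIV (\<lambda>l. joint x l)"
    unfolding joint_def by (rule continuous_on_vec_lambda) (rule c(2))
qed

lemma open_fibre: "open \<Omega> \<Longrightarrow> open {x. joint x l \<in> \<Omega>}" "open \<Omega> \<Longrightarrow> open {l. joint x l \<in> \<Omega>}"
  using open_vimage[OF _ continuous_joint(1)] open_vimage[OF _ continuous_joint(2)] by (auto simp: vimage_def)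

text \<open>The data behind \<open>regular_family\<close>, with the representatives \<open>q l\<close> of the members chosen at once.\<close>

definition family_expression :: "(complex^'n) set \<Rightarrow> (complex^'n \<Rightarrow> 'n mero) \<Rightarrow>
    (complex^('n + 'n)) set \<Rightarrow> (complex^('n + 'n) \<Rightarrow> complex) \<Rightarrow> (complex^'n \<Rightarrow> complex^'n \<Rightarrow> complex) \<Rightarrow> bool" where
  "family_expression N F \<Omega> f q \<longleftrightarrow> f mholo_on \<Omega> \<and> (\<forall>l\<in>N. closure {x. joint x l \<in> \<Omega>} = UNIV \<and>
     meromorphic_fun (q l) \<and> F l = abs_mero (q l) \<and> (\<forall>x. joint x l \<in> \<Omega> \<longrightarrow> q l x = f (joint x l)))"

lemma regular_family_iff: "regular_family N F \<longleftrightarrow> (\<exists>\<Omega> f q. family_expression N F \<Omega> f q)"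
  unfolding regular_family_def family_expression_def by metis

lemma family_expressionD:
  assumes "family_expression N F \<Omega> f q"
  shows "f mholo_on \<Omega>" "l \<in> N \<Longrightarrow> closure {x. joint x l \<in> \<Omega>} = UNIV"
    "l \<in> N \<Longrightarrow> meromorphic_fun (q l)" "l \<in> N \<Longrightarrow> F l = abs_mero (q l)"
    "l \<in> N \<Longrightarrow> joint x l \<in> \<Omega> \<Longrightarrow> q l x = f (joint x l)"
  using assms unfolding family_expression_def by blast+

lemma regular_familyI:
  assumes "f mholo_on \<Omega>" "\<And>l. l \<in> N \<Longrightarrow> closure {x. joint x l \<in> \<Omega>} = UNIV"
    "\<And>l. l \<in> N \<Longrightarrow> meromorphic_fun (q l)" "\<And>l. l \<in> N \<Longrightarrow> F l = abs_mero (q l)"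
    "\<And>l x. l \<in> N \<Longrightarrow> joint x l \<in> \<Omega> \<Longrightarrow> q l x = f (joint x l)"
  shows "regular_family N F"
  unfolding regular_family_iff family_expression_def using assms by blast

lemma regular_family_subset: "regular_family N F \<Longrightarrow> N' \<subseteq> N \<Longrightarrow> regular_family N' F"
  unfolding regular_family_def by blast

lemma dense_fibre_Int:
  assumes "open \<Omega>" "closure {x. joint x l \<in> \<Omega>} = UNIV" "closure {x. joint x l \<in> \<Omega>'} = UNIV"
  shows "closure {x. joint x l \<in> \<Omega> \<inter> \<Omega>'} = UNIV"
  using dense_Int[OF open_fibre(1)[OF assms(1)] assms(2,3)] by (simp add: Int_def)

lemma regular_family_binary:
  fixes F G :: "complex^'n \<Rightarrow> ('n::finite) mero"
  assumes F: "regular_family N F" and G: "regular_family N G"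
    and holo: "\<And>S (f :: complex^('n + 'n) \<Rightarrow> complex) g. f mholo_on S \<Longrightarrow> g mholo_on S \<Longrightarrow> (\<lambda>x. op (f x) (g x)) mholo_on S"
    and mer: "\<And>f g :: complex^'n \<Rightarrow> complex. meromorphic_fun f \<Longrightarrow> meromorphic_fun g \<Longrightarrow> meromorphic_fun (\<lambda>x. op (f x) (g x))"
    and abs: "\<And>f g. meromorphic_fun f \<Longrightarrow> meromorphic_fun g \<Longrightarrow> opm (abs_mero f) (abs_mero g) = abs_mero (\<lambda>x. op (f x) (g x))"
  shows "regular_family N (\<lambda>l. opm (F l) (G l))"
proof -
  obtain \<Omega> f q where "family_expression N F \<Omega> f q" using F unfolding regular_family_iff by blast
  note 1 = family_expressionD[OF this]
  obtain \<Omega>' f' q' where "family_expression N G \<Omega>' f' q'" using G unfolding regular_family_iff by blast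
  note 2 = family_expressionD[OF this]
  have o: "open (\<Omega> \<inter> \<Omega>')" using mholo_open[OF 1(1)] mholo_open[OF 2(1)] by blast
  show ?thesis
  proof (rule regular_familyI[where \<Omega> = "\<Omega> \<inter> \<Omega>'" and f = "\<lambda>z. op (f z) (f' z)" and q = "\<lambda>l x. op (q l x) (q' l x)"])
    show "(\<lambda>z. op (f z) (f' z)) mholo_on \<Omega> \<inter> \<Omega>'"
      by (rule holo) (auto intro: mholo_on_subset[OF 1(1) o] mholo_on_subset[OF 2(1) o])
    show "closure {x. joint x l \<in> \<Omega> \<inter> \<Omega>'} = UNIV" if "l \<in> N" for l
      using dense_fibre_Int[OF mholo_open[OF 1(1)]] 1(2) 2(2) that by blast
  qed (use 1(3-) 2(3-) mer abs in auto)
qed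

lemma regular_family_add: "regular_family N F \<Longrightarrow> regular_family N G \<Longrightarrow> regular_family N (\<lambda>l. F l + G l)"
  by (rule regular_family_binary[where op = "(+)"]) (auto intro: mholo_add meromorphic_add abs_mero_add)

lemma regular_family_mult: "regular_family N F \<Longrightarrow> regular_family N G \<Longrightarrow> regular_family N (\<lambda>l. F l * G l)"
  by (rule regular_family_binary[where op = "(*)"]) (auto intro: mholo_mult meromorphic_mult abs_mero_mult)

lemma abs_mero_rep: obtains q where "meromorphic_fun q" "c = abs_mero q"
proof -
  have "abs_mero (rep_mero c) = c" by (rule Quotient_abs_rep[OF Quotient_mero])
  moreover have "mero_eq (rep_mero c) (rep_mero c)" by (rule Quotient_rep_reflp[OF Quotient_mero])
  ultimately show ?thesis using that[of "rep_mero c"] mero_eqD(1) by metis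
qed

lemma meromorphic_holo_dense:
  assumes q: "meromorphic_fun q"
  obtains D where "q mholo_on D" "closure D = UNIV"
proof
  let ?D = "\<Union>{S. q mholo_on S}"
  show "q mholo_on ?D"
  proof -
    have "open ?D" using mholo_open by blast
    moreover have "continuous_on ?D q"
      by (rule continuous_on_open_Union) (auto dest: mholo_open mholo_cont)
    ultimately show ?thesis unfolding mholo_on_def by (auto simp: mholo_on_def)
  qed
  have "v \<in> closure ?D" for v
  proof -
    obtain N g h where 1: "v \<in> N" "g mholo_on N" "h mholo_on N" "N \<subseteq> closure {x\<in>N. h x \<noteq> 0}"
      "\<forall>x\<in>N. h x \<noteq> 0 \<longrightarrow> q x = g x / h x"
      by (rule meromorphic_funE[OF q])
    let ?A = "{x\<in>N. h x \<noteq> 0}"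
    have o: "open ?A" by (rule mholo_nonzero_open[OF 1(3)])
    have "(\<lambda>x. g x / h x) mholo_on ?A"
      by (rule mholo_divide) (auto intro: mholo_on_subset[OF 1(2) o] mholo_on_subset[OF 1(3) o])
    then have "q mholo_on ?A" by (rule mholo_cong) (use 1(5) in auto)
    then have "?A \<subseteq> ?D" by blast
    from closure_mono[OF this] show ?thesis using 1(1,4) by blast
  qed
  then show "closure ?D = UNIV" by blast
qed

text \<open>The function must be restricted to the dense open set where it is holomorphic, because an arbitrary representative of a
  meromorphic function need not be continuous elsewhere.\<close>

lemma regular_family_const:
  fixes c :: "'n::finite mero"
  shows "regular_family N (\<lambda>_. c)"
proof -
  obtain q where q: "meromorphic_fun q" "c = abs_mero q" by (rule abs_mero_rep)
  obtain D where D: "q mholo_on D" "closure D = UNIV" by (rule meromorphic_holo_dense[OF q(1)])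
  let ?fst = "\<lambda>z :: complex^('n + 'n). \<chi> i. z $ Inl i"
  have c: "continuous_on UNIV ?fst" by (intro continuous_intros)
  have fst: "?fst (joint x l) = x" for x l by (simp add: vec_eq_iff)
  have fst_upd: "?fst (upd z k t) = (case k of Inl i \<Rightarrow> upd (?fst z) i t | Inr i \<Rightarrow> ?fst z)" for z k t
    by (auto simp: vec_eq_iff split: sum.split)
  show ?thesis
  proof (rule regular_familyI[where \<Omega> = "?fst -` D" and f = "\<lambda>z. q (?fst z)" and q = "\<lambda>_. q"])
    show "(\<lambda>z. q (?fst z)) mholo_on ?fst -` D"
    proof (rule mholo_onI[where D = "\<lambda>z k. case k of Inl i \<Rightarrow> pd i q (?fst z) | Inr i \<Rightarrow> 0"])
      show "open (?fst -` D)" by (rule open_vimage[OF mholo_open[OF D(1)] c])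
      show "continuous_on (?fst -` D) (\<lambda>z. q (?fst z))"
        by (rule continuous_on_compose2[OF mholo_cont[OF D(1)] continuous_on_subset[OF c]]) auto
      fix z k assume "z \<in> ?fst -` D"
      then have z: "?fst z \<in> D" by simp
      show "((\<lambda>t. q (?fst (upd z k t))) has_field_derivative (case k of Inl i \<Rightarrow> pd i q (?fst z) | Inr i \<Rightarrow> 0)) (at (z $ k))"
      proof (cases k)
        case (Inl i)
        have "?fst z $ i = z $ k" by (simp add: Inl)
        then show ?thesis using mholo_onD'[OF D(1) z, of i] unfolding fst_upd by (simp add: Inl)
      next
        case (Inr i)
        then show ?thesis unfolding fst_upd by simp
      qed
    qed
    show "closure {x. joint x l \<in> ?fst -` D} = UNIV" for l
      using D(2) by (simp add: fst)
  qed (use q fst in auto)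
qed

lemma regular_family_sum: "(\<And>i. i \<in> A \<Longrightarrow> regular_family N (F i)) \<Longrightarrow> regular_family N (\<lambda>l. \<Sum>i\<in>A. F i l)"
  by (induction A rule: infinite_finite_induct) (auto intro: regular_family_const regular_family_add)

lemma regular_family_if:
  "regular_family N F \<Longrightarrow> regular_family N G \<Longrightarrow> regular_family N (\<lambda>l. if C then F l else G l)"
  by (cases C) auto

lemma regular_family_deriv:
  assumes "regular_family N F" shows "regular_family N (\<lambda>l. mero_deriv i (F l))"
proof -
  obtain \<Omega> f q where "family_expression N F \<Omega> f q" using assms unfolding regular_family_iff by blast
  note 1 = family_expressionD[OF this]
  show ?thesis
  proof (rule regular_familyI[where f = "pd (Inl i) f" and q = "\<lambda>l. pd i (q l)", OF pd_mholo[OF 1(1)] 1(2)])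
    fix l assume l: "l \<in> N"
    show "meromorphic_fun (pd i (q l))" by (rule meromorphic_pd[OF 1(3)[OF l]])
    show "mero_deriv i (F l) = abs_mero (pd i (q l))"
      unfolding 1(4)[OF l] by (rule mero_deriv.abs_eq) (rule mero_eq_refl[OF 1(3)[OF l]])
    fix x assume x: "joint x l \<in> \<Omega>"
    have "pd i (q l) x = pd i (\<lambda>x. f (joint x l)) x"
      by (rule pd_cong[OF open_fibre(1)[OF mholo_open[OF 1(1)]]]) (use x 1(5)[OF l] in auto)
    also have "\<dots> = pd (Inl i) f (joint x l)" by (simp add: pd_def upd_joint)
    finally show "pd i (q l) x = pd (Inl i) f (joint x l)" .
  qed
qed

lemma perm_of_bij:
  fixes \<sigma> :: "'k::finite \<Rightarrow> 'k"
  assumes "bij \<sigma>" obtains u where "\<And>z. vperm u z = (\<chi> k. z $ \<sigma> k)"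
proof
  show "vperm (inverse (Perm \<sigma>)) z = (\<chi> k. z $ \<sigma> k)" for z
    using assms by (simp add: vperm_def Perm_inverse)
qed

lemma bij_map_sum:
  assumes "bij f" "bij g" shows "bij (map_sum f g)"
proof -
  obtain f' g' where "\<And>x. f' (f x) = x" "\<And>x. f (f' x) = x" "\<And>y. g' (g y) = y" "\<And>y. g (g' y) = y"
    using assms by (metis bij_pointE)
  then show ?thesis
    by (intro bij_betw_byWitness[where f' = "map_sum f' g'"]) (auto simp: sum_split_all)
qed

lemma bij_apply: "bij (apply w)"
  by (rule bij_betw_byWitness[where f' = "\<lambda>i. inverse w \<langle>$\<rangle> i"]) auto

lemma vperm_joint_fst:
  fixes w :: "'n::finite perm"
  obtains u where "\<And>x l. vperm u (joint x l) = joint (vperm w x) l"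
proof -
  obtain u :: "('n + 'n) perm" where u: "\<And>z. vperm u z = (\<chi> k. z $ map_sum (apply (inverse w)) id k)"
    by (rule perm_of_bij[OF bij_map_sum[OF bij_apply[of "inverse w"] bij_id]]) (rule that)
  show ?thesis by (rule that[of u]) (simp add: u, simp add: vec_eq_iff sum_split_all vperm_def)
qed

lemma vperm_joint_snd:
  fixes w :: "'n::finite perm"
  obtains u where "\<And>x l. vperm u (joint x l) = joint x (vperm w l)"
proof -
  obtain u :: "('n + 'n) perm" where u: "\<And>z. vperm u z = (\<chi> k. z $ map_sum id (apply (inverse w)) k)"
    by (rule perm_of_bij[OF bij_map_sum[OF bij_id bij_apply[of "inverse w"]]]) (rule that)
  show ?thesis by (rule that[of u]) (simp add: u, simp add: vec_eq_iff sum_split_all vperm_def)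
qed

lemma regular_family_perm:
  assumes "regular_family N F" shows "regular_family N (\<lambda>l. mero_perm w (F l))"
proof -
  obtain \<Omega> f q where "family_expression N F \<Omega> f q" using assms unfolding regular_family_iff by blast
  note 1 = family_expressionD[OF this]
  obtain u where u: "\<And>x l. vperm u (joint x l) = joint (vperm (inverse w) x) l"
    by (rule vperm_joint_fst[of "inverse w"]) (rule that)
  show ?thesis
  proof (rule regular_familyI[where f = "\<lambda>z. f (vperm u z)" and q = "\<lambda>l x. q l (vperm (inverse w) x)", OF mholo_vperm[OF 1(1)]])
    fix l assume l: "l \<in> N"
    show "closure {x. joint x l \<in> vperm u -` \<Omega>} = UNIV"
      using closure_vperm[of "inverse w" "{x. joint x l \<in> \<Omega>}"] 1(2)[OF l] by (auto simp: vimage_def u)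
    show "meromorphic_fun (\<lambda>x. q l (vperm (inverse w) x))" by (rule meromorphic_vperm[OF 1(3)[OF l]])
    show "mero_perm w (F l) = abs_mero (\<lambda>x. q l (vperm (inverse w) x))"
      unfolding 1(4)[OF l] by (rule mero_perm.abs_eq) (rule mero_eq_refl[OF 1(3)[OF l]])
    fix x assume x: "joint x l \<in> vperm u -` \<Omega>"
    then show "q l (vperm (inverse w) x) = f (vperm u (joint x l))" using 1(5)[OF l] by (simp add: u)
  qed
qed

lemma regular_family_vperm:
  assumes "regular_family N F" shows "regular_family (vperm w -` N) (\<lambda>l. F (vperm w l))"
proof -
  obtain \<Omega> f q where "family_expression N F \<Omega> f q" using assms unfolding regular_family_iff by blast
  note 1 = family_expressionD[OF this]
  obtain u where u: "\<And>x l. vperm u (joint x l) = joint x (vperm w l)"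
    by (rule vperm_joint_snd[of w]) (rule that)
  show ?thesis
    by (rule regular_familyI[where f = "\<lambda>z. f (vperm u z)" and q = "\<lambda>l. q (vperm w l)", OF mholo_vperm[OF 1(1)]])
      (use 1(2-) in \<open>auto simp: u\<close>)
qed

lemma abs_mero_eq_zeroD:
  assumes "meromorphic_fun q" "abs_mero q = 0"
  obtains D where "closure D = UNIV" "\<And>x. x \<in> D \<Longrightarrow> q x = 0"
proof -
  have "mero_eq q (\<lambda>_. 0)"
    by (rule Quotient_rel[OF Quotient_mero, THEN iffD1])
      (simp add: assms abs_mero_zero mero_eq_refl[OF meromorphic_const] mero_eq_refl[OF assms(1)])
  then show ?thesis using that unfolding mero_eq_def by blast
qed

lemma dense_meets_open:
  assumes "closure G = UNIV" "open S" "x \<in> S" obtains y where "y \<in> G" "y \<in> S"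
proof -
  have "S \<inter> G \<noteq> {}" using open_Int_closure_eq_empty[OF assms(2), of G] assms(1,3) by auto
  then show ?thesis using that by blast
qed

text \<open>If the holomorphic function behind the family were nonzero at a point over \<open>l0\<close>, it would be nonzero near that point,
  in particular on a nonempty open part of the fibre over some \<open>l \<in> N \<inter> G\<close>, where the member of the family is zero.\<close>

lemma regular_family_limit:
  assumes F: "regular_family N F" and zero: "\<And>l. l \<in> N \<Longrightarrow> l \<in> G \<Longrightarrow> F l = 0"
    and N: "open N" and G: "closure G = UNIV" and l0: "l0 \<in> N"
  shows "F l0 = 0"
proof -
  obtain \<Omega> f q where "family_expression N F \<Omega> f q" using F unfolding regular_family_iff by blast
  note 1 = family_expressionD[OF this]
  have "f (joint x l0) = 0" if x: "joint x l0 \<in> \<Omega>" for x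
  proof (rule ccontr)
    assume nz: "f (joint x l0) \<noteq> 0"
    let ?V = "{z\<in>\<Omega>. f z \<noteq> 0}"
    have V: "open ?V" by (rule mholo_nonzero_open[OF 1(1)])
    have "open ({l. joint x l \<in> ?V} \<inter> N)" "l0 \<in> {l. joint x l \<in> ?V} \<inter> N"
      using open_fibre(2)[OF V, of x] N l0 x nz by auto
    from dense_meets_open[OF G this] obtain l where l: "l \<in> G" "l \<in> N" "joint x l \<in> ?V" by blast
    obtain D where D: "closure D = UNIV" "\<And>x. x \<in> D \<Longrightarrow> q l x = 0"
      by (rule abs_mero_eq_zeroD[OF 1(3)[OF l(2)]]) (use 1(4)[OF l(2)] zero[OF l(2,1)] in auto)
    have "open {x. joint x l \<in> ?V}" "x \<in> {x. joint x l \<in> ?V}"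
      using open_fibre(1)[OF V, of l] l(3) by auto
    from dense_meets_open[OF D(1) this] obtain x' where "x' \<in> D" "joint x' l \<in> ?V" by blast
    with D(2) 1(5)[OF l(2)] show False by force
  qed
  then have "q l0 x = 0" if "joint x l0 \<in> \<Omega>" for x using 1(5)[OF l0] that by simp
  then have "abs_mero (q l0) = abs_mero (\<lambda>_. 0)"
    by (intro abs_mero_eqI[OF 1(3)[OF l0] meromorphic_const open_fibre(1)[OF mholo_open[OF 1(1)]] 1(2)[OF l0]]) auto
  then show ?thesis by (simp add: 1(4)[OF l0] abs_mero_zero)
qed

section \<open>Regular families in the crossed product\<close>

definition multidegree :: "('n::finite \<Rightarrow>\<^sub>0 nat) \<Rightarrow> nat" where
  "multidegree \<alpha> = (\<Sum>i\<in>UNIV. pm_lookup \<alpha> i)"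

lemma multidegree_step: "multidegree (\<alpha> + pm_single i 1) = Suc (multidegree \<alpha>)"
proof -
  have "(\<Sum>k\<in>UNIV. pm_lookup (pm_single i (1::nat)) k) = (\<Sum>k\<in>UNIV. if i = k then 1 else 0)"
    by (rule sum.cong) (auto simp: lookup_single when_def)
  then show ?thesis by (simp add: multidegree_def lookup_add sum.distrib)
qed

lemma finite_multidegree: "finite {\<alpha> :: 'n::finite \<Rightarrow>\<^sub>0 nat. multidegree \<alpha> \<le> m}"
proof (rule finite_imageD)
  have "pm_lookup \<alpha> i \<le> m" if "multidegree \<alpha> \<le> m" for \<alpha> :: "'n \<Rightarrow>\<^sub>0 nat" and i
    using that member_le_sum[of i UNIV "pm_lookup \<alpha>"] by (simp add: multidegree_def)
  then have "pm_lookup ` {\<alpha> :: 'n \<Rightarrow>\<^sub>0 nat. multidegree \<alpha> \<le> m} \<subseteq> PiE UNIV (\<lambda>_. {..m})" by auto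
  moreover have "finite (PiE UNIV (\<lambda>_ :: 'n. {..m}))" by (rule finite_PiE) auto
  ultimately show "finite (pm_lookup ` {\<alpha> :: 'n \<Rightarrow>\<^sub>0 nat. multidegree \<alpha> \<le> m})" by (rule finite_subset)
  show "inj_on pm_lookup {\<alpha> :: 'n \<Rightarrow>\<^sub>0 nat. multidegree \<alpha> \<le> m}"
    by (rule inj_onI) (simp add: poly_mapping_eqI)
qed

lemma lookup_var_mult:
  fixes c :: "('n \<Rightarrow>\<^sub>0 nat) \<Rightarrow>\<^sub>0 'k::comm_ring_1"
  shows "pm_lookup (pm_single (pm_single i 1) 1 * c) \<gamma> = (if pm_lookup \<gamma> i = 0 then 0 else pm_lookup c (\<gamma> - pm_single i 1))"
proof (induction c rule: pm_add_induct)
  case (single k d)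
  have "pm_single i 1 + k = \<gamma> \<longleftrightarrow> pm_lookup \<gamma> i \<noteq> 0 \<and> k = \<gamma> - pm_single i 1"
  proof
    assume "pm_single i 1 + k = \<gamma>"
    then show "pm_lookup \<gamma> i \<noteq> 0 \<and> k = \<gamma> - pm_single i 1"
      by (auto simp: lookup_add lookup_single)
  next
    assume "pm_lookup \<gamma> i \<noteq> 0 \<and> k = \<gamma> - pm_single i 1"
    then show "pm_single i 1 + k = \<gamma>"
      by (intro poly_mapping_eqI) (auto simp: lookup_add lookup_minus lookup_single when_def)
  qed
  then show ?case by (auto simp: mult_single lookup_single when_def)
qed (simp_all add: distrib_left lookup_add)

lemma lookup_coeff_mult:
  fixes m :: "('n \<Rightarrow>\<^sub>0 nat) \<Rightarrow>\<^sub>0 'k::comm_ring_1"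
  shows "pm_lookup (pm_single 0 c * m) \<gamma> = c * pm_lookup m \<gamma>"
  by (induction m rule: pm_add_induct) (simp_all add: mult_single lookup_single when_def distrib_left lookup_add)

lemma multidegree_minus: "pm_lookup \<gamma> i \<noteq> 0 \<Longrightarrow> multidegree \<gamma> = Suc (multidegree (\<gamma> - pm_single i 1))"
proof -
  assume "pm_lookup \<gamma> i \<noteq> 0"
  then have "\<gamma> = (\<gamma> - pm_single i 1) + pm_single i 1"
    by (intro poly_mapping_eqI) (auto simp: lookup_add lookup_minus lookup_single when_def)
  then show ?thesis using multidegree_step by metis
qed

lemma lookup_gen:
  fixes c :: "('n::{finite,linorder} \<Rightarrow>\<^sub>0 nat) \<Rightarrow>\<^sub>0 'n mero fps"
  shows "fps_nth (pm_lookup (ore_gen hbar_deriv i c) \<gamma>) k =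
   (if pm_lookup \<gamma> i = 0 then 0 else fps_nth (pm_lookup c (\<gamma> - pm_single i 1)) k) +
   (if k = 0 then 0 else mero_deriv i (fps_nth (pm_lookup c \<gamma>) (k - 1)))"
  unfolding ore_gen_def lookup_add lookup_var_mult hbar.lookup_map_D by (simp add: hbar_deriv_nth)

text \<open>Every factor \<open>p_hat i\<close> either raises the degree by one or differentiates at the cost of one power of \<open>\<hbar>\<close>.\<close>

lemma monom_filtration:
  "multidegree \<alpha> > multidegree \<gamma> + k \<Longrightarrow> fps_nth (pm_lookup (ore_monom hbar_deriv \<alpha> b) \<gamma>) k = 0"
proof (induction \<alpha> arbitrary: \<gamma> k rule: multiidx_induct)
  case zero
  then show ?case by (simp add: multidegree_def)
next
  case (step \<alpha> i)
  have deg: "multidegree \<gamma> + k < Suc (multidegree \<alpha>)"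
    using step.prems unfolding multidegree_step .
  have "fps_nth (pm_lookup (ore_monom hbar_deriv \<alpha> b) (\<gamma> - pm_single i 1)) k = 0" if "pm_lookup \<gamma> i \<noteq> 0"
    by (rule step.IH) (use deg multidegree_minus[OF that] in linarith)
  moreover have "fps_nth (pm_lookup (ore_monom hbar_deriv \<alpha> b) \<gamma>) (k - 1) = 0" if "k \<noteq> 0"
    by (rule step.IH) (use deg that in linarith)
  ultimately show ?case unfolding hbar.monom_step lookup_gen by auto
qed

text \<open>The degrees in the momenta of the members of a family need not be bounded, so the number of terms in a product could
  depend on the parameter. By \<open>monom_filtration\<close> a single coefficient is nevertheless a sum over a finite index set that
  does not depend on the factors; this is what makes products of regular families regular.\<close>

lemma lookup_ore_mult:
  fixes a b :: "('n::{finite,linorder} \<Rightarrow>\<^sub>0 nat) \<Rightarrow>\<^sub>0 'n mero fps"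
  shows "fps_nth (pm_lookup (ore_mult hbar_deriv a b) \<gamma>) k =
    (\<Sum>\<alpha>\<in>{\<alpha>. multidegree \<alpha> \<le> multidegree \<gamma> + k}. \<Sum>i=0..k.
       fps_nth (pm_lookup a \<alpha>) i * fps_nth (pm_lookup (ore_monom hbar_deriv \<alpha> b) \<gamma>) (k - i))"
    (is "_ = sum ?t ?B")
proof -
  have "fps_nth (pm_lookup (ore_mult hbar_deriv a b) \<gamma>) k = sum ?t (pm_keys a)"
    by (simp add: ore_mult_def lookup_sum lookup_coeff_mult fps_sum_nth fps_mult_nth)
  also have "\<dots> = sum ?t (pm_keys a \<union> ?B)"
    by (rule sum.mono_neutral_left) (auto simp: finite_multidegree in_keys_iff)
  also have "\<dots> = sum ?t ?B"
  proof (rule sum.mono_neutral_right)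
    show "\<forall>\<alpha>\<in>(pm_keys a \<union> ?B) - ?B. ?t \<alpha> = 0"
    proof (intro ballI sum.neutral)
      fix \<alpha> i assume "\<alpha> \<in> (pm_keys a \<union> ?B) - ?B"
      then have "multidegree \<gamma> + (k - i) < multidegree \<alpha>" by auto
      then show "fps_nth (pm_lookup a \<alpha>) i * fps_nth (pm_lookup (ore_monom hbar_deriv \<alpha> b) \<gamma>) (k - i) = 0"
        by (simp add: monom_filtration)
    qed
  qed (auto simp: finite_multidegree)
  finally show ?thesis .
qed

definition regular_symbol :: "(complex^('n::{finite,linorder})) set \<Rightarrow> (complex^('n::{finite,linorder}) \<Rightarrow> ('n \<Rightarrow>\<^sub>0 nat) \<Rightarrow>\<^sub>0 'n mero fps) \<Rightarrow> bool" where
  "regular_symbol N F \<longleftrightarrow> (\<forall>\<alpha> k. regular_family N (\<lambda>l. fps_nth (pm_lookup (F l) \<alpha>) k))"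

lemma regular_symbol_const: "regular_symbol N (\<lambda>_. c)"
  by (simp add: regular_symbol_def regular_family_const)

lemma regular_symbol_gen:
  "regular_symbol N F \<Longrightarrow> regular_symbol N (\<lambda>l. ore_gen hbar_deriv i (F l))"
  unfolding regular_symbol_def lookup_gen
  by (intro allI regular_family_add regular_family_if regular_family_const regular_family_deriv) auto

lemma regular_symbol_monom:
  "regular_symbol N F \<Longrightarrow> regular_symbol N (\<lambda>l. ore_monom hbar_deriv \<alpha> (F l))"
  by (induction \<alpha> rule: multiidx_induct) (simp_all only: hbar.monom_zero hbar.monom_step regular_symbol_gen)

lemma regular_symbol_mult:
  assumes "regular_symbol N F" "regular_symbol N G"
  shows "regular_symbol N (\<lambda>l. ore_mult hbar_deriv (F l) (G l))"
  using assms(1) regular_symbol_monom[OF assms(2)] unfolding regular_symbol_def lookup_ore_mult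
  by (auto intro!: regular_family_sum regular_family_mult)

lemma regular_crossed_iff:
  "regular_crossed N F \<longleftrightarrow> (\<forall>w s t. regular_symbol N (\<lambda>l. symbol (entry (crossed_coeff (F l) w) s t)))"
  by (simp add: regular_crossed_def regular_symbol_def)

lemma regular_crossed_const: "regular_crossed N (\<lambda>_. c)"
  by (simp add: regular_crossed_iff regular_symbol_const)

lemma regular_symbol_add: "regular_symbol N F \<Longrightarrow> regular_symbol N G \<Longrightarrow> regular_symbol N (\<lambda>l. F l + G l)"
  by (simp add: regular_symbol_def lookup_add regular_family_add)

lemma regular_symbol_sum: "(\<And>i. i \<in> A \<Longrightarrow> regular_symbol N (F i)) \<Longrightarrow> regular_symbol N (\<lambda>l. \<Sum>i\<in>A. F i l)"
  by (induction A rule: infinite_finite_induct) (auto intro: regular_symbol_const regular_symbol_add)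

lemma regular_symbol_perm:
  assumes "regular_symbol N F" shows "regular_symbol N (\<lambda>l. ore_perm w (coeff_perm w) (F l))"
  using assms unfolding regular_symbol_def lookup_ore_perm[of "coeff_perm w", OF hbar.s_zero]
  by (simp add: coeff_perm_def regular_family_perm)

lemma symbol_sum: "symbol (sum f A) = (\<Sum>x\<in>A. symbol (f x))"
  by (induction A rule: infinite_finite_induct) (simp_all add: zero_quantum.rep_eq plus_quantum.rep_eq)

lemma entry_sum: "entry (sum f A) s t = (\<Sum>x\<in>A. entry (f x) s t)"
  by (induction A rule: infinite_finite_induct) (simp_all add: zero_sqmat.rep_eq plus_sqmat.rep_eq)

lemma regular_crossed_add: "regular_crossed N F \<Longrightarrow> regular_crossed N G \<Longrightarrow> regular_crossed N (\<lambda>l. F l + G l)"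
  by (simp add: regular_crossed_iff plus_crossed.rep_eq plus_sqmat.rep_eq plus_quantum.rep_eq regular_symbol_add)

lemma regular_crossed_mult:
  assumes "regular_crossed N F" "regular_crossed N G"
  shows "regular_crossed N (\<lambda>l. F l * G l)"
  using assms unfolding regular_crossed_iff
  by (auto simp: times_crossed.rep_eq entry_sum symbol_sum times_sqmat.rep_eq times_quantum.rep_eq perm_qEnd_def perm_q.rep_eq
      intro!: regular_symbol_sum regular_symbol_mult regular_symbol_perm)

lemma regular_crossed_uminus: "regular_crossed N F \<Longrightarrow> regular_crossed N (\<lambda>l. - F l)"
  using regular_crossed_mult[OF regular_crossed_const[of N "- 1"], of F] by simp

lemma regular_crossed_diff: "regular_crossed N F \<Longrightarrow> regular_crossed N G \<Longrightarrow> regular_crossed N (\<lambda>l. F l - G l)"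
  using regular_crossed_add[OF _ regular_crossed_uminus[of N G], of F] by simp

lemma regular_crossed_sum: "(\<And>i. i \<in> A \<Longrightarrow> regular_crossed N (F i)) \<Longrightarrow> regular_crossed N (\<lambda>l. \<Sum>i\<in>A. F i l)"
  by (induction A rule: infinite_finite_induct) (auto intro: regular_crossed_const regular_crossed_add)

lemma regular_crossed_subset: "regular_crossed N F \<Longrightarrow> N' \<subseteq> N \<Longrightarrow> regular_crossed N' F"
  unfolding regular_crossed_def using regular_family_subset by blast

lemma regular_crossed_vperm: "regular_crossed N F \<Longrightarrow> regular_crossed (vperm w -` N) (\<lambda>l. F (vperm w l))"
  unfolding regular_crossed_def using regular_family_vperm by blast

lemma crossed_eq_zeroI:
  assumes "\<And>w s t \<alpha> k. fps_nth (pm_lookup (symbol (entry (crossed_coeff a w) s t)) \<alpha>) k = 0"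
  shows "a = 0"
proof (rule crossed_eqI, rule sqmat_eqI)
  fix w s t
  have "pm_lookup (symbol (entry (crossed_coeff a w) s t)) \<alpha> = 0" for \<alpha>
    by (rule fps_ext) (simp add: assms)
  then have "symbol (entry (crossed_coeff a w) s t) = symbol 0"
    by (intro poly_mapping_eqI) (simp add: zero_quantum.rep_eq)
  then show "entry (crossed_coeff a w) s t = entry (crossed_coeff 0 w) s t"
    by (simp add: symbol_inject zero_crossed.rep_eq zero_sqmat.rep_eq)
qed

lemma regular_crossed_limit:
  assumes "regular_crossed N F" "\<And>l. l \<in> N \<Longrightarrow> l \<in> G \<Longrightarrow> F l = 0" "open N" "closure G = UNIV" "l0 \<in> N"
  shows "F l0 = 0"
proof (rule crossed_eq_zeroI, rule regular_family_limit[OF _ _ assms(3-5)])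
  fix w s t \<alpha> k
  show "regular_family N (\<lambda>l. fps_nth (pm_lookup (symbol (entry (crossed_coeff (F l) w) s t)) \<alpha>) k)"
    using assms(1) by (simp add: regular_crossed_def)
  show "fps_nth (pm_lookup (symbol (entry (crossed_coeff (F l) w) s t)) \<alpha>) k = 0" if "l \<in> N" "l \<in> G" for l
    using assms(2)[OF that] by (simp add: zero_crossed.rep_eq zero_sqmat.rep_eq zero_quantum.rep_eq)
qed

section \<open>The Dunkl operators as a regular family\<close>

text \<open>The coefficient is a quotient of functions holomorphic in \<open>(x, \<lambda>)\<close> jointly, and the condition on \<open>N\<close> keeps the part of the
  denominator that depends on \<open>\<lambda>\<close> away from zero.\<close>

lemma R_coeff_regular:
  fixes i j :: "'n::finite"
  assumes tau: "Im \<tau> > 0" and d: "d > 0" and ij: "i \<noteq> j"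
    and N: "\<And>l. l \<in> N \<Longrightarrow> theta_regular \<tau> d (l $ i - l $ j)"
  shows "regular_family N (\<lambda>l. abs_mero (\<lambda>x. R_coeff \<tau> d \<alpha> \<beta> \<gamma> \<delta> (x $ i - x $ j) (l $ i - l $ j)))"
proof (cases "(\<alpha> + \<gamma>) mod int d = (\<beta> + \<delta>) mod int d")
  case True
  define T where "T = of_nat d * \<tau>"
  have T: "Im T > 0" using tau d by (simp add: T_def)
  define m where "m = of_int (\<gamma> - \<beta>) * \<tau>"
  define n where "n = of_int (\<beta> - \<alpha>) * \<tau>"
  let ?X = "\<lambda>z :: complex^('n + 'n). z $ Inl i - z $ Inl j"
  let ?L = "\<lambda>z :: complex^('n + 'n). z $ Inr i - z $ Inr j"
  let ?\<Omega> = "{z. theta (?X z + m) T * theta (?L z + n) T \<noteq> 0}"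
  have X: "?X mholo_on UNIV" and L: "?L mholo_on UNIV"
    by (intro mholo_diff mholo_coord; simp)+
  have t: "(\<lambda>z. theta (?X z + m) T) mholo_on UNIV" "(\<lambda>z. theta (?L z + n) T) mholo_on UNIV"
    by (rule mholo_comp[OF X theta_shift_holomorphic[OF T]] mholo_comp[OF L theta_shift_holomorphic[OF T]])+
  have o: "open ?\<Omega>" using mholo_nonzero_open[OF mholo_mult[OF t]] by simp
  let ?e = "\<lambda>z. exp (2 * pi * \<i> / of_nat d * (of_int ((\<gamma> - \<beta>) * (\<beta> - \<alpha>)) * \<tau> + of_int (\<gamma> - \<beta>) * ?L z + of_int (\<beta> - \<alpha>) * ?X z))"
  let ?f = "\<lambda>z. ?e z * (deriv (\<lambda>z. theta z T) 0 * theta (?X z + m + (?L z + n)) T / (theta (?X z + m) T * theta (?L z + n) T))"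
  obtain c where c: "theta (c + m) T \<noteq> 0" using theta_shift_nonzero[OF T] by blast
  show ?thesis
  proof (rule regular_familyI[where \<Omega> = ?\<Omega> and f = ?f])
    have m: "UNIV \<supseteq> ?\<Omega>" by simp
    have exp: "exp holomorphic_on (UNIV :: complex set)" by (intro holomorphic_intros)
    have "?f mholo_on ?\<Omega>"
    proof (rule mholo_mult[OF mholo_on_subset[OF mholo_comp[OF _ exp] o m] mholo_divide])
      show "(\<lambda>z. 2 * pi * \<i> / of_nat d * (of_int ((\<gamma> - \<beta>) * (\<beta> - \<alpha>)) * \<tau> + of_int (\<gamma> - \<beta>) * ?L z + of_int (\<beta> - \<alpha>) * ?X z)) mholo_on UNIV"
        by (intro mholo_mult mholo_add mholo_const X L open_UNIV)
      have XL: "(\<lambda>z. ?X z + m + (?L z + n)) mholo_on UNIV"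
        by (intro mholo_add mholo_const X L open_UNIV)
      show "(\<lambda>z. deriv (\<lambda>z. theta z T) 0 * theta (?X z + m + (?L z + n)) T) mholo_on ?\<Omega>"
        by (rule mholo_on_subset[OF mholo_mult[OF mholo_const[OF open_UNIV] mholo_comp[OF XL theta_holomorphic[OF T]]] o m])
      show "(\<lambda>z. theta (?X z + m) T * theta (?L z + n) T) mholo_on ?\<Omega>"
        by (rule mholo_on_subset[OF mholo_mult[OF t] o m])
    qed auto
    then show "?f mholo_on ?\<Omega>" .
    fix l assume l: "l \<in> N"
    then have nz: "theta (l $ i - l $ j + n) T \<noteq> 0"
      using N unfolding theta_regular_def T_def n_def by blast
    show "closure {x. joint x l \<in> ?\<Omega>} = UNIV"
      using dense_nonzero[OF theta_shift_holomorphic[OF T] c ij] nz by simp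
    show "meromorphic_fun (\<lambda>x :: complex^'n. R_coeff \<tau> d \<alpha> \<beta> \<gamma> \<delta> (x $ i - x $ j) (l $ i - l $ j))"
      by (rule R_coeff_meromorphic[OF tau d ij])
    show "R_coeff \<tau> d \<alpha> \<beta> \<gamma> \<delta> (x $ i - x $ j) (l $ i - l $ j) = ?f (joint x l)" for x
      unfolding R_coeff_def phi_def if_P[OF True] m_def n_def T_def joint_nth ..
  qed simp
next
  case False
  then show ?thesis by (simp add: R_coeff_def regular_family_const)
qed

lemma fun_q_symbol: "fps_nth (pm_lookup (symbol (fun_q f)) \<alpha>) k = (if \<alpha> = 0 \<and> k = 0 then f else 0)"
  by (auto simp: fun_q_def symbol_coeff_q lookup_single when_def)

lemma R_op_regular:
  fixes i j :: "'n::{finite,linorder}"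
  assumes tau: "Im \<tau> > 0" and ij: "i \<noteq> j"
    and N: "\<And>l. l \<in> N \<Longrightarrow> theta_regular \<tau> CARD('d::{finite,linorder}) (l $ i - l $ j)"
  shows "regular_crossed N (\<lambda>l. emb (R_op \<tau> i j (l $ i - l $ j)) :: ('n, 'd) crossed)"
  unfolding regular_crossed_def
proof (intro allI)
  fix w and s t :: "'n \<Rightarrow> 'd" and \<alpha> :: "'n \<Rightarrow>\<^sub>0 nat" and k :: nat
  let ?R = "\<lambda>l. abs_mero (\<lambda>x. R_coeff \<tau> CARD('d) (pos (s i)) (pos (t i)) (pos (s j)) (pos (t j)) (x $ i - x $ j) (l $ i - l $ j))"
  have "CARD('d) > 0" by simp
  from R_coeff_regular[OF tau this ij N]
  have R: "regular_family N ?R" .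
  have "fps_nth (pm_lookup (symbol (entry (crossed_coeff (emb (R_op \<tau> i j (l $ i - l $ j)) :: ('n, 'd) crossed) w) s t)) \<alpha>) k =
     (if w = 1 \<and> (\<forall>k. k \<noteq> i \<and> k \<noteq> j \<longrightarrow> s k = t k) \<and> \<alpha> = 0 \<and> k = 0 then ?R l else 0)" for l
    by (auto simp: coeff_emb R_op_def fun_q_symbol zero_sqmat.rep_eq zero_quantum.rep_eq)
  then show "regular_family N (\<lambda>l. fps_nth (pm_lookup (symbol (entry (crossed_coeff (emb (R_op \<tau> i j (l $ i - l $ j)) :: ('n, 'd) crossed) w) s t)) \<alpha>) k)"
    using R by (simp only:) (intro regular_family_if regular_family_const)
qed

lemma dunkl_regular:
  fixes i :: "'n::{finite,linorder}"
  assumes tau: "Im \<tau> > 0"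
    and N: "\<And>l j. l \<in> N \<Longrightarrow> j \<noteq> i \<Longrightarrow> theta_regular \<tau> CARD('d::{finite,linorder}) (l $ i - l $ j)"
  shows "regular_crossed N (\<lambda>l. dunkl \<tau> g l i :: ('n, 'd) crossed)"
  unfolding dunkl_def
  by (intro regular_crossed_diff regular_crossed_mult regular_crossed_sum regular_crossed_const R_op_regular[OF tau])
    (use N in auto)

section \<open>Generic spectral parameters\<close>

lemma theta_period_one: "theta (z + 1) \<tau> = - theta z \<tau>"
proof -
  have "theta_term \<tau> (z + 1 + 1/2) (of_int k + of_real (1/2)) = - theta_term \<tau> (z + 1/2) (of_int k + of_real (1/2))" for k :: int
  proof -
    have "theta_term \<tau> (z + 1 + 1/2) (of_int k + of_real (1/2)) =
       theta_term \<tau> (z + 1/2) (of_int k + of_real (1/2)) * exp (2 * pi * \<i> * of_int k + pi * \<i>)"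
      unfolding theta_term_def exp_add[symmetric] by (rule arg_cong[of _ _ exp]) (simp add: algebra_simps)
    then show ?thesis unfolding exp_add exp_two_pi_int by simp
  qed
  then show ?thesis by (simp only: theta_eq theta_char_def infsum_uminus)
qed

text \<open>The odd function theta vanishes at 0, hence at every lattice point by quasi-periodicity.\<close>

lemma theta_regular_imp_not_lattice:
  assumes "theta_regular \<tau> 1 z" shows "z \<notin> lattice \<tau>"
proof
  assume "z \<in> lattice \<tau>"
  then obtain m k where z: "z = of_int m + of_int k * \<tau>" by (auto simp: lattice_def)
  have "(theta (0 + of_int m * 1) \<tau> = 0) = (theta 0 \<tau> = 0)"
    by (rule int_periodic[where f = "\<lambda>w. theta w \<tau> = 0"]) (simp add: theta_period_one)
  moreover have "theta 0 \<tau> = 0" using theta_odd[of 0 \<tau>] by simp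
  ultimately have "theta (z + of_int (- k) * \<tau>) (of_nat 1 * \<tau>) = 0" by (simp add: z)
  with assms show False unfolding theta_regular_def by blast
qed

lemma theta_regular_punctured_neighbourhood:
  assumes tau: "Im \<tau> > 0" and d: "d > 0"
  shows "\<forall>\<^sub>F \<mu> in at 0. theta_regular \<tau> d \<mu>"
  unfolding theta_regular_finite[OF d]
proof (rule eventually_ball_finite, simp, rule ballI)
  fix m :: int
  have T: "Im (of_nat d * \<tau>) > 0" using tau d by simp
  obtain c where c: "theta (c + of_int m * \<tau>) (of_nat d * \<tau>) \<noteq> 0" using theta_shift_nonzero[OF T] by blast
  have "\<forall>\<^sub>F w in at 0. theta (w + of_int m * \<tau>) (of_nat d * \<tau>) \<noteq> 0 \<and> w \<in> UNIV"
    by (rule non_zero_neighbour_alt[OF theta_shift_holomorphic[OF T] open_UNIV connected_UNIV _ _ c]) auto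
  then show "\<forall>\<^sub>F \<mu> in at 0. theta (\<mu> + of_int m * \<tau>) (of_nat d * \<tau>) \<noteq> 0" by simp
qed


section \<open>Matrices of elements that commute with the stabiliser of the first index\<close>

text \<open>The defining relation of the matrix of an element. As a relation it can be transported through sums and products
  before existence and uniqueness of the matrix come into play.\<close>

definition represents :: "('n::{finite,linorder}, 'd::finite) crossed \<Rightarrow> (('n, 'd) qEnd, 'n) sqmat \<Rightarrow> bool" where
  "represents a A \<longleftrightarrow> (\<forall>i. a * e_prime * hat \<langle>first \<leftrightarrow> i\<rangle> =
     (\<Sum>j\<in>UNIV. e_prime * hat \<langle>first \<leftrightarrow> j\<rangle> * emb (entry A j i)))"

lemma W_prime_mult: "u \<in> W_prime \<Longrightarrow> v \<in> W_prime \<Longrightarrow> u * v \<in> W_prime"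
  by (simp add: W_prime_def apply_times)

lemma W_prime_inverse: "u \<in> W_prime \<Longrightarrow> inverse u \<in> W_prime"
  unfolding W_prime_def mem_Collect_eq by (metis perm_inv_apply(1))

lemma e_prime_mult_hat:
  fixes w :: "'n::{finite,linorder} perm"
  assumes "w \<in> W_prime" shows "(e_prime :: ('n, 'd::finite) crossed) * hat w = e_prime"
proof -
  have "bij_betw (\<lambda>v. v * w) W_prime W_prime"
    by (rule bij_betw_byWitness[where f' = "\<lambda>v. v * inverse w"])
      (use assms W_prime_mult W_prime_inverse in \<open>auto simp: mult.assoc\<close>)
  from sum.reindex_bij_betw[OF this, of "hat :: _ \<Rightarrow> ('n, 'd) crossed"]
  have "(\<Sum>v\<in>W_prime. hat v) * hat w = (\<Sum>v\<in>W_prime. hat v :: ('n, 'd) crossed)"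
    by (simp add: sum_distrib_right hat_mult)
  then show ?thesis by (simp add: e_prime_def mult.assoc)
qed

lemma swap_involution: "\<langle>i \<leftrightarrow> j\<rangle> * \<langle>i \<leftrightarrow> j\<rangle> = 1"
  by (rule perm_eqI) (auto simp: apply_times apply_swap)

text \<open>The right coset of \<open>w\<close> modulo the stabiliser of the first index is determined by the preimage of that index.\<close>

lemma e_prime_hat_coset:
  fixes w :: "'n::{finite,linorder} perm"
  shows "(e_prime :: ('n, 'd::finite) crossed) * hat w = e_prime * hat \<langle>first \<leftrightarrow> inverse w \<langle>$\<rangle> first\<rangle>"
proof -
  let ?s = "\<langle>first \<leftrightarrow> inverse w \<langle>$\<rangle> first\<rangle>"
  have s: "w * ?s \<in> W_prime" by (simp add: W_prime_def apply_times)
  have "hat w = (hat (w * ?s) * hat ?s :: ('n, 'd) crossed)"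
    by (simp add: hat_mult mult.assoc swap_involution)
  then show ?thesis using e_prime_mult_hat[OF s, where 'd = 'd] by (simp only: mult.assoc[symmetric])
qed

lemma emb_sum: "emb (sum f A) = (\<Sum>x\<in>A. emb (f x))"
  by (induction A rule: infinite_finite_induct) (simp_all add: emb_zero emb_add[symmetric])

lemma e_prime_span:
  fixes X :: "('n::{finite,linorder}, 'd::finite) crossed"
  shows "\<exists>B. e_prime * X = (\<Sum>j\<in>UNIV. e_prime * hat \<langle>first \<leftrightarrow> j\<rangle> * emb (B j))"
proof -
  let ?x = "\<lambda>w. perm_qEnd (inverse w) (crossed_coeff X w)"
  let ?j = "\<lambda>w :: 'n perm. inverse w \<langle>$\<rangle> first"
  have "emb (crossed_coeff X w) * hat w = hat w * emb (?x w)" for w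
    by (simp add: hat_emb perm_qEnd_times[symmetric] perm_qEnd_id)
  then have "e_prime * X = (\<Sum>w\<in>UNIV. (e_prime * hat w) * emb (?x w))"
    by (subst crossed_expand[of X]) (simp add: sum_distrib_left mult.assoc)
  also have "\<dots> = (\<Sum>w\<in>UNIV. e_prime * hat \<langle>first \<leftrightarrow> ?j w\<rangle> * emb (?x w))"
    by (simp only: e_prime_hat_coset[symmetric])
  also have "\<dots> = (\<Sum>j\<in>UNIV. \<Sum>w\<in>{w \<in> UNIV. ?j w = j}. e_prime * hat \<langle>first \<leftrightarrow> ?j w\<rangle> * emb (?x w))"
    by (rule sum.group[symmetric]) auto
  also have "\<dots> = (\<Sum>j\<in>UNIV. e_prime * hat \<langle>first \<leftrightarrow> j\<rangle> * emb (\<Sum>w\<in>{w \<in> UNIV. ?j w = j}. ?x w))"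
  proof (rule sum.cong[OF refl])
    fix j
    show "(\<Sum>w\<in>{w \<in> UNIV. ?j w = j}. e_prime * hat \<langle>first \<leftrightarrow> ?j w\<rangle> * emb (?x w)) =
        e_prime * hat \<langle>first \<leftrightarrow> j\<rangle> * emb (\<Sum>w\<in>{w \<in> UNIV. ?j w = j}. ?x w)"
      unfolding emb_sum sum_distrib_left by (rule sum.cong) auto
  qed
  finally show ?thesis by (rule exI[where x = "\<lambda>j. \<Sum>w\<in>{w \<in> UNIV. ?j w = j}. ?x w"])
qed

lemma const_q_mult: "const_q a * const_q b = (const_q (a * b) :: 'n::{finite,linorder} quantum)"
proof -
  have "mero_const a * mero_const b = (mero_const (a * b) :: 'n mero)"
    by transfer (simp add: mero_eq_refl meromorphic_const)
  then show ?thesis by (simp add: const_q_def fun_q_mult)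
qed

lemma const_q_one: "const_q 1 = (1 :: 'n::{finite,linorder} quantum)"
proof -
  have "mero_const 1 = (1 :: 'n mero)" by transfer (simp add: mero_eq_refl meromorphic_const)
  then show ?thesis
    by (intro quantum_eqI) (simp add: const_q_def fun_q_def symbol_coeff_q one_quantum.rep_eq)
qed

lemma coeff_e_prime:
  "crossed_coeff (e_prime :: ('n::{finite,linorder}, 'd::finite) crossed) w =
     (if w \<in> W_prime then scalar_mat (const_q (1 / fact (CARD('n) - 1))) else 0)"
  by (simp add: e_prime_def scal_def coeff_emb_mult coeff_sum coeff_hat)

lemma left_inverse_cancel:
  fixes u v x y :: "'a::monoid_mult"
  shows "u * v = 1 \<Longrightarrow> v * x = v * y \<Longrightarrow> x = y"
  by (metis mult.assoc mult_1_left)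

text \<open>The transposition of the first index and \<open>j\<close> lies in one coset only, so the coefficient at this transposition isolates \<open>B j\<close>,
  up to a permutation and the invertible factor \<open>1 / (n - 1)!\<close>.\<close>

lemma e_prime_basis_unique:
  fixes B C :: "'n::{finite,linorder} \<Rightarrow> ('n, 'd::finite) qEnd"
  assumes "(\<Sum>j\<in>UNIV. e_prime * hat \<langle>first \<leftrightarrow> j\<rangle> * emb (B j)) = (\<Sum>j\<in>UNIV. e_prime * hat \<langle>first \<leftrightarrow> j\<rangle> * emb (C j))"
  shows "B j = C j"
proof -
  let ?c = "1 / fact (CARD('n) - 1) :: complex"
  let ?s = "\<langle>first \<leftrightarrow> j\<rangle> :: 'n perm"
  have c: "crossed_coeff (\<Sum>k\<in>UNIV. e_prime * hat \<langle>first \<leftrightarrow> k\<rangle> * emb (B k)) ?s = scalar_mat (const_q ?c) * perm_qEnd ?s (B j)"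
    for B :: "'n \<Rightarrow> ('n, 'd) qEnd"
  proof -
    have "?s * inverse \<langle>first \<leftrightarrow> k\<rangle> \<in> W_prime \<longleftrightarrow> k = j" for k
      by (auto simp: W_prime_def apply_times apply_swap)
    then have "crossed_coeff (\<Sum>k\<in>UNIV. e_prime * hat \<langle>first \<leftrightarrow> k\<rangle> * emb (B k)) ?s =
        (\<Sum>k\<in>UNIV. (if k = j then scalar_mat (const_q ?c) else 0) * perm_qEnd ?s (B k))"
      by (simp only: coeff_sum coeff_mult_emb coeff_mult_hat coeff_e_prime)
    also have "\<dots> = scalar_mat (const_q ?c) * perm_qEnd ?s (B j)"
      by (rule sum_UNIV_eq[where c = j]) auto
    finally show ?thesis .
  qed
  have "scalar_mat (const_q (fact (CARD('n) - 1))) * scalar_mat (const_q ?c) = (1 :: ('n, 'd) qEnd)"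
    by (simp add: scalar_mat_mult const_q_mult const_q_one scalar_mat_one)
  moreover have "scalar_mat (const_q ?c) * perm_qEnd ?s (B j) = scalar_mat (const_q ?c) * perm_qEnd ?s (C j)"
    using c[of B] c[of C] assms by simp
  ultimately have "perm_qEnd ?s (B j) = perm_qEnd ?s (C j)"
    by (rule left_inverse_cancel)
  then have "perm_qEnd (inverse ?s) (perm_qEnd ?s (B j)) = perm_qEnd (inverse ?s) (perm_qEnd ?s (C j))" by simp
  then show ?thesis by (simp only: perm_qEnd_times[symmetric] perm.left_inverse perm_qEnd_id)
qed

lemma represents_unique: "represents a A \<Longrightarrow> represents a B \<Longrightarrow> A = B"
proof (rule sqmat_eqI)
  fix j i assume "represents a A" "represents a B"
  then have "(\<Sum>j\<in>UNIV. e_prime * hat \<langle>first \<leftrightarrow> j\<rangle> * emb (entry A j i)) = (\<Sum>j\<in>UNIV. e_prime * hat \<langle>first \<leftrightarrow> j\<rangle> * emb (entry B j i))"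
    unfolding represents_def by metis
  then show "entry A j i = entry B j i" by (rule e_prime_basis_unique)
qed

lemma rep_matrix_eqI: "represents a A \<Longrightarrow> rep_matrix a = A"
  unfolding rep_matrix_def represents_def[symmetric]
  by (rule the_equality) (auto intro: represents_unique)

lemma e_prime_commute:
  assumes "\<And>w. w \<in> W_prime \<Longrightarrow> hat w * a = a * hat w"
  shows "a * e_prime = e_prime * a"
proof -
  have "a * (\<Sum>w\<in>W_prime. hat w) = (\<Sum>w\<in>W_prime. hat w) * a"
    unfolding sum_distrib_left sum_distrib_right by (rule sum.cong[OF refl]) (simp add: assms)
  then show ?thesis by (simp only: e_prime_def scal_const_left_commute mult.assoc)
qed

lemma represents_rep_matrix:
  assumes "\<And>w. w \<in> W_prime \<Longrightarrow> hat w * a = a * hat w"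
  shows "represents a (rep_matrix a)"
proof -
  have "\<exists>B. e_prime * (a * hat \<langle>first \<leftrightarrow> i\<rangle>) = (\<Sum>j\<in>UNIV. e_prime * hat \<langle>first \<leftrightarrow> j\<rangle> * emb (B j))" for i
    by (rule e_prime_span)
  then obtain B where "\<And>i. e_prime * (a * hat \<langle>first \<leftrightarrow> i\<rangle>) = (\<Sum>j\<in>UNIV. e_prime * hat \<langle>first \<leftrightarrow> j\<rangle> * emb (B i j))"
    by metis
  then have "represents a (Sqmat (\<lambda>j i. B i j))"
    by (simp add: represents_def e_prime_commute[OF assms] mult.assoc)
  then show ?thesis using rep_matrix_eqI by metis
qed

lemma represents_mult:
  assumes a: "represents a A" and b: "represents b B"
  shows "represents (a * b) (A * B)"
  unfolding represents_def
proof
  fix i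
  have "a * b * e_prime * hat \<langle>first \<leftrightarrow> i\<rangle> = a * (b * e_prime * hat \<langle>first \<leftrightarrow> i\<rangle>)" by (simp add: mult.assoc)
  also have "\<dots> = (\<Sum>j\<in>UNIV. a * e_prime * hat \<langle>first \<leftrightarrow> j\<rangle> * emb (entry B j i))"
    using b by (simp add: represents_def sum_distrib_left mult.assoc)
  also have "\<dots> = (\<Sum>j\<in>UNIV. \<Sum>k\<in>UNIV. e_prime * hat \<langle>first \<leftrightarrow> k\<rangle> * emb (entry A k j * entry B j i))"
    using a by (simp add: represents_def sum_distrib_right mult.assoc emb_mult)
  also have "\<dots> = (\<Sum>k\<in>UNIV. \<Sum>j\<in>UNIV. e_prime * hat \<langle>first \<leftrightarrow> k\<rangle> * emb (entry A k j * entry B j i))"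
    by (rule sum.swap)
  also have "\<dots> = (\<Sum>k\<in>UNIV. e_prime * hat \<langle>first \<leftrightarrow> k\<rangle> * emb (entry (A * B) k i))"
    by (simp add: times_sqmat.rep_eq emb_sum sum_distrib_left)
  finally show "a * b * e_prime * hat \<langle>first \<leftrightarrow> i\<rangle> = (\<Sum>k\<in>UNIV. e_prime * hat \<langle>first \<leftrightarrow> k\<rangle> * emb (entry (A * B) k i))" .
qed

lemma represents_add:
  assumes "represents a A" "represents b B" shows "represents (a + b) (A + B)"
  using assms by (simp add: represents_def distrib_left distrib_right plus_sqmat.rep_eq emb_add[symmetric] sum.distrib)

lemma represents_scal:
  fixes c :: "'n::{finite,linorder} quantum"
  assumes "\<And>w. perm_q w c = c"
  shows "represents (scal c :: ('n, 'd::finite) crossed) (scalar_mat (scalar_mat c))"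
  unfolding represents_def
proof
  fix i :: 'n
  have h: "hat w * scal c = scal c * (hat w :: ('n, 'd) crossed)" for w by (simp add: hat_scal assms)
  have "(\<Sum>j\<in>UNIV. e_prime * hat \<langle>first \<leftrightarrow> j\<rangle> * emb (entry (scalar_mat (scalar_mat c)) j i)) =
     e_prime * hat \<langle>first \<leftrightarrow> i\<rangle> * (scal c :: ('n, 'd) crossed)"
    by (rule sum_UNIV_eq[where c = i]) (auto simp: scalar_mat_def emb_zero scal_def)
  also have "\<dots> = scal c * e_prime * hat \<langle>first \<leftrightarrow> i\<rangle>"
    using e_prime_commute[of "scal c :: ('n, 'd) crossed", OF h] by (simp only: mult.assoc h)
  finally show "scal c * e_prime * hat \<langle>first \<leftrightarrow> i\<rangle> = (\<Sum>j\<in>UNIV. e_prime * hat \<langle>first \<leftrightarrow> j\<rangle> * emb (entry (scalar_mat (scalar_mat c) :: (('n, 'd) qEnd, 'n) sqmat) j i))" ..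
qed

lemma vperm_special_point:
  assumes "w \<in> W_prime" shows "vperm w (special_point \<mu>) = special_point \<mu>"
proof -
  have "inverse w \<langle>$\<rangle> i = first \<longleftrightarrow> i = first" for i
    using assms unfolding W_prime_def mem_Collect_eq by (metis perm_inv_apply)
  then show ?thesis by (simp add: vec_eq_iff vperm_def special_point_def)
qed

lemma hat_dunkl_special_point:
  fixes w :: "'n::{finite,linorder} perm"
  assumes "Im \<tau> > 0" "w \<in> W_prime"
  shows "hat w * dunkl \<tau> g (special_point \<mu>) first = dunkl \<tau> g (special_point \<mu>) first * (hat w :: ('n, 'd::{finite,linorder}) crossed)"
  using hat_dunkl[OF assms(1), of w g "special_point \<mu>" first] vperm_special_point[OF assms(2)] assms(2)
  by (simp add: W_prime_def)

text \<open>Since \<open>y\<^sub>1\<close> commutes with \<open>e'\<close>, it acts on the basis through \<open>e' y\<^sub>1 s\<^sub>1\<^sub>i\<close>. Moving the R-matrix through \<open>s\<^sub>1\<^sub>j s\<^sub>1\<^sub>i\<close>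
  replaces its sites \<open>1, j\<close> by \<open>k, i\<close>, with \<open>k = s\<^sub>1\<^sub>i(j)\<close>, and \<open>e' s\<^sub>1\<^sub>j s\<^sub>1\<^sub>i = e' s\<^sub>1\<^sub>k\<close>. As \<open>j\<close> runs through the indices
  other than 1, \<open>k\<close> runs through those other than \<open>i\<close>.\<close>

lemma represents_dunkl:
  assumes tau: "Im \<tau> > 0"
  shows "represents (dunkl \<tau> g (special_point \<mu>) first :: ('n::{finite,linorder}, 'd::{finite,linorder}) crossed)
     (Sqmat (\<lambda>i j. if i = j then scalar_mat (p_hat i) else - (scalar_mat (const_q g) * R_op \<tau> i j \<mu>)))"
    (is "represents ?y ?L")
  unfolding represents_def
proof
  fix i :: 'n
  let ?e = "e_prime :: ('n, 'd) crossed"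
  let ?s = "\<lambda>j :: 'n. \<langle>first \<leftrightarrow> j\<rangle>"
  let ?G = "scal (const_q g) :: ('n, 'd) crossed"
  have y: "?y = scal (p_hat first) - ?G * (\<Sum>j\<in>UNIV - {first}. emb (R_op \<tau> first j \<mu>) * hat (?s j))"
    unfolding dunkl_def special_point_def by (intro arg_cong2[of _ _ _ _ "(-)"] refl arg_cong2[of _ _ _ _ "(*)"] sum.cong) auto
  have 1: "?e * (scal (p_hat first) * hat (?s i)) = ?e * hat (?s i) * emb (scalar_mat (p_hat i))"
    using hat_scal[of "?s i" "p_hat i", where 'b = 'd] by (simp add: perm_q_p_hat apply_swap scal_def mult.assoc)
  have 2: "?e * (emb (R_op \<tau> first j \<mu>) * hat (?s j) * hat (?s i)) =
      ?e * hat (?s (?s i \<langle>$\<rangle> j)) * emb (R_op \<tau> (?s i \<langle>$\<rangle> j) i \<mu>)" if j: "j \<noteq> first" for j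
  proof -
    let ?w = "?s j * ?s i" and ?k = "?s i \<langle>$\<rangle> j"
    have ki: "?k \<noteq> i" using j by (auto simp: apply_swap)
    have w: "?w \<langle>$\<rangle> ?k = first" "?w \<langle>$\<rangle> i = j"
      using j by (auto simp: apply_times apply_swap)
    have "?e * (emb (R_op \<tau> first j \<mu>) * hat (?s j) * hat (?s i)) = ?e * (emb (R_op \<tau> first j \<mu>) * hat ?w)"
      by (simp add: hat_mult mult.assoc)
    also have "emb (R_op \<tau> first j \<mu>) * hat ?w = hat ?w * emb (R_op \<tau> ?k i \<mu>)"
      unfolding hat_emb perm_qEnd_R_op[OF tau ki] w ..
    also have "?e * (hat ?w * emb (R_op \<tau> ?k i \<mu>)) = (?e * hat ?w) * emb (R_op \<tau> ?k i \<mu>)" by (simp only: mult.assoc)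
    also have "?e * hat ?w = ?e * hat (?s ?k)"
    proof -
      have "inverse ?w \<langle>$\<rangle> first = ?k" by (metis perm_inv_apply(1) w(1))
      then show ?thesis using e_prime_hat_coset[of ?w] by simp
    qed
    finally show ?thesis .
  qed
  have bij: "bij_betw (\<lambda>j. ?s i \<langle>$\<rangle> j) (UNIV - {first}) (UNIV - {i})"
    by (rule bij_betw_byWitness[where f' = "\<lambda>j. ?s i \<langle>$\<rangle> j"]) (auto simp: apply_swap split: if_splits)
  have c: "?y * ?e = ?e * ?y" by (rule e_prime_commute) (rule hat_dunkl_special_point[OF tau])
  have "?y * ?e * hat (?s i) = ?e * (?y * hat (?s i))" unfolding c by (rule mult.assoc)
  also have "\<dots> = ?e * (scal (p_hat first) * hat (?s i)) -
      ?G * (\<Sum>j\<in>UNIV - {first}. ?e * (emb (R_op \<tau> first j \<mu>) * hat (?s j) * hat (?s i)))"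
    unfolding y by (simp only: left_diff_distrib right_diff_distrib mult.assoc scal_const_left_commute sum_distrib_left sum_distrib_right)
  also have "(\<Sum>j\<in>UNIV - {first}. ?e * (emb (R_op \<tau> first j \<mu>) * hat (?s j) * hat (?s i))) =
      (\<Sum>j\<in>UNIV - {first}. ?e * hat (?s (?s i \<langle>$\<rangle> j)) * emb (R_op \<tau> (?s i \<langle>$\<rangle> j) i \<mu>))"
    by (rule sum.cong[OF refl], rule 2) auto
  also have "\<dots> = (\<Sum>k\<in>UNIV - {i}. ?e * hat (?s k) * emb (R_op \<tau> k i \<mu>))"
    by (rule sum.reindex_bij_betw[OF bij])
  also have "?e * (scal (p_hat first) * hat (?s i)) - ?G * \<dots> =
      ?e * hat (?s i) * emb (entry ?L i i) + (\<Sum>k\<in>UNIV - {i}. ?e * hat (?s k) * emb (entry ?L k i))"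
  proof -
    have "?G * (?e * hat (?s k) * emb (R_op \<tau> k i \<mu>)) = - (?e * hat (?s k) * emb (entry ?L k i))" if "k \<in> UNIV - {i}" for k
    proof -
      have "emb (entry ?L k i) = - (?G * emb (R_op \<tau> k i \<mu>))"
        using that by (simp add: emb_uminus emb_mult[symmetric] scal_def)
      then show ?thesis by (simp only: scal_const_left_commute mult.assoc mult_minus_right minus_minus)
    qed
    then have "?G * (\<Sum>k\<in>UNIV - {i}. ?e * hat (?s k) * emb (R_op \<tau> k i \<mu>)) = (\<Sum>k\<in>UNIV - {i}. - (?e * hat (?s k) * emb (entry ?L k i)))"
      unfolding sum_distrib_left by (rule sum.cong[OF refl])
    then show ?thesis unfolding 1 by (simp only: sum_negf) simp
  qed
  also have "\<dots> = (\<Sum>k\<in>UNIV. ?e * hat (?s k) * emb (entry ?L k i))"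
    by (rule sum.remove[symmetric]) auto
  finally show "?y * ?e * hat (?s i) = (\<Sum>k\<in>UNIV. ?e * hat (?s k) * emb (entry ?L k i))" .
qed


section \<open>The classical limit\<close>

text \<open>\<open>eta0\<close> at the level of symbols.\<close>

definition symbol0 :: "(('n \<Rightarrow>\<^sub>0 nat) \<Rightarrow>\<^sub>0 'k::zero fps) \<Rightarrow> (('n \<Rightarrow>\<^sub>0 nat) \<Rightarrow>\<^sub>0 'k)" where
  "symbol0 a = pm_map (\<lambda>f. fps_nth f 0) a"

lemma lookup_symbol0: "pm_lookup (symbol0 a) \<alpha> = fps_nth (pm_lookup a \<alpha>) 0"
  by (simp add: symbol0_def Poly_Mapping.map.rep_eq when_def)

lemma eta0_symbol: "eta0 a = symbol0 (symbol a)"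
  by (simp add: eta0_def symbol0_def)

lemma symbol0_add: "symbol0 (a + b) = symbol0 a + symbol0 b"
  by (rule poly_mapping_eqI) (simp add: lookup_symbol0 lookup_add)

lemma symbol0_single: "symbol0 (pm_single \<alpha> c) = pm_single \<alpha> (fps_nth c 0)"
  by (rule poly_mapping_eqI) (simp add: lookup_symbol0 lookup_single when_def)

lemma symbol0_zero: "symbol0 0 = 0"
  by (rule poly_mapping_eqI) (simp add: lookup_symbol0)

lemma symbol0_coeff_mult: "symbol0 (pm_single 0 c * m) = pm_single 0 (fps_nth c 0) * symbol0 (m :: ('n \<Rightarrow>\<^sub>0 nat) \<Rightarrow>\<^sub>0 'k::comm_ring_1 fps)"
  by (rule poly_mapping_eqI) (simp add: lookup_symbol0 lookup_coeff_mult)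

lemma symbol0_gen:
  fixes b :: "('n::{finite,linorder} \<Rightarrow>\<^sub>0 nat) \<Rightarrow>\<^sub>0 'n mero fps"
  shows "symbol0 (ore_gen hbar_deriv i b) = pm_single (pm_single i 1) 1 * symbol0 b"
  by (rule poly_mapping_eqI) (simp only: lookup_symbol0 lookup_gen lookup_var_mult, simp)

lemma symbol0_monom:
  fixes b :: "('n::{finite,linorder} \<Rightarrow>\<^sub>0 nat) \<Rightarrow>\<^sub>0 'n mero fps"
  shows "symbol0 (ore_monom hbar_deriv \<alpha> b) = pm_single \<alpha> 1 * symbol0 b"
proof (induction \<alpha> rule: multiidx_induct)
  case (step \<alpha> i)
  have "pm_single (pm_single i 1) 1 * pm_single \<alpha> 1 = (pm_single (\<alpha> + pm_single i 1) 1 :: ('n \<Rightarrow>\<^sub>0 nat) \<Rightarrow>\<^sub>0 'n mero)"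
    by (simp add: mult_single add.commute)
  then show ?case unfolding hbar.monom_step symbol0_gen step by (simp only: mult.assoc[symmetric])
qed (simp add: hbar.monom_zero)

lemma symbol0_mult:
  fixes a b :: "('n::{finite,linorder} \<Rightarrow>\<^sub>0 nat) \<Rightarrow>\<^sub>0 'n mero fps"
  shows "symbol0 (ore_mult hbar_deriv a b) = symbol0 a * symbol0 b"
proof (induction a rule: pm_add_induct)
  case (single \<alpha> c)
  have "pm_single 0 (fps_nth c 0) * pm_single \<alpha> 1 = pm_single \<alpha> (fps_nth c 0)" by (simp add: mult_single)
  then show ?case by (simp add: hbar.mult_single' symbol0_coeff_mult symbol0_monom symbol0_single mult.assoc[symmetric])
qed (simp_all add: hbar.mult_zero_left hbar.mult_add_left symbol0_zero symbol0_add distrib_right)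

lemma eta0_add: "eta0 (a + b) = eta0 a + eta0 b"
  by (simp add: eta0_symbol plus_quantum.rep_eq symbol0_add)

lemma eta0_zero: "eta0 0 = 0"
  by (simp add: eta0_symbol zero_quantum.rep_eq symbol0_zero)

lemma eta0_uminus: "eta0 (- a) = - eta0 a"
  using eta0_add[of a "- a"] by (simp add: eta0_zero minus_unique)

lemma eta0_mult: "eta0 (a * b) = eta0 a * eta0 b"
  by (simp add: eta0_symbol times_quantum.rep_eq symbol0_mult)

lemma deriv_p_add: "deriv_p i (a + b) = deriv_p i a + deriv_p i b"
  unfolding deriv_p_def by (rule setsum_keys_plus_distrib) (simp_all add: single_add algebra_simps)

lemma deriv_p_zero: "deriv_p i 0 = 0"
  by (simp add: deriv_p_def)

lemma deriv_p_single: "deriv_p i (pm_single \<alpha> c) = pm_single (\<alpha> - pm_single i 1) (of_nat (pm_lookup \<alpha> i) * c)"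
  by (simp add: deriv_p_def)

lemma deriv_p_mult: "deriv_p i (a * b) = deriv_p i a * b + a * deriv_p i b"
proof (induction a rule: pm_add_induct)
  case (single \<alpha> c)
  show ?case
  proof (induction b rule: pm_add_induct)
    case (single \<beta> d)
    have shift: "pm_single (\<alpha> + \<beta> - pm_single i 1) (of_nat (pm_lookup \<alpha> i) * e) = pm_single (\<alpha> - pm_single i 1 + \<beta>) (of_nat (pm_lookup \<alpha> i) * e)"
      for \<alpha> \<beta> :: "'a \<Rightarrow>\<^sub>0 nat" and e :: "'a mero"
    proof (cases "pm_lookup \<alpha> i = 0")
      case False
      then have "\<alpha> + \<beta> - pm_single i 1 = \<alpha> - pm_single i 1 + \<beta>"
        by (intro poly_mapping_eqI) (auto simp: lookup_add lookup_minus lookup_single when_def)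
      then show ?thesis by simp
    qed simp
    have "deriv_p i (pm_single \<alpha> c * pm_single \<beta> d) =
       pm_single (\<alpha> + \<beta> - pm_single i 1) (of_nat (pm_lookup \<alpha> i) * (c * d)) +
       pm_single (\<beta> + \<alpha> - pm_single i 1) (of_nat (pm_lookup \<beta> i) * (c * d))"
      by (simp add: mult_single deriv_p_single single_add[symmetric] lookup_add algebra_simps add.commute[of \<beta>])
    then show ?case unfolding shift by (simp add: deriv_p_single mult_single algebra_simps)
  qed (simp_all add: deriv_p_zero deriv_p_add distrib_left)
qed (simp_all add: deriv_p_zero deriv_p_add distrib_right)

lemma lookup_deriv_x: "pm_lookup (deriv_x i a) \<alpha> = mero_deriv i (pm_lookup a \<alpha>)"
  by (simp add: deriv_x_def Poly_Mapping.map.rep_eq when_def)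

lemma deriv_x_add: "deriv_x i (a + b) = deriv_x i a + deriv_x i b"
  by (rule poly_mapping_eqI) (simp add: lookup_deriv_x lookup_add mero_deriv_add)

lemma deriv_x_zero: "deriv_x i 0 = 0"
  by (rule poly_mapping_eqI) (simp add: lookup_deriv_x)

lemma deriv_x_single: "deriv_x i (pm_single \<alpha> c) = pm_single \<alpha> (mero_deriv i c)"
  by (rule poly_mapping_eqI) (simp add: lookup_deriv_x lookup_single when_def)

lemma deriv_x_mult: "deriv_x i (a * b) = deriv_x i a * b + a * deriv_x i b"
proof (induction a rule: pm_add_induct)
  case (single \<alpha> c)
  show ?case
    by (induction b rule: pm_add_induct)
      (simp_all add: deriv_x_zero deriv_x_add distrib_left mult_single deriv_x_single mero_deriv_mult single_add)
qed (simp_all add: deriv_x_zero deriv_x_add distrib_right)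

lemma poisson_antisym: "poisson b a = - poisson a b"
  by (simp add: poisson_def sum_negf[symmetric] algebra_simps)

lemma poisson_add: "poisson (a + a') b = poisson a b + poisson a' b"
  by (simp add: poisson_def deriv_p_add deriv_x_add sum.distrib[symmetric] algebra_simps)

lemma poisson_mult: "poisson (a * a') b = a * poisson a' b + poisson a b * a'"
  by (simp add: poisson_def deriv_p_mult deriv_x_mult sum.distrib[symmetric] sum_distrib_left sum_distrib_right algebra_simps)

lemma quantum_induct [case_names coeff p_hat add mult]:
  fixes a :: "'n::{finite,linorder} quantum"
  assumes c: "\<And>f. P (coeff_q f)" and p: "\<And>i. P (p_hat i)"
    and add: "\<And>a b. P a \<Longrightarrow> P b \<Longrightarrow> P (a + b)" and mult: "\<And>a b. P a \<Longrightarrow> P b \<Longrightarrow> P (a * b)"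
  shows "P a"
proof -
  have mon: "P (Quantum (pm_single \<alpha> 1))" for \<alpha> :: "'n \<Rightarrow>\<^sub>0 nat"
  proof (induction \<alpha> rule: multiidx_induct)
    case zero
    then show ?case using c[of 1] by (simp add: coeff_q_def)
  next
    case (step \<alpha> i)
    have "p_hat i * Quantum (pm_single \<alpha> 1) = Quantum (pm_single (\<alpha> + pm_single i 1) 1)"
      unfolding symbol_inject[symmetric] times_quantum.rep_eq p_hat.rep_eq Quantum_inverse[OF UNIV_I] hbar.mult_single' ore_monom_single
      by (simp add: ore_gen_def hbar.map_D_single mult_single add.commute)
    then show ?case using mult[OF p step] by metis
  qed
  have "P (Quantum b)" for b
  proof (induction b rule: pm_add_induct)
    case zero
    then show ?case using c[of 0] by (simp add: coeff_q_def)
  next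
    case (single \<alpha> f)
    have "coeff_q f * Quantum (pm_single \<alpha> 1) = Quantum (pm_single \<alpha> f)"
      unfolding symbol_inject[symmetric] times_quantum.rep_eq coeff_q_def Quantum_inverse[OF UNIV_I]
      by (simp add: hbar.mult_single' hbar.monom_zero mult_single)
    then show ?case using mult[OF c mon] by metis
  next
    case (add a b)
    have "Quantum a + Quantum b = Quantum (a + b)"
      unfolding symbol_inject[symmetric] plus_quantum.rep_eq by (simp add: Quantum_inverse)
    then show ?case using assms(3)[OF add] by metis
  qed
  then show ?thesis by (metis symbol_inverse)
qed

lemma hbar_cancel:
  assumes "hbar_q * a = hbar_q * b" shows "a = b"
proof -
  have s: "symbol (hbar_q * c) = pm_single 0 fps_X * symbol c" for c :: "'a quantum"
    by (simp add: times_quantum.rep_eq hbar_q_def coeff_q_def Quantum_inverse hbar.mult_single' hbar.monom_zero)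
  have "fps_nth (pm_lookup (symbol (hbar_q * c)) \<alpha>) (Suc k) = fps_nth (pm_lookup (symbol c) \<alpha>) k" for c :: "'a quantum" and \<alpha> k
    unfolding s lookup_coeff_mult by simp
  then show ?thesis
    using assms by (intro quantum_eqI poly_mapping_eqI fps_ext) metis
qed

text \<open>Commutator and Poisson bracket are biderivations, so this relation is stable under sums and products in either argument. It is therefore
  enough to verify it on functions and momenta.\<close>

definition has_bracket :: "'n::{finite,linorder} quantum \<Rightarrow> 'n quantum \<Rightarrow> bool" where
  "has_bracket a b \<longleftrightarrow> (\<exists>c. commutator a b = hbar_q * c \<and> poisson (eta0 a) (eta0 b) = eta0 c)"

lemma has_bracket_sym: "has_bracket a b \<Longrightarrow> has_bracket b a"
  unfolding has_bracket_def
proof (elim exE conjE)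
  fix c assume "commutator a b = hbar_q * c" "poisson (eta0 a) (eta0 b) = eta0 c"
  moreover have "commutator b a = - commutator a b" by (simp add: commutator_def)
  ultimately show "\<exists>c. commutator b a = hbar_q * c \<and> poisson (eta0 b) (eta0 a) = eta0 c"
    by (intro exI[of _ "- c"]) (simp add: poisson_antisym[of "eta0 b"] eta0_uminus)
qed

lemma has_bracket_add: "has_bracket a b \<Longrightarrow> has_bracket a' b \<Longrightarrow> has_bracket (a + a') b"
  unfolding has_bracket_def
proof (elim exE conjE)
  fix c c' assume "commutator a b = hbar_q * c" "poisson (eta0 a) (eta0 b) = eta0 c"
    "commutator a' b = hbar_q * c'" "poisson (eta0 a') (eta0 b) = eta0 c'"
  moreover have "commutator (a + a') b = commutator a b + commutator a' b"
    by (simp add: commutator_def algebra_simps)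
  ultimately show "\<exists>c. commutator (a + a') b = hbar_q * c \<and> poisson (eta0 (a + a')) (eta0 b) = eta0 c"
    by (intro exI[of _ "c + c'"]) (simp add: eta0_add poisson_add distrib_left)
qed

lemma has_bracket_mult: "has_bracket a b \<Longrightarrow> has_bracket a' b \<Longrightarrow> has_bracket (a * a') b"
  unfolding has_bracket_def
proof (elim exE conjE)
  fix c c' assume 1: "commutator a b = hbar_q * c" "poisson (eta0 a) (eta0 b) = eta0 c"
    "commutator a' b = hbar_q * c'" "poisson (eta0 a') (eta0 b) = eta0 c'"
  have "commutator (a * a') b = a * commutator a' b + commutator a b * a'"
    by (simp add: commutator_def algebra_simps)
  also have "\<dots> = hbar_q * (a * c') + hbar_q * (c * a')"
    unfolding 1 mult.assoc[symmetric] hbar_central[of a] ..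
  finally show "\<exists>c. commutator (a * a') b = hbar_q * c \<and> poisson (eta0 (a * a')) (eta0 b) = eta0 c"
    using 1 by (intro exI[of _ "a * c' + c * a'"]) (simp add: eta0_add eta0_mult poisson_mult distrib_left)
qed

lemma eta0_coeff: "eta0 (coeff_q f) = pm_single 0 (fps_nth f 0)"
  by (simp add: eta0_symbol coeff_q_def Quantum_inverse symbol0_single)

lemma eta0_p_hat: "eta0 (p_hat i) = pm_single (pm_single i 1) 1"
  by (simp add: eta0_symbol p_hat.rep_eq symbol0_single)

lemma mero_deriv_one: "mero_deriv i 1 = 0"
  using mero_deriv_mult[of i 1 1] by simp

lemma has_bracket_p_coeff: "has_bracket (p_hat i) (coeff_q f)"
proof -
  let ?d = "Abs_fps (\<lambda>k. mero_deriv i (fps_nth f k))"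
  have "symbol (p_hat i * coeff_q f) = symbol (coeff_q f * p_hat i + coeff_q (hbar_deriv i f))"
    unfolding times_quantum.rep_eq plus_quantum.rep_eq p_hat.rep_eq coeff_q_def Quantum_inverse[OF UNIV_I] hbar.mult_single' ore_monom_single
    by (simp add: ore_gen_def hbar.map_D_single mult_single hbar.monom_zero)
  then have "commutator (p_hat i) (coeff_q f) = hbar_q * coeff_q ?d"
    by (simp add: symbol_inject commutator_def hbar_deriv_def hbar_q_def coeff_q_mult)
  moreover have "poisson (eta0 (p_hat i)) (eta0 (coeff_q f)) = eta0 (coeff_q ?d)"
    unfolding poisson_def eta0_p_hat eta0_coeff deriv_p_single deriv_x_single
    by (rule sum_UNIV_eq[where c = i]) (simp_all add: lookup_single when_def mult_single)
  ultimately show ?thesis unfolding has_bracket_def by blast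
qed

lemma has_bracket_coeff_coeff: "has_bracket (coeff_q f) (coeff_q h)"
proof -
  have "poisson (eta0 (coeff_q f)) (eta0 (coeff_q h)) = eta0 0"
    by (simp add: poisson_def eta0_coeff eta0_zero deriv_p_single)
  then show ?thesis unfolding has_bracket_def
    by (intro exI[of _ 0]) (simp add: commutator_def coeff_q_mult mult.commute)
qed

lemma has_bracket_p_p: "has_bracket (p_hat i) (p_hat j)"
proof -
  have "poisson (eta0 (p_hat i)) (eta0 (p_hat j)) = eta0 0"
    by (simp add: poisson_def eta0_p_hat eta0_zero deriv_x_single mero_deriv_one)
  then show ?thesis unfolding has_bracket_def
    by (intro exI[of _ 0]) (simp add: commutator_def p_hat_commute)
qed

lemma has_bracket: "has_bracket a b"
proof (induction a rule: quantum_induct)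
  case (coeff f)
  show ?case
  proof (rule has_bracket_sym, induction b rule: quantum_induct)
    case (coeff h) show ?case by (rule has_bracket_coeff_coeff)
  next
    case (p_hat i) show ?case by (rule has_bracket_p_coeff)
  qed (auto intro: has_bracket_add has_bracket_mult)
next
  case (p_hat i)
  show ?case
  proof (rule has_bracket_sym, induction b rule: quantum_induct)
    case (coeff h) show ?case by (rule has_bracket_sym) (rule has_bracket_p_coeff)
  next
    case (p_hat j) show ?case by (rule has_bracket_p_p)
  qed (auto intro: has_bracket_add has_bracket_mult)
qed (auto intro: has_bracket_add has_bracket_mult)

lemma poisson_eta0:
  assumes "commutator a b = hbar_q * c"
  shows "poisson (eta0 a) (eta0 b) = eta0 c"
  using has_bracket[of a b] assms hbar_cancel unfolding has_bracket_def by metis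

lemma crossed_hbar_cancel:
  fixes a :: "('n::{finite,linorder}, 'd::finite) crossed"
  assumes "scal hbar_q * a = 0" shows "a = 0"
proof (rule crossed_eqI, rule sqmat_eqI)
  fix w s t
  have "hbar_q * entry (crossed_coeff a w) s t = entry (crossed_coeff (scal hbar_q * a) w) s t"
    by (simp add: scal_def coeff_emb_mult scalar_mat_mult_left)
  also have "\<dots> = hbar_q * 0" by (simp add: assms zero_crossed.rep_eq zero_sqmat.rep_eq)
  finally have "entry (crossed_coeff a w) s t = 0" by (rule hbar_cancel)
  then show "entry (crossed_coeff a w) s t = entry (crossed_coeff 0 w) s t"
    by (simp add: zero_crossed.rep_eq zero_sqmat.rep_eq)
qed

lemma map_mat_add:
  fixes A B :: "('a::ring_1, 'k::finite) sqmat" and h :: "'a \<Rightarrow> 'b::ring_1"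
  assumes "\<And>x y. h (x + y) = h x + h y"
  shows "map_mat h (A + B) = map_mat h A + map_mat h B"
  by (rule sqmat_eqI) (simp add: map_mat_def plus_sqmat.rep_eq assms)

lemma map_mat_mult:
  fixes A B :: "('a::ring_1, 'k::finite) sqmat" and h :: "'a \<Rightarrow> 'b::ring_1"
  assumes "\<And>x y. h (x + y) = h x + h y" "\<And>x y. h (x * y) = h x * h y"
  shows "map_mat h (A * B) = map_mat h A * map_mat h B"
proof -
  have z: "h 0 = 0" using assms(1)[of 0 0] by simp
  have s: "h (sum f S) = (\<Sum>x\<in>S. h (f x))" for f :: "'k \<Rightarrow> 'a" and S
    by (induction S rule: infinite_finite_induct) (simp_all add: z assms(1))
  show ?thesis
    by (rule sqmat_eqI) (simp add: map_mat_def times_sqmat.rep_eq s assms(2))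
qed

lemma map_mat_commutator:
  fixes A B :: "('a::ring_1, 'k::finite) sqmat" and h :: "'a \<Rightarrow> 'b::ring_1"
  assumes "\<And>x y. h (x + y) = h x + h y" "\<And>x y. h (x * y) = h x * h y"
  shows "map_mat h (commutator A B) = commutator (map_mat h A) (map_mat h B)"
proof -
  have "map_mat h (commutator A B) + map_mat h (B * A) = map_mat h (A * B)"
    by (simp add: map_mat_add[of h, OF assms(1), symmetric] commutator_def)
  then show ?thesis by (simp add: map_mat_mult[of h, OF assms] commutator_def eq_diff_eq)
qed

section \<open>The Lax pairs\<close>

lemma vperm_theta_regular_set: "l \<in> theta_regular_set \<tau> d \<Longrightarrow> vperm w l \<in> theta_regular_set \<tau> d"
  by (auto simp: theta_regular_set_def vperm_def apply_inj)

text \<open>The first set gives commuting Dunkl operators. The second one, with \<open>d = 1\<close>, excludes differences in the lattice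
  \<open>\<int> + \<tau> \<int>\<close>, at which the Weierstrass function has its poles.\<close>

definition generic :: "complex \<Rightarrow> nat \<Rightarrow> (complex^'n) set" where
  "generic \<tau> d = theta_regular_set \<tau> d \<inter> theta_regular_set \<tau> 1"

lemma generic_dense:
  assumes "Im \<tau> > 0" "d > 0" shows "closure (generic \<tau> d :: (complex^'n) set) = UNIV"
  unfolding generic_def
  by (rule dense_Int) (simp_all add: theta_regular_set_open_dense assms)

lemma generic_not_lattice: "l \<in> generic \<tau> d \<Longrightarrow> i \<noteq> j \<Longrightarrow> l $ i - l $ j \<notin> lattice \<tau>"
  using theta_regular_imp_not_lattice by (auto simp: generic_def theta_regular_set_def)

text \<open>A decomposition of \<open>h\<^sub>r(\<lambda>, y)\<close> on a fixed open set of spectral variables.\<close>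

locale eCM_family =
  fixes \<tau> g :: complex and r :: nat and H :: "'n::{finite,linorder} quantum"
    and a :: "complex^('n::{finite,linorder}) \<Rightarrow> ('n, 'd::{finite,linorder}) crossed" and N :: "(complex^('n::{finite,linorder})) set"
  assumes tau: "Im \<tau> > 0" and H: "\<And>w. perm_q w H = H" and N: "open N" and reg: "regular_crossed N a"
    and split: "\<And>l. l \<in> N \<Longrightarrow> l \<in> generic \<tau> CARD('d) \<Longrightarrow> eCM_dunkl \<tau> g r l = scal H + scal hbar_q * a l"
begin

lemma dim_pos: "CARD('d) > 0" by simp

text \<open>For generic \<open>l\<close> the difference of \<open>w a(l)\<close> and \<open>a(w l) w\<close> is killed by \<open>\<hbar>\<close>, by equivariance of \<open>h\<^sub>r(\<lambda>, y)\<close> and invariance of \<open>H\<close>,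
  and \<open>\<hbar>\<close> can be cancelled. The limit at a fixed point of \<open>w\<close> is the claim.\<close>

lemma hat_a:
  assumes l: "l \<in> N" "vperm w l = l"
  shows "hat w * a l = a l * hat w"
proof -
  let ?N = "N \<inter> vperm w -` N"
  let ?F = "\<lambda>l. hat w * a l - a (vperm w l) * hat w"
  have "?F l = 0"
  proof (rule regular_crossed_limit[where F = ?F and N = ?N and G = "generic \<tau> CARD('d)"])
    show "regular_crossed ?N ?F"
      by (intro regular_crossed_diff regular_crossed_mult regular_crossed_const
          regular_crossed_subset[OF reg] regular_crossed_subset[OF regular_crossed_vperm[OF reg, of w]]) auto
    show "open ?N" using N open_vperm[OF N] by blast
    show "closure (generic \<tau> CARD('d)) = UNIV" by (rule generic_dense[OF tau dim_pos])
    show "l \<in> ?N" using l by simp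
    fix l assume l: "l \<in> ?N" "l \<in> generic \<tau> CARD('d)"
    then have l': "vperm w l \<in> generic \<tau> CARD('d)" by (simp add: generic_def vperm_theta_regular_set)
    have e: "hat w * eCM_dunkl \<tau> g r l = eCM_dunkl \<tau> g r (vperm w l) * (hat w :: ('n, 'd) crossed)"
      by (rule hat_eCM_dunkl[OF tau]) (use l in \<open>simp add: generic_def\<close>)
    have s: "eCM_dunkl \<tau> g r l = scal H + scal hbar_q * a l" "eCM_dunkl \<tau> g r (vperm w l) = scal H + scal hbar_q * a (vperm w l)"
      using split l l' by auto
    have "hat w * (scal hbar_q * a l) = scal hbar_q * (hat w * a l)"
      by (simp only: mult.assoc[symmetric] hat_scal perm_q_hbar)
    then have "scal hbar_q * ?F l = 0"
      using e unfolding s by (simp add: distrib_left distrib_right right_diff_distrib hat_scal H mult.assoc)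
    then show "?F l = 0" by (rule crossed_hbar_cancel)
  qed
  then show ?thesis using l by simp
qed

text \<open>Both \<open>a\<close> and \<open>y\<^sub>1\<close> are regular near \<open>\<lambda>\<^sup>0\<close>, although the sum \<open>H + \<hbar> a\<close> agrees with \<open>h\<^sub>r(\<lambda>, y)\<close> at generic points only.\<close>

lemma lax_crossed:
  assumes \<mu>: "theta_regular \<tau> CARD('d) \<mu>" "special_point \<mu> \<in> N"
  shows "commutator (scal H + scal hbar_q * a (special_point \<mu>)) (dunkl \<tau> g (special_point \<mu>) first) = 0"
proof -
  let ?M = "\<Inter>j\<in>UNIV - {first}. {l :: (complex, 'n) vec. theta_regular \<tau> CARD('d) (l $ first - l $ j)}"
  let ?F = "\<lambda>l. commutator (scal H + scal hbar_q * a l) (dunkl \<tau> g l first)"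
  show ?thesis
  proof (rule regular_crossed_limit[where F = ?F and N = "N \<inter> ?M" and G = "generic \<tau> CARD('d)"])
    have a: "regular_crossed (N \<inter> ?M) a" by (rule regular_crossed_subset[OF reg]) blast
    have y: "regular_crossed (N \<inter> ?M) (\<lambda>l. dunkl \<tau> g l first :: ('n, 'd) crossed)"
      by (rule dunkl_regular[OF tau]) auto
    show "regular_crossed (N \<inter> ?M) ?F"
      unfolding commutator_def
      by (intro regular_crossed_diff regular_crossed_mult regular_crossed_add regular_crossed_const a y)
    have "open {l :: (complex, 'n) vec. theta_regular \<tau> CARD('d) (l $ first - l $ j)}" for j
    proof -
      have T: "Im (of_nat CARD('d) * \<tau>) > 0" using tau by simp
      have "open {l :: (complex, 'n) vec. theta (l $ first - l $ j + of_int m * \<tau>) (of_nat CARD('d) * \<tau>) \<noteq> 0}" for m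
        using mholo_nonzero_open[OF mholo_comp[OF mholo_diff[OF mholo_coord[OF open_UNIV] mholo_coord[OF open_UNIV]] theta_shift_holomorphic[OF T]]]
        by simp
      then have "open (\<Inter>m\<in>{0..<int CARD('d)}. {l :: (complex, 'n) vec. theta (l $ first - l $ j + of_int m * \<tau>) (of_nat CARD('d) * \<tau>) \<noteq> 0})"
        by (intro open_INT) auto
      moreover have "{l :: (complex, 'n) vec. theta_regular \<tau> CARD('d) (l $ first - l $ j)} =
         (\<Inter>m\<in>{0..<int CARD('d)}. {l. theta (l $ first - l $ j + of_int m * \<tau>) (of_nat CARD('d) * \<tau>) \<noteq> 0})"
        unfolding theta_regular_finite[OF dim_pos] by auto
      ultimately show ?thesis by simp
    qed
    then show "open (N \<inter> ?M)" using N by (intro open_Int open_INT) auto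
    show "closure (generic \<tau> CARD('d)) = UNIV" by (rule generic_dense[OF tau dim_pos])
    show "special_point \<mu> \<in> N \<inter> ?M" using \<mu> by (auto simp: special_point_def)
    fix l assume l: "l \<in> N \<inter> ?M" "l \<in> generic \<tau> CARD('d)"
    then have "eCM_dunkl \<tau> g r l = scal H + scal hbar_q * a l" using split by blast
    moreover have "eCM_dunkl \<tau> g r l * dunkl \<tau> g l first = dunkl \<tau> g l first * (eCM_dunkl \<tau> g r l :: ('n, 'd) crossed)"
      by (rule eCM_dunkl_commute[OF tau]) (use l in \<open>simp add: generic_def\<close>)
    ultimately show "?F l = 0" by (simp add: commutator_def)
  qed
qed

context
  fixes \<mu> :: complex and y AA LL
  defines "y \<equiv> dunkl \<tau> g (special_point \<mu>) first :: ('n, 'd) crossed"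
  defines "AA \<equiv> rep_matrix (a (special_point \<mu>))"
  defines "LL \<equiv> rep_matrix y"
  assumes \<mu>: "theta_regular \<tau> CARD('d) \<mu>" "special_point \<mu> \<in> N"
begin

lemma quantum_lax:
  "commutator (scalar_mat (scalar_mat H)) LL = scalar_mat (scalar_mat hbar_q) * commutator LL AA"
proof -
  have "represents y LL"
    unfolding LL_def y_def by (rule represents_rep_matrix) (rule hat_dunkl_special_point[OF tau])
  have A: "represents (a (special_point \<mu>)) AA"
    unfolding AA_def by (rule represents_rep_matrix) (rule hat_a[OF \<mu>(2) vperm_special_point])
  let ?h = "scalar_mat (scalar_mat hbar_q) :: (('n, 'd) qEnd, 'n) sqmat"
  let ?H = "scalar_mat (scalar_mat H) :: (('n, 'd) qEnd, 'n) sqmat"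
  let ?z = "scal H + scal hbar_q * a (special_point \<mu>)"
  have Z: "represents ?z (?H + ?h * AA)"
    by (intro represents_add represents_mult represents_scal A H perm_q_hbar)
  have "?z * y = y * ?z" using lax_crossed[OF \<mu>] by (simp add: commutator_def y_def)
  then have "(?H + ?h * AA) * LL = LL * (?H + ?h * AA)"
    using represents_mult[OF Z \<open>represents y LL\<close>] represents_mult[OF \<open>represents y LL\<close> Z] represents_unique by metis
  moreover have "LL * (?h * AA) = ?h * (LL * AA)"
  proof -
    have "?h * LL = LL * ?h" by (intro scalar_mat_central hbar_central)
    then show ?thesis by (simp only: mult.assoc[symmetric])
  qed
  ultimately show ?thesis by (simp add: commutator_def algebra_simps)
qed

lemma classical_lax:
  "map_mat (map_mat (poisson (eta0 H))) (map_mat (map_mat eta0) LL) =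
     commutator (map_mat (map_mat eta0) LL) (map_mat (map_mat eta0) AA)"
proof -
  have "map_mat (map_mat eta0) (commutator LL AA) = commutator (map_mat (map_mat eta0) LL) (map_mat (map_mat eta0) AA)"
    by (rule map_mat_commutator) (intro map_mat_add map_mat_mult eta0_add eta0_mult)+
  moreover have "poisson (eta0 H) (eta0 (entry (entry LL i j) s t)) = eta0 (entry (entry (commutator LL AA) i j) s t)" for i j s t
  proof (rule poisson_eta0)
    have "commutator H (entry (entry LL i j) s t) = entry (entry (commutator (scalar_mat (scalar_mat H)) LL) i j) s t"
      by (simp add: commutator_def minus_sqmat.rep_eq scalar_mat_mult_left scalar_mat_mult_right)
    also have "\<dots> = hbar_q * entry (entry (commutator LL AA) i j) s t"
      unfolding quantum_lax by (simp add: scalar_mat_mult_left)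
    finally show "commutator H (entry (entry LL i j) s t) = hbar_q * entry (entry (commutator LL AA) i j) s t" .
  qed
  ultimately have e: "commutator (map_mat (map_mat eta0) LL) (map_mat (map_mat eta0) AA) = map_mat (map_mat eta0) (commutator LL AA)"
    and p: "\<And>i j s t. poisson (eta0 H) (eta0 (entry (entry LL i j) s t)) = eta0 (entry (entry (commutator LL AA) i j) s t)"
    by simp_all
  show ?thesis
    unfolding e by (rule sqmat_eqI, rule sqmat_eqI) (simp add: map_mat_def p)
qed

end

end


lemma eCM_familyI:
  assumes "Im \<tau> > 0" "eCM_decomposition \<tau> g Ht r H (a :: _ \<Rightarrow> ('n::{finite,linorder}, 'd::{finite,linorder}) crossed)"
  obtains N where "open N" "0 \<in> N" "eCM_family \<tau> g r H a N"
proof -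
  obtain N where N: "open N" "0 \<in> N" "regular_crossed N a"
    "\<forall>l\<in>N. (\<forall>i j. i \<noteq> j \<longrightarrow> l $ i - l $ j \<notin> lattice \<tau>) \<longrightarrow> eCM_dunkl \<tau> g r l = scal H + scal hbar_q * a l"
    using assms(2) unfolding eCM_decomposition_def by blast
  have "eCM_family \<tau> g r H a N"
  proof
    show "perm_q w H = H" for w
      using assms(2) by (simp add: eCM_decomposition_def W_invariant_def)
    show "eCM_dunkl \<tau> g r l = scal H + scal hbar_q * a l" if "l \<in> N" "l \<in> generic \<tau> CARD('d)" for l
      using N(4) that generic_not_lattice by blast
  qed (fact assms(1) N)+
  with N that show ?thesis by blast
qed

lemma eventually_special_point:
  fixes N :: "(complex^('n::{finite,linorder})) set"
  assumes "open N" "0 \<in> N" shows "\<forall>\<^sub>F \<mu> in at 0. special_point \<mu> \<in> N"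
proof -
  have "special_point \<mu> = (axis first \<mu> :: (complex, 'n) vec)" for \<mu>
    by (simp add: special_point_def axis_def)
  then have "continuous_on UNIV (special_point :: complex \<Rightarrow> (complex, 'n) vec)"
    using continuous_axis[of "first :: 'n"] by (metis ext)
  then have "open (special_point -` N)" by (rule open_vimage[OF assms(1)])
  moreover have "(special_point 0 :: (complex, 'n) vec) = 0" by (simp add: special_point_def vec_eq_iff)
  ultimately have "\<forall>\<^sub>F \<mu> in nhds 0. \<mu> \<in> special_point -` N"
    using assms(2) by (intro eventually_nhds_in_open) auto
  then have "\<forall>\<^sub>F \<mu> in at 0. \<mu> \<in> special_point -` N"
    by (rule filter_leD[OF at_within_le_nhds])
  then show ?thesis by simp
qed

theorem mainTheorem4:
  fixes \<tau> g :: complex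
    and Ht H :: "nat \<Rightarrow> 'n::{finite,linorder} quantum"
    and a :: "nat \<Rightarrow> complex^('n::{finite,linorder}) \<Rightarrow> ('n, 'd::{finite,linorder}) crossed"
  assumes "Im \<tau> > 0"
    and "quantum_eCM_lifts \<tau> g Ht"
    and "\<And>r. r \<in> {1..CARD('n)} \<Longrightarrow> eCM_decomposition \<tau> g Ht r (H r) (a r)"
  shows "\<forall>\<^sub>F \<mu> in at 0.
    let l0 = special_point \<mu>;
        y1 = dunkl \<tau> g l0 first :: ('n, 'd) crossed;
        LL = rep_matrix y1;
        AA = (\<lambda>r. rep_matrix (a r l0));
        L = map_mat (map_mat eta0) LL;
        A = (\<lambda>r. map_mat (map_mat eta0) (AA r))
    in (\<forall>w\<in>W_prime. hat w * y1 = y1 * hat w) \<and>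
       (\<forall>r\<in>{1..CARD('n)}. \<forall>w\<in>W_prime. hat w * a r l0 = a r l0 * hat w) \<and>
       (\<forall>i j. i \<noteq> j \<longrightarrow> entry LL i j = - (scalar_mat (const_q g) * R_op \<tau> i j \<mu>)) \<and>
       (\<forall>i. entry LL i i = scalar_mat (p_hat i)) \<and>
       (\<forall>r\<in>{1..CARD('n)}.
          commutator (scalar_mat (scalar_mat (H r))) LL = 
            scalar_mat (scalar_mat hbar_q) * commutator LL (AA r)) \<and>
       (\<forall>r\<in>{1..CARD('n)}.
          map_mat (map_mat (poisson (eta0 (H r)))) L = commutator L (A r))"
proof -
  note tau = assms(1)
  have d: "CARD('d) > 0" by simp
  have "\<exists>N. open N \<and> 0 \<in> N \<and> eCM_family \<tau> g r (H r) (a r) N" if "r \<in> {1..CARD('n)}" for r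
    using eCM_familyI[OF tau assms(3)[OF that]] by metis
  then obtain N where N: "\<And>r. r \<in> {1..CARD('n)} \<Longrightarrow> open (N r) \<and> 0 \<in> N r \<and> eCM_family \<tau> g r (H r) (a r) (N r)"
    by metis
  have "\<forall>\<^sub>F \<mu> in at 0. \<forall>r\<in>{1..CARD('n)}. special_point \<mu> \<in> N r"
    by (intro eventually_ball_finite ballI eventually_special_point) (use N in auto)
  with theta_regular_punctured_neighbourhood[OF tau d] show ?thesis
  proof eventually_elim
    case (elim \<mu>)
    let ?y = "dunkl \<tau> g (special_point \<mu>) first :: ('n, 'd) crossed"
    let ?L = "Sqmat (\<lambda>i j. if i = j then scalar_mat (p_hat i) else - (scalar_mat (const_q g) * R_op \<tau> i j \<mu>)) :: (('n, 'd) qEnd, 'n) sqmat"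
    have L: "rep_matrix ?y = ?L" by (rule rep_matrix_eqI[OF represents_dunkl[OF tau]])
    have fam: "eCM_family \<tau> g r (H r) (a r) (N r)" "special_point \<mu> \<in> N r" if "r \<in> {1..CARD('n)}" for r
      using N elim that by blast+
    show ?case
      unfolding Let_def
    proof (intro conjI ballI allI impI)
      fix w :: "'n perm" assume w: "w \<in> W_prime"
      show "hat w * ?y = ?y * hat w" by (rule hat_dunkl_special_point[OF tau w])
    next
      fix r and w :: "'n perm" assume "r \<in> {1..CARD('n)}" "w \<in> W_prime"
      then show "hat w * a r (special_point \<mu>) = a r (special_point \<mu>) * hat w"
        using eCM_family.hat_a[OF fam] vperm_special_point by metis
    next
      fix i j :: 'n assume "i \<noteq> j"
      then show "entry (rep_matrix ?y) i j = - (scalar_mat (const_q g) * R_op \<tau> i j \<mu>)" by (simp add: L)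
    next
      show "entry (rep_matrix ?y) i i = scalar_mat (p_hat i)" for i by (simp add: L)
    next
      fix r assume r: "r \<in> {1..CARD('n)}"
      show "commutator (scalar_mat (scalar_mat (H r))) (rep_matrix ?y) =
          scalar_mat (scalar_mat hbar_q) * commutator (rep_matrix ?y) (rep_matrix (a r (special_point \<mu>)))"
        by (rule eCM_family.quantum_lax[OF fam(1)[OF r] elim(1) fam(2)[OF r]])
      show "map_mat (map_mat (poisson (eta0 (H r)))) (map_mat (map_mat eta0) (rep_matrix ?y)) =
          commutator (map_mat (map_mat eta0) (rep_matrix ?y)) (map_mat (map_mat eta0) (rep_matrix (a r (special_point \<mu>))))"
        by (rule eCM_family.classical_lax[OF fam(1)[OF r] elim(1) fam(2)[OF r]])
    qed
  qed
qed


end
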